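(* Let $q\in(1,\infty)$ and $t\in\mathbb R$, and let $s\mapsto p(s,t)$, $s\le t$, be the solution of $$p'(s)=-\frac{p(s)}{c(p(s),s)},\quad s\le t;\qquad p(t)=q,$$ where $c(p,s)=\frac{p}{p-1}\|Q^{1/2}(s,-\infty)B^*(s)^{-1}\|^2$. Then for $s<t$, $P_{s,t}$ maps $L^q(\mathbb R^n,\nu_t)$ into $L^{p(s,t)}(\mathbb R^n,\nu_s)$ and $$\|P_{s,t}\varphi\|_{L^{p(s,t)}(\mathbb R^n,\nu_s)}\le\|\varphi\|_{L^q(\mathbb R^n,\nu_t)},\qquad\varphi\in L^q(\mathbb R^n,\nu_t).$$
   Context: Let $n\ge 1$ and let $A,B:\mathbb R\to\mathcal L(\mathbb R^n)$, $f:\mathbb R\to\mathbb R^n$ be continuous and bounded (not necessarily periodic), with $\|B(t)x\|\ge \mu_0\|x\|$ for all $t,x$ and some $\mu_0>0$. Let $U(t,s)$ be the evolution operator of $\xi'=A(t)\xi$, and assume $\omega_0(U):=\inf\{\omega:\exists M,\ \|U(t,s)\|\le Me^{\omega(t-s)}\ \forall s\le t\}<0$. For $-\infty\le s<t$ let $Q(t,s)=\int_s^tU(t,r)B(r)B^*(r)U^*(t,r)dr$ ($Q^{1/2}$ its positive square root), $g(t,s)=\int_s^tU(t,r)f(r)dr$, and $\nu_t=\mathcal N_{g(t,-\infty),Q(t,-\infty)}$ (Gaussian measure on $\mathbb R^n$). For $s<t$, $P_{s,t}\varphi(x)=\int_{\mathbb R^n}\varphi(y)\,\mathcal N_{U(t,s)x+g(t,s),Q(t,s)}(dy)$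 for bounded continuous $\varphi$, extended by density to $L^q(\mathbb R^n,\nu_t)$. *)

theory Defs
  imports "HOL-Probability.Probability"
begin

definition mat_opnorm :: "real^'n^'m \<Rightarrow> real" where
  "mat_opnorm M = onorm (\<lambda>x. M *v x)"

definition msqrt :: "real^'n^'n \<Rightarrow> real^'n^'n" where
  "msqrt Q = (THE S. transpose S = S \<and> (\<forall>x. 0 \<le> x \<bullet> (S *v x)) \<and> S ** S = Q)"

definition std_gaussian :: "(real^'n) measure" where
  "std_gaussian = density lborel (\<lambda>x. ennreal (\<Prod>i\<in>UNIV. std_normal_density (x $ i)))"

definition gaussian_measure :: "real^'n \<Rightarrow> real^'n^'n \<Rightarrow> (real^'n) measure" where
  "gaussian_measure m Q = distr std_gaussian borel (\<lambda>x. m + msqrt Q *v x)"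

definition covQ :: "(real \<Rightarrow> real \<Rightarrow> real^'n^'n) \<Rightarrow> (real \<Rightarrow> real^'k^'n) \<Rightarrow> real \<Rightarrow> real \<Rightarrow> real^'n^'n" where
  "covQ U B t s = integral {s..t} (\<lambda>r. U t r ** B r ** transpose (B r) ** transpose (U t r))"

definition covQinf :: "(real \<Rightarrow> real \<Rightarrow> real^'n^'n) \<Rightarrow> (real \<Rightarrow> real^'k^'n) \<Rightarrow> real \<Rightarrow> real^'n^'n" where
  "covQinf U B t = integral {..t} (\<lambda>r. U t r ** B r ** transpose (B r) ** transpose (U t r))"

definition meanG :: "(real \<Rightarrow> real \<Rightarrow> real^'n^'n) \<Rightarrow> (real \<Rightarrow> real^'n) \<Rightarrow> real \<Rightarrow> real \<Rightarrow> real^'n" where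
  "meanG U f t s = integral {s..t} (\<lambda>r. U t r *v f r)"

definition meanGinf :: "(real \<Rightarrow> real \<Rightarrow> real^'n^'n) \<Rightarrow> (real \<Rightarrow> real^'n) \<Rightarrow> real \<Rightarrow> real^'n" where
  "meanGinf U f t = integral {..t} (\<lambda>r. U t r *v f r)"

definition nu :: "(real \<Rightarrow> real \<Rightarrow> real^'n^'n) \<Rightarrow> (real \<Rightarrow> real^'n^'n) \<Rightarrow> (real \<Rightarrow> real^'n) \<Rightarrow> real \<Rightarrow> (real^'n) measure" where
  "nu U B f t = gaussian_measure (meanGinf U f t) (covQinf U B t)"

definition Pst :: "(real \<Rightarrow> real \<Rightarrow> real^'n^'n) \<Rightarrow> (real \<Rightarrow> real^'n^'n) \<Rightarrow> (real \<Rightarrow> real^'n) \<Rightarrow> real \<Rightarrow> real \<Rightarrow> (real^'n \<Rightarrow> real) \<Rightarrow> real^'n \<Rightarrow> real" where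
  "Pst U B f s t \<phi> x = (\<integral>y. \<phi> y \<partial>gaussian_measure (U t s *v x + meanG U f t s) (covQ U B t s))"

definition cfun :: "(real \<Rightarrow> real \<Rightarrow> real^'n^'n) \<Rightarrow> (real \<Rightarrow> real^'n^'n) \<Rightarrow> real \<Rightarrow> real \<Rightarrow> real" where
  "cfun U B p s = p / (p - 1) * (mat_opnorm (msqrt (covQinf U B s) ** matrix_inv (transpose (B s))))\<^sup>2"

end

theory Submission
  imports Defs
begin

text \<open>
  Let \<open>(X, Y)\<close> be centred jointly Gaussian with \<open>X\<close> distributed as \<open>\<nu>\<^sub>s\<close> and \<open>Y = U(t,s) X + Z\<close>, where \<open>Z\<close> is
  independent of \<open>X\<close> with covariance \<open>Q(t,s)\<close>; then \<open>Y\<close> is distributed as \<open>\<nu>\<^sub>t\<close> (up to the means) and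
  \<open>P\<^sub>s\<^sub>,\<^sub>t \<phi>(X) = E[\<phi>(Y) | X]\<close>. Testing with \<open>\<psi> = (P \<phi>)\<^sup>p\<^sup>-\<^sup>1\<close>, the contraction property follows from
  \<open>E[F(X)\<^sup>\<alpha> G(Y)\<^sup>\<beta>] \<le> (E F(X))\<^sup>\<alpha> (E G(Y))\<^sup>\<beta>\<close> with \<open>\<alpha> = 1 - 1/p\<close> and \<open>\<beta> = 1/q\<close>.

  For smooth \<open>F\<close>, \<open>G\<close> bounded away from zero, split \<open>(X, Y)\<close> into \<open>N\<close> independent copies of \<open>N\<^sup>-\<^sup>1\<^sup>/\<^sup>2 (X, Y)\<close> and
  average them out one at a time. By Taylor expansion each average costs only \<open>O(N\<^sup>-\<^sup>3\<^sup>/\<^sup>2)\<close>, because the second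
  order term is nonpositive as soon as \<open>(p - 1) \<langle>Q\<^sub>s U\<^sup>* y, U\<^sup>* y\<rangle> \<le> (q - 1) \<langle>Q\<^sub>t y, y\<rangle>\<close>. The latter holds since
  \<open>r \<mapsto> (p(r) - 1) \<langle>Q\<^sub>r U(t,r)\<^sup>* y, U(t,r)\<^sup>* y\<rangle>\<close> is nondecreasing by the differential equation for \<open>p\<close>.
\<close>

section \<open>Square roots of positive definite matrices\<close>

text \<open>The two fixed times are compared directly: no norm of
  \<open>Pst U B f s t \<phi>\<close> is differentiated in \<open>s\<close>, and the equation for
  \<open>p\<close> enters only through one inequality between quadratic forms. What carries the
  averaging is uniformity: a step of size \<open>h\<close> must cost at most \<open>C h^3\<close>
  with one \<open>C\<close> for all functions met on the way. Hence the bounds \<open>e\<close> and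
  \<open>M\<close>, which keep relative fluctuations bounded, and a C11 condition whose constants do
  not grow under averaging. With \<open>m^2\<close> steps of size \<open>1/m\<close> the total error
  is \<open>C/m\<close>. The price is a chain of limits: Gaussian mollification leads to continuous
  functions, almost everywhere approximation to bounded measurable ones, and truncation with Fatou's
  lemma to all of \<open>L^q\<close>. The lower bound on \<open>B\<close> makes every covariance
  positive definite; this gives absolutely continuous laws for \<open>X\<close> and
  \<open>Y\<close>, as the second limit demands, and lets the definite description in
  \<open>msqrt\<close> denote the square root.\<close>

lemma inner_matrix_vector_left:
  fixes A :: "real^'n^'m"
  shows "(A *v x) \<bullet> y = x \<bullet> (transpose A *v y)"
  by (metis dot_lmul_matrix inner_commute vector_transpose_matrix)

text \<open>A zero of a nonnegative form is a minimum, so moving from \<open>x\<close> along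
  \<open>S *v x\<close> must not decrease it; the first-order change is \<open>2 e |S x|^2\<close>,
  which forces \<open>S *v x = 0\<close>.\<close>

lemma psd_quadratic_zero:
  fixes S :: "real^'n^'n"
  assumes sym: "transpose S = S" and psd: "\<And>x. 0 \<le> x \<bullet> (S *v x)" and z: "x \<bullet> (S *v x) = 0"
  shows "S *v x = 0"
proof -
  define a where "a = (S *v x) \<bullet> (S *v x)"
  define c where "c = (S *v x) \<bullet> (S *v (S *v x))"
  \<comment> \<open>Close to the minimiser \<open>- a / c\<close> of \<open>2 e a + e^2 c\<close>;
    the added 1 covers \<open>c = 0\<close>, and the value is still negative unless
    \<open>a = 0\<close>.\<close>
  define e where "e = - a / (c + 1)"
  have c0: "0 \<le> c" and a0: "0 \<le> a" unfolding c_def a_def using psd by auto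
  have "0 \<le> (x + e *\<^sub>R (S *v x)) \<bullet> (S *v (x + e *\<^sub>R (S *v x)))" by (rule psd)
  also have "\<dots> = 2 * e * a + e\<^sup>2 * c"
  proof -
    have "x \<bullet> (S *v (S *v x)) = a"
      using inner_matrix_vector_left[of S x "S *v x"] sym by (simp add: a_def)
    then show ?thesis
      using z by (simp add: matrix_vector_right_distrib matrix_vector_mult_scaleR inner_add_left
          inner_add_right a_def[symmetric] c_def[symmetric] power2_eq_square algebra_simps)

  qed
  finally have "0 \<le> e * (2 * a + e * c)" by (simp add: power2_eq_square algebra_simps)
  moreover have "2 * a + e * c = a * (c + 2) / (c + 1)"
    unfolding e_def using c0 by (simp add: field_simps)
  ultimately have "0 \<le> (- a / (c + 1)) * (a * (c + 2) / (c + 1))"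
    unfolding e_def by simp
  also have "\<dots> = - (a * a * (c + 2) / (c + 1)\<^sup>2)"
    by (simp add: power2_eq_square)
  finally have "0 \<le> - (a * a * (c + 2) / (c + 1)\<^sup>2)" .
  moreover have "0 \<le> a * a * (c + 2) / (c + 1)\<^sup>2" using c0 by simp
  ultimately have "a * a * (c + 2) / (c + 1)\<^sup>2 = 0" by linarith
  then have "a = 0" using c0 by auto
  then show ?thesis by (simp add: a_def)
qed

lemma trace_eq_sum_inner: "trace (A :: real^'n^'n) = (\<Sum>i\<in>UNIV. axis i 1 \<bullet> (A *v axis i 1))"
  by (simp add: trace_def inner_axis' matrix_vector_mult_basis column_def)

text \<open>With \<open>D = S - T\<close> the hypothesis reads \<open>S D + D T = 0\<close>.
  Multiplying by \<open>D\<close> and taking traces gives two nonnegative terms with sum zero, so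
  \<open>S\<close> vanishes on the range of \<open>D\<close>; definiteness of \<open>S ** S\<close>
  then leaves only zero there.\<close>

lemma psd_sqrt_unique:
  fixes S T :: "real^'n^'n"
  assumes S: "transpose S = S" "\<And>x. 0 \<le> x \<bullet> (S *v x)"
    and T: "transpose T = T" "\<And>x. 0 \<le> x \<bullet> (T *v x)"
    and eq: "S ** S = T ** T" and pd: "\<And>x. x \<noteq> 0 \<Longrightarrow> 0 < x \<bullet> ((S ** S) *v x)"
  shows "S = T"
proof -
  define D where "D = S - T"
  have Dsym: "transpose D = D"
    using S(1) T(1) by (simp add: D_def transpose_def vec_eq_iff)
  have quad: "axis i 1 \<bullet> ((D ** (R ** D)) *v axis i 1) = (D *v axis i 1) \<bullet> (R *v (D *v axis i 1))"
    for i and R :: "real^'n^'n"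
    using inner_matrix_vector_left[of D "axis i 1" "R *v (D *v axis i 1)"] Dsym
    by (simp add: matrix_vector_mul_assoc[symmetric])
  have "S ** D + D ** T = 0"
    using eq by (simp add: D_def matrix_matrix_mult_def vec_eq_iff sum_subtractf algebra_simps)
  then have "trace (D ** (S ** D + D ** T)) = 0" by (simp add: trace_def)
  then have "trace (D ** (S ** D)) + trace (D ** (D ** T)) = 0"
    by (simp add: matrix_add_ldistrib trace_add)
  moreover have "trace (D ** (D ** T)) = trace (D ** (T ** D))"
    by (metis matrix_mul_assoc trace_mul_sym)
  ultimately have "trace (D ** (S ** D)) + trace (D ** (T ** D)) = 0" by simp
  moreover have "0 \<le> trace (D ** (T ** D))"
    unfolding trace_eq_sum_inner quad by (intro sum_nonneg T)
  moreover have nn: "0 \<le> trace (D ** (S ** D))"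
    unfolding trace_eq_sum_inner quad by (intro sum_nonneg S)
  ultimately have "trace (D ** (S ** D)) = 0" by linarith
  then have z: "(D *v axis i 1) \<bullet> (S *v (D *v axis i 1)) = 0" for i
    unfolding trace_eq_sum_inner quad using S(2)
    by (subst (asm) sum_nonneg_eq_0_iff) auto
  have "D *v axis i 1 = 0" for i
  proof (rule ccontr)
    assume "D *v axis i 1 \<noteq> 0"
    from pd[OF this] psd_quadratic_zero[OF S z[of i]] show False
      by (simp add: matrix_vector_mul_assoc[symmetric])
  qed
  then have "D = 0"
    by (simp add: matrix_vector_mult_basis column_def vec_eq_iff)
  then show ?thesis by (simp add: D_def)
qed

definition pos_def :: "real^'n^'n \<Rightarrow> bool" where
  "pos_def Q \<longleftrightarrow> transpose Q = Q \<and> (\<forall>x. x \<noteq> 0 \<longrightarrow> 0 < x \<bullet> (Q *v x))"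

lemma pos_def_sqrt_exists:
  fixes Q :: "real^'n^'n"
  assumes "pos_def Q"
  shows "\<exists>S. transpose S = S \<and> (\<forall>x. 0 \<le> x \<bullet> (S *v x)) \<and> S ** S = Q"
proof -
  have sym: "transpose Q = Q" and pd: "\<And>x. x \<noteq> 0 \<Longrightarrow> 0 < x \<bullet> (Q *v x)"
    using assms by (auto simp: pos_def_def)
  \<comment> \<open>Coercivity: \<open>c\<close> is the minimum of the form over the unit sphere,
    extended by homogeneity.\<close>
  obtain c where c: "c > 0" "\<And>x. c * (x \<bullet> x) \<le> x \<bullet> (Q *v x)"
  proof -
    have 1: "compact (sphere (0::real^'n) 1)" and 2: "sphere (0::real^'n) 1 \<noteq> {}" by auto
    have 3: "continuous_on (sphere 0 1) (\<lambda>x. x \<bullet> (Q *v x))"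
      by (intro continuous_intros)
    obtain x0 where x0: "x0 \<in> sphere 0 1"
      "\<And>x. x \<in> sphere 0 1 \<Longrightarrow> x0 \<bullet> (Q *v x0) \<le> x \<bullet> (Q *v x)"
      using continuous_attains_inf[OF 1 2 3] by blast
    show ?thesis
    proof
      show "0 < x0 \<bullet> (Q *v x0)" using x0(1) by (intro pd) auto
      fix x :: "real^'n"
      show "x0 \<bullet> (Q *v x0) * (x \<bullet> x) \<le> x \<bullet> (Q *v x)"
      proof (cases "x = 0")
        case False
        have "x0 \<bullet> (Q *v x0) \<le> ((1 / norm x) *\<^sub>R x) \<bullet> (Q *v ((1 / norm x) *\<^sub>R x))"
          using False by (intro x0(2)) simp
        also have "\<dots> = x \<bullet> (Q *v x) / (norm x)\<^sup>2"
          by (simp add: matrix_vector_mult_scaleR power2_eq_square)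
        finally show ?thesis using False by (simp add: field_simps dot_square_norm)
      qed simp
    qed
  qed
  define k where "k = onorm ((*v) Q) + 1"
  have k: "k > 0" "norm (Q *v x) \<le> k * norm x" for x
    unfolding k_def using onorm_pos_le[of "(*v) Q"] onorm[of "(*v) Q" x]
    by (auto simp: algebra_simps intro: order_trans)
  \<comment> \<open>One has \<open>|x - e Q x|^2 <= (1 - 2 e c + e^2 k^2) |x|^2\<close>, and
    \<open>e k^2 <= c\<close> reduces the factor to \<open>1 - e c\<close>, the square of
    \<open>\<alpha>\<close>; the second bound keeps that number positive.\<close>
  define e where "e = min (c / k\<^sup>2) (1 / (2 * c))"
  have e: "e > 0" "e * k\<^sup>2 \<le> c" "e * c \<le> 1 / 2"
  proof -
    show "e > 0" using c k by (simp add: e_def)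
    have "e * k\<^sup>2 \<le> c / k\<^sup>2 * k\<^sup>2" unfolding e_def by (intro mult_right_mono) auto
    then show "e * k\<^sup>2 \<le> c" using k by simp
    have "e * c \<le> 1 / (2 * c) * c" unfolding e_def using c by (intro mult_right_mono) auto
    then show "e * c \<le> 1 / 2" using c by simp
  qed
  define \<alpha> where "\<alpha> = sqrt (1 - e * c)"
  have ec: "0 < e * c" using e c by simp
  have \<alpha>: "0 \<le> \<alpha>" "\<alpha> < 1" unfolding \<alpha>_def using ec e(3) by auto
  define A where "A = Blinfun (\<lambda>x. x - e *\<^sub>R (Q *v x))"
  have A_apply: "blinfun_apply A x = x - e *\<^sub>R (Q *v x)" for x
    unfolding A_def
    by (subst bounded_linear_Blinfun_apply)
      (intro bounded_linear_sub bounded_linear_ident bounded_linear_const_scaleR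
        matrix_vector_mul_bounded_linear refl)+
  have Qs: "(Q *v x) \<bullet> y = x \<bullet> (Q *v y)" for x y using inner_matrix_vector_left[of Q x y] sym by simp
  have normA: "norm A \<le> \<alpha>"
  proof (rule norm_blinfun_bound[OF \<alpha>(1)])
    fix x
    have "(norm (A x))\<^sup>2 = (norm x)\<^sup>2 - 2 * e * (x \<bullet> (Q *v x)) + e\<^sup>2 * (norm (Q *v x))\<^sup>2"
      unfolding A_apply power2_norm_eq_inner
      by (simp add: inner_diff_left inner_diff_right Qs power2_eq_square algebra_simps)
    also have "\<dots> \<le> (norm x)\<^sup>2 - 2 * e * (c * (norm x)\<^sup>2) + e\<^sup>2 * (k * norm x)\<^sup>2"
      using e c(2)[of x] k(2)[of x]
      by (intro add_mono diff_mono mult_left_mono power_mono) (auto simp: dot_square_norm)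
    also have "\<dots> = (1 - 2 * (e * c) + e * (e * k\<^sup>2)) * (norm x)\<^sup>2"
      by (simp add: power2_eq_square algebra_simps)
    also have "\<dots> \<le> (1 - 2 * (e * c) + e * c) * (norm x)\<^sup>2"
      using e by (intro mult_right_mono add_left_mono mult_left_mono) auto
    also have "\<dots> = (\<alpha> * norm x)\<^sup>2"
      unfolding \<alpha>_def using e(3) by (simp add: power_mult_distrib)
    finally show "norm (A x) \<le> \<alpha> * norm x" by (rule power2_le_imp_le) (simp add: \<alpha>)
  qed
  \<comment> \<open>If \<open>Y = (A + Y\<^sup>2) / 2\<close> with \<open>A = 1 - e Q\<close>, then \<open>(1 - Y)\<^sup>2 = e Q\<close>; for small \<open>e\<close> the right-hand side
    is a contraction on a ball of radius less than one.\<close>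
  define X where "X = {Y :: (real^'n) \<Rightarrow>\<^sub>L (real^'n). norm Y \<le> \<alpha> \<and> (\<forall>x y. blinfun_apply Y x \<bullet> y = x \<bullet> blinfun_apply Y y)}"
  define g where "g = (\<lambda>Y :: (real^'n) \<Rightarrow>\<^sub>L (real^'n). (1/2) *\<^sub>R (A + (Y o\<^sub>L Y)))"
  \<comment> \<open>Symmetry is part of the closed set, so that the fixed point, and with it the
    root, is symmetric.\<close>
  have "closed X"
  proof -
    have "X = cball 0 \<alpha> \<inter> (\<Inter>x. \<Inter>y. {Y. blinfun_apply Y x \<bullet> y = x \<bullet> blinfun_apply Y y})"
      by (auto simp: X_def)
    moreover have "closed {Y. blinfun_apply Y x \<bullet> y = x \<bullet> blinfun_apply Y y}" for x y :: "real^'n"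
      by (intro closed_Collect_eq continuous_intros)
    ultimately show ?thesis by (simp add: closed_Int closed_INT)
  qed
  have nsq: "norm (Y o\<^sub>L Z) \<le> \<alpha> * norm Z" if "norm Y \<le> \<alpha>" for Y Z :: "(real^'n) \<Rightarrow>\<^sub>L (real^'n)"
    using order_trans[OF norm_blinfun_compose[of Y Z] mult_right_mono[OF that]] by simp
  have "\<exists>!Y\<in>X. g Y = Y"
  proof (rule Banach_fix[OF complete_eq_closed[THEN iffD2, OF \<open>closed X\<close>] _ \<alpha>])
    show "X \<noteq> {}" using \<alpha> by (auto simp: X_def intro!: exI[of _ 0])
    show "g ` X \<subseteq> X"
    proof safe
      fix Y assume Y: "Y \<in> X"
      have "norm (Y o\<^sub>L Y) \<le> \<alpha> * \<alpha>"
        using Y nsq[of Y Y] mult_left_mono[of "norm Y" \<alpha> \<alpha>] \<alpha> by (auto simp: X_def)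
      also have "\<alpha> * \<alpha> \<le> \<alpha>" using \<alpha> by (simp add: mult_left_le)
      finally have "norm (A + (Y o\<^sub>L Y)) \<le> 2 * \<alpha>"
        using normA norm_triangle_ineq[of A "Y o\<^sub>L Y"] by linarith
      moreover have "g Y x \<bullet> y = x \<bullet> g Y y" for x y
        using Y by (simp add: g_def X_def blinfun.bilinear_simps A_apply inner_add_left inner_add_right
            inner_diff_left inner_diff_right Qs)
      ultimately show "g Y \<in> X" by (auto simp: X_def g_def)
    qed
    fix Y Z assume YZ: "Y \<in> X" "Z \<in> X"
    \<comment> \<open>\<open>Y\<close> and \<open>Z\<close> need not commute, hence this form of the
      difference of squares; two terms of size \<open>\<alpha>\<close> against the factor 1/2 leave
      the contraction constant \<open>\<alpha>\<close>.\<close>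
    have "g Y - g Z = (1/2) *\<^sub>R ((Y o\<^sub>L (Y - Z)) + ((Y - Z) o\<^sub>L Z))"
      by (rule blinfun_eqI) (simp add: g_def blinfun.bilinear_simps algebra_simps)
    moreover have "norm (Y o\<^sub>L (Y - Z)) \<le> \<alpha> * norm (Y - Z)" using YZ by (intro nsq) (simp add: X_def)
    moreover have "norm ((Y - Z) o\<^sub>L Z) \<le> \<alpha> * norm (Y - Z)"
      using YZ norm_blinfun_compose[of "Y - Z" Z] mult_left_mono[of "norm Z" \<alpha> "norm (Y - Z)"]
      by (simp add: X_def mult.commute)
    moreover have "norm ((Y o\<^sub>L (Y - Z)) + ((Y - Z) o\<^sub>L Z)) \<le> norm (Y o\<^sub>L (Y - Z)) + norm ((Y - Z) o\<^sub>L Z)"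
      by (rule norm_triangle_ineq)
    ultimately show "dist (g Y) (g Z) \<le> \<alpha> * dist Y Z"
      by (simp add: dist_norm)
  qed
  then obtain Y where Y: "Y \<in> X" "g Y = Y" by blast
  have Yeq: "2 *\<^sub>R Y x - Y (Y x) = x - e *\<^sub>R (Q *v x)" for x
  proof -
    have "g Y x = Y x" using Y by simp
    then have "2 *\<^sub>R ((1/2) *\<^sub>R (A x + Y (Y x))) = 2 *\<^sub>R Y x" by (simp add: g_def blinfun.bilinear_simps)
    then show ?thesis by (simp add: A_apply algebra_simps)
  qed
  \<comment> \<open>The fixed point equation makes \<open>Q\<close> the square of
    \<open>(1 - Y) / sqrt e\<close>, and this root is nonnegative because the norm of
    \<open>Y\<close> is below one.\<close>
  define S where "S = matrix (\<lambda>x. (1 / sqrt e) *\<^sub>R (x - Y x))"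
  have S: "S *v x = (1 / sqrt e) *\<^sub>R (x - Y x)" for x
    unfolding S_def
    by (rule fun_cong[OF matrix_vector_mul(3)])
      (intro bounded_linear_sub bounded_linear_ident bounded_linear_const_scaleR
        blinfun.bounded_linear_right)
  have "transpose S *v x = S *v x" for x
  proof (rule vector_eq_ldot[THEN iffD1], intro allI)
    fix z
    have "z \<bullet> (transpose S *v x) = (S *v z) \<bullet> x" by (rule inner_matrix_vector_left[symmetric])
    also have "\<dots> = z \<bullet> (S *v x)" using Y by (simp add: S X_def inner_diff_left inner_diff_right)
    finally show "z \<bullet> (transpose S *v x) = z \<bullet> (S *v x)" .
  qed
  then have 1: "transpose S = S" by (simp add: matrix_eq)
  have 2: "0 \<le> x \<bullet> (S *v x)" for x
  proof -
    have "x \<bullet> Y x \<le> norm x * norm (Y x)" by (rule norm_cauchy_schwarz)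
    also have "\<dots> \<le> norm x * (1 * norm x)"
      using Y \<alpha> norm_blinfun[of Y x] mult_right_mono[of "norm Y" 1 "norm x"]
      by (intro mult_left_mono) (auto simp: X_def)
    finally show ?thesis
      using e by (simp add: S inner_diff_right dot_square_norm power2_eq_square)
  qed
  have 3: "S ** S = Q"
  proof (subst matrix_eq, intro allI)
    fix x
    have "(S ** S) *v x = (1 / e) *\<^sub>R (x - Y x - Y (x - Y x))"
    proof -
      have sc: "(1 / sqrt e) * (1 / sqrt e) = 1 / e" using e by simp
      show ?thesis
        by (simp only: matrix_vector_mul_assoc[symmetric] S blinfun.scaleR_right
            scaleR_diff_right[symmetric] scaleR_scaleR sc)
    qed
    also have "x - Y x - Y (x - Y x) = x - (2 *\<^sub>R Y x - Y (Y x))"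
      by (simp add: blinfun.bilinear_simps scaleR_2)
    finally show "(S ** S) *v x = Q *v x" using e by (simp add: Yeq)
  qed
  from 1 2 3 show ?thesis by blast
qed

text \<open>\<open>msqrt\<close> is a definite description, so these facts need existence and
  uniqueness together; positive definiteness provides both.\<close>

lemma msqrt_props:
  fixes Q :: "real^'n^'n"
  assumes Q: "pos_def Q"
  shows transpose_msqrt: "transpose (msqrt Q) = msqrt Q"
    and msqrt_mult_self: "msqrt Q ** msqrt Q = Q"
    and inj_msqrt: "inj ((*v) (msqrt Q))"
proof -
  have "\<exists>!S. transpose S = S \<and> (\<forall>x. 0 \<le> x \<bullet> (S *v x)) \<and> S ** S = Q"
    using pos_def_sqrt_exists[OF assms]
  proof (rule ex_ex1I, elim conjE)
    fix S T
    assume S: "transpose S = S" "\<forall>x. 0 \<le> x \<bullet> (S *v x)" "S ** S = Q"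
      and T: "transpose T = T" "\<forall>x. 0 \<le> x \<bullet> (T *v x)" "T ** T = Q"
    show "S = T"
      by (rule psd_sqrt_unique) (use S T assms in \<open>auto simp: pos_def_def\<close>)
  qed
  from theI'[OF this] have *: "transpose (msqrt Q) = msqrt Q" "msqrt Q ** msqrt Q = Q"
    unfolding msqrt_def by blast+
  then show "transpose (msqrt Q) = msqrt Q" "msqrt Q ** msqrt Q = Q" by auto
  have "x = 0" if "msqrt Q *v x = 0" for x
  proof -
    have "Q *v x = msqrt Q *v (msqrt Q *v x)" using *(2) by (simp add: matrix_vector_mul_assoc)
    with that have "x \<bullet> (Q *v x) = 0" by simp
    with assms show ?thesis by (auto simp: pos_def_def)
  qed
  then show "inj ((*v) (msqrt Q))"
    by (simp add: linear_injective_0 matrix_vector_mul_linear)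
qed

lemma norm_msqrt_mult:
  fixes Q :: "real^'n^'n"
  assumes "pos_def Q"
  shows "(norm (msqrt Q *v x))\<^sup>2 = x \<bullet> (Q *v x)"
proof -
  have "(norm (msqrt Q *v x))\<^sup>2 = x \<bullet> (msqrt Q *v (msqrt Q *v x))"
    by (simp add: power2_norm_eq_inner inner_matrix_vector_left transpose_msqrt[OF assms])
  then show ?thesis by (simp add: matrix_vector_mul_assoc msqrt_mult_self[OF assms])
qed

lemma matrix_inv_invertible:
  fixes A :: "real^'n^'n"
  assumes "invertible A"
  shows "A ** matrix_inv A = mat 1" "matrix_inv A ** A = mat 1"
proof -
  from assms have "\<exists>A'. A ** A' = mat 1 \<and> A' ** A = mat 1" by (simp add: invertible_def)
  from someI_ex[OF this] show "A ** matrix_inv A = mat 1" "matrix_inv A ** A = mat 1"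
    by (auto simp: matrix_inv_def)
qed

section \<open>The standard Gaussian measure\<close>

text \<open>Formulated over an arbitrary euclidean space, so that a pair of independent standard
  vectors is again a standard vector, on the product type, and every lemma applies to the pair as
  well.\<close>

definition gauss_density :: "'a::euclidean_space \<Rightarrow> real" where
  "gauss_density x = (\<Prod>b\<in>Basis. std_normal_density (x \<bullet> b))"

definition std_gauss :: "'a::euclidean_space measure" where
  "std_gauss = density lborel (\<lambda>x. ennreal (gauss_density x))"

lemma gauss_density_eq:
  "gauss_density (x::'a::euclidean_space) = (1 / sqrt (2 * pi)) ^ DIM('a) * exp (- (norm x)\<^sup>2 / 2)"
proof -
  have "gauss_density x = (\<Prod>b\<in>(Basis::'a set). (1 / sqrt (2 * pi)) * exp (- (x \<bullet> b)\<^sup>2 / 2))"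
    by (simp add: gauss_density_def std_normal_density_def)
  also have "\<dots> = (1 / sqrt (2 * pi)) ^ DIM('a) * exp (\<Sum>b\<in>Basis. - (x \<bullet> b)\<^sup>2 / 2)"
    by (simp only: prod.distrib prod_constant exp_sum[OF finite_Basis])
  also have "(\<Sum>b\<in>Basis. - (x \<bullet> b)\<^sup>2 / 2) = - (norm x)\<^sup>2 / 2"
    unfolding power2_norm_eq_inner euclidean_inner[of x x] sum_divide_distrib sum_negf[symmetric]
    by (simp add: power2_eq_square)
  finally show ?thesis .
qed

lemma gauss_density_pos: "0 < gauss_density x"
  by (simp add: gauss_density_eq)

lemma gauss_density_nonneg [simp]: "0 \<le> gauss_density x"
  using gauss_density_pos[of x] by simp

lemma borel_measurable_gauss_density [measurable]: "gauss_density \<in> borel_measurable borel"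
  unfolding gauss_density_eq by measurable

lemma gauss_density_cong: "norm x = norm y \<Longrightarrow> gauss_density x = gauss_density y"
  for x y :: "'a::euclidean_space"
  by (simp add: gauss_density_eq)

lemma nn_integral_gauss_density: "(\<integral>\<^sup>+x. gauss_density (x::'a::euclidean_space) \<partial>lborel) = 1"
proof -
  have "(\<integral>\<^sup>+x. std_normal_density x \<partial>lborel) = 1"
    by (subst nn_integral_eq_integral) (auto simp: integral_normal_density)
  then show ?thesis
    using nn_integral_lborel_prod[of "\<lambda>(_::'a) x. ennreal (std_normal_density x)"]
    by (simp add: gauss_density_def prod_ennreal)
qed

lemma sets_std_gauss [measurable_cong, simp]: "sets std_gauss = sets borel"
  by (simp add: std_gauss_def)

lemma space_std_gauss [simp]: "space std_gauss = UNIV"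
  by (simp add: std_gauss_def)

lemma prob_space_std_gauss: "prob_space (std_gauss :: 'a::euclidean_space measure)"
  by (rule prob_spaceI) (simp add: std_gauss_def emeasure_density nn_integral_gauss_density)

interpretation std_gauss: prob_space "std_gauss :: 'a::euclidean_space measure"
  by (rule prob_space_std_gauss)

interpretation std_gauss_pair: pair_sigma_finite "std_gauss :: 'a::euclidean_space measure"
  "std_gauss :: 'b::euclidean_space measure" ..

lemma measure_std_gauss_UNIV [simp]: "measure (std_gauss :: 'a::euclidean_space measure) UNIV = 1"
  using std_gauss.prob_space by simp

lemma nn_integral_std_gauss:
  assumes [measurable]: "f \<in> borel_measurable borel"
  shows "(\<integral>\<^sup>+x. f x \<partial>std_gauss) = (\<integral>\<^sup>+x. ennreal (gauss_density x) * f x \<partial>lborel)"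
  unfolding std_gauss_def by (subst nn_integral_density) auto

lemma std_gaussian_eq: "std_gaussian = (std_gauss :: (real^'n) measure)"
proof -
  have "(\<Prod>i\<in>UNIV. std_normal_density (x $ i)) = gauss_density x" for x :: "real^'n"
  proof -
    have "(\<Prod>i\<in>(UNIV::'n set). std_normal_density (x $ i)) =
        (1 / sqrt (2 * pi)) ^ CARD('n) * exp (\<Sum>i\<in>UNIV. - (x $ i)\<^sup>2 / 2)"
      by (simp only: std_normal_density_def prod.distrib prod_constant exp_sum[OF finite])
    also have "(\<Sum>i\<in>UNIV. - (x $ i)\<^sup>2 / 2) = - (norm x)\<^sup>2 / 2"
      unfolding power2_norm_eq_inner inner_vec_def sum_divide_distrib sum_negf[symmetric]
      by (simp add: power2_eq_square)
    finally show ?thesis by (simp add: gauss_density_eq)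
  qed
  then show ?thesis by (simp add: std_gaussian_def std_gauss_def)
qed

lemma std_gauss_prod:
  "std_gauss \<Otimes>\<^sub>M std_gauss = (std_gauss :: ('a::euclidean_space \<times> 'b::euclidean_space) measure)"
proof -
  have dens: "ennreal (gauss_density x) * ennreal (gauss_density y) = ennreal (gauss_density (x, y))"
    for x :: 'a and y :: 'b
    by (simp add: gauss_density_eq norm_prod_def ennreal_mult[symmetric] power_add
        exp_add[symmetric] field_simps)
  have "std_gauss \<Otimes>\<^sub>M std_gauss =
      density (lborel \<Otimes>\<^sub>M lborel) (\<lambda>(x::'a, y::'b). ennreal (gauss_density x) * ennreal (gauss_density y))"
    unfolding std_gauss_def
    by (rule pair_measure_density)
      (auto simp: std_gauss.sigma_finite_measure_axioms[unfolded std_gauss_def] lborel.sigma_finite_measure_axioms)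
  also have "\<dots> = std_gauss"
    by (simp add: std_gauss_def lborel_prod dens case_prod_unfold)
  finally show ?thesis .
qed

lemma linear_borel_measurable:
  fixes T :: "'a::euclidean_space \<Rightarrow> 'b::euclidean_space"
  assumes "linear T" shows "T \<in> borel_measurable borel"
  using assms by (intro borel_measurable_continuous_onI linear_continuous_on) (simp add: linear_conv_bounded_linear)

lemma nn_integral_lborel_shift:
  fixes c :: "'a::euclidean_space"
  assumes [measurable]: "f \<in> borel_measurable borel"
  shows "(\<integral>\<^sup>+x. f (c + x) \<partial>lborel) = (\<integral>\<^sup>+x. f x \<partial>lborel)"
  by (subst (2) lborel_distr_plus[symmetric, of c]) (subst nn_integral_distr; simp)

text \<open>The constant is not needed explicitly, so translation invariance of \<^const>\<open>lborel\<close> suffices and no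
  determinant appears.\<close>

lemma nn_integral_lborel_linear:
  fixes T R :: "'a::euclidean_space \<Rightarrow> 'a"
  assumes T: "linear T" and R: "\<And>y. T (R y) = y" and [measurable]: "h \<in> borel_measurable borel"
  shows "(\<integral>\<^sup>+x. h (T x) \<partial>lborel) = (\<integral>\<^sup>+x. gauss_density (T x) \<partial>lborel) * (\<integral>\<^sup>+x. h x \<partial>lborel)"
proof -
  note [measurable] = linear_borel_measurable[OF T]
  note [simp] = linear_add[OF T] R
  let ?k = "\<lambda>x::'a. ennreal (gauss_density x)"
  have "(\<integral>\<^sup>+x. h (T x) \<partial>lborel) = (\<integral>\<^sup>+x. (\<integral>\<^sup>+y. h (T x) * ?k y \<partial>lborel) \<partial>lborel)"
    by (simp add: nn_integral_cmult nn_integral_gauss_density)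
  also have "\<dots> = (\<integral>\<^sup>+x. (\<integral>\<^sup>+y. h (T x) * ?k (- T x + y) \<partial>lborel) \<partial>lborel)"
    by (intro nn_integral_cong nn_integral_lborel_shift[symmetric]) simp
  also have "\<dots> = (\<integral>\<^sup>+y. (\<integral>\<^sup>+x. h (T x) * ?k (- T x + y) \<partial>lborel) \<partial>lborel)"
    by (rule lborel_pair.Fubini'[symmetric]) measurable
  also have "\<dots> = (\<integral>\<^sup>+y. (\<integral>\<^sup>+x. h (T (R y + x)) * ?k (- T (R y + x) + y) \<partial>lborel) \<partial>lborel)"
    by (intro nn_integral_cong nn_integral_lborel_shift[symmetric]) simp
  also have "\<dots> = (\<integral>\<^sup>+y. (\<integral>\<^sup>+x. h (T x + y) * ?k (T x) \<partial>lborel) \<partial>lborel)"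
    by (intro nn_integral_cong) (simp add: add.commute gauss_density_cong[of "- T x" "T x" for x])
  also have "\<dots> = (\<integral>\<^sup>+x. (\<integral>\<^sup>+y. h (T x + y) * ?k (T x) \<partial>lborel) \<partial>lborel)"
    by (rule lborel_pair.Fubini') measurable
  also have "\<dots> = (\<integral>\<^sup>+x. (\<integral>\<^sup>+y. h y \<partial>lborel) * ?k (T x) \<partial>lborel)"
    by (intro nn_integral_cong) (simp add: nn_integral_multc nn_integral_lborel_shift)
  finally show ?thesis by (simp add: nn_integral_cmult mult.commute)
qed

text \<open>The assumption \<open>norm\<close> says that \<open>T1\<close> and \<open>T2\<close>,
  each composed with its adjoint, add up to the identity, so the sum has identity covariance. Since
  \<open>T2\<close> is invertible with inverse \<open>R\<close>, the density of the sum is found by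
  substituting \<open>w = T1 x + T2 z\<close> for \<open>z\<close>, with a constant
  Jacobian.\<close>

lemma distr_std_gauss_linear_sum:
  fixes T1 :: "'a::euclidean_space \<Rightarrow> 'b::euclidean_space" and T2 R :: "'b \<Rightarrow> 'b"
  assumes T1: "linear T1" and T2: "linear T2" and R: "\<And>y. T2 (R y) = y"
    and norm: "\<And>w. (norm (adjoint T1 w))\<^sup>2 + (norm (adjoint T2 w))\<^sup>2 = (norm w)\<^sup>2"
  shows "distr (std_gauss \<Otimes>\<^sub>M std_gauss) borel (\<lambda>(x, z). T1 x + T2 z) = std_gauss"
proof -
  note [measurable] = linear_borel_measurable[OF T1] linear_borel_measurable[OF T2]
  have inj: "inj T2"
    by (rule linear_surj_imp_inj[OF T2]) (metis R surj_def)
  have RT: "R (T2 z) = z" for z by (rule injD[OF inj]) (rule R)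
  have linR: "linear R"
    by (rule linearI; rule injD[OF inj]) (simp_all add: R linear_add[OF T2] linear_scale[OF T2])
  note [measurable] = linear_borel_measurable[OF linR]
  let ?M = "std_gauss \<Otimes>\<^sub>M std_gauss :: ('a \<times> 'b) measure"
  let ?k = "gauss_density"
  define c where "c = (\<integral>\<^sup>+z. ennreal (?k (T2 z)) \<partial>lborel)"
  define g where "g u = ?k u * exp (- (norm (R (T1 u)))\<^sup>2 / 2)" for u
  define d where "d = c * (\<integral>\<^sup>+u. ennreal (g u) \<partial>lborel)"
  have [measurable]: "g \<in> borel_measurable borel" unfolding g_def by measurable
  \<comment> \<open>Completing the square; the leftover Gaussian factor in \<open>x\<close> integrates to a constant, which
    is identified at the end by comparing total masses.\<close>
  have square: "?k x * ?k (R (w - T1 x)) = ?k w * g (- adjoint T1 w + x)" for x w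
  proof -
    define u where "u = - adjoint T1 w + x"
    have x: "x = u + adjoint T1 w" by (simp add: u_def)
    have adj1: "u \<bullet> adjoint T1 w = T1 u \<bullet> w" by (rule adjoint_works[OF T1])
    \<comment> \<open>Polarisation of \<open>norm\<close>, using its instances at
      \<open>z + w\<close>, \<open>z\<close> and \<open>w\<close>.\<close>
    have adj11: "T1 (adjoint T1 w) = w - T2 (adjoint T2 w)"
    proof -
      have *: "z \<bullet> (T1 (adjoint T1 w) + T2 (adjoint T2 w) - w) = 0" for z
      proof -
        have b: "z \<bullet> T1 (adjoint T1 w) = adjoint T1 z \<bullet> adjoint T1 w"
          "z \<bullet> T2 (adjoint T2 w) = adjoint T2 z \<bullet> adjoint T2 w" for z w
          using adjoint_works[OF T1, of "adjoint T1 w" z] adjoint_works[OF T2, of "adjoint T2 w" z]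
          by (simp_all add: inner_commute)
        note n = norm[unfolded power2_norm_eq_inner]
        have l: "linear (adjoint T1)" "linear (adjoint T2)" by (rule adjoint_linear[OF T1], rule adjoint_linear[OF T2])
        from n[of "z + w"] n[of z] n[of w] show ?thesis
          by (simp add: b linear_add[OF l(1)] linear_add[OF l(2)] inner_add_left inner_add_right
              inner_diff_right inner_commute)
      qed
      from this[of "T1 (adjoint T1 w) + T2 (adjoint T2 w) - w"]
      have "T1 (adjoint T1 w) + T2 (adjoint T2 w) - w = 0" by (simp only: inner_eq_zero_iff)
      then show ?thesis by (simp add: algebra_simps)
    qed
    have "w - T1 x = T2 (adjoint T2 w) - T1 u" by (simp add: x linear_add[OF T1] adj11)
    then have Rw: "R (w - T1 x) = adjoint T2 w - R (T1 u)" by (simp add: linear_diff[OF linR] RT)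
    have "adjoint T2 w \<bullet> R (T1 u) = w \<bullet> T1 u"
      using adjoint_works[OF T2, of "R (T1 u)" w] by (simp add: R inner_commute)
    then have "(norm x)\<^sup>2 + (norm (R (w - T1 x)))\<^sup>2 = (norm w)\<^sup>2 + ((norm u)\<^sup>2 + (norm (R (T1 u)))\<^sup>2)"
      unfolding Rw unfolding x norm[of w, symmetric] power2_norm_eq_inner
      using adj1 norm[of w, unfolded power2_norm_eq_inner]
      by (simp add: inner_add_left inner_add_right inner_diff_left inner_diff_right inner_commute)
    then show ?thesis
      unfolding g_def u_def[symmetric] gauss_density_eq
      by (simp add: exp_add[symmetric] mult.assoc[symmetric] field_simps)
  qed
  have emea: "emeasure (distr ?M borel (\<lambda>(x, z). T1 x + T2 z)) A = d * emeasure std_gauss A"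
    if [measurable]: "A \<in> sets borel" for A
  proof -
    let ?h = "indicator A :: 'b \<Rightarrow> ennreal"
    have "emeasure (distr ?M borel (\<lambda>(x, z). T1 x + T2 z)) A = (\<integral>\<^sup>+p. ?h (case p of (x, z) \<Rightarrow> T1 x + T2 z) \<partial>?M)"
      by (subst nn_integral_indicator[symmetric], simp) (subst nn_integral_distr; simp)
    also have "\<dots> = (\<integral>\<^sup>+x. (\<integral>\<^sup>+z. ?h (T1 x + T2 z) \<partial>std_gauss) \<partial>std_gauss)"
      by (subst std_gauss.nn_integral_fst[symmetric]) auto
    also have "\<dots> = (\<integral>\<^sup>+x. ?k x * (\<integral>\<^sup>+z. ?k z * ?h (T1 x + T2 z) \<partial>lborel) \<partial>lborel)"
      by (subst nn_integral_std_gauss, measurable) (simp add: nn_integral_std_gauss)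
    also have "\<dots> = (\<integral>\<^sup>+x. ?k x * (\<integral>\<^sup>+z. (\<lambda>w. ?k (R w) * ?h (T1 x + w)) (T2 z) \<partial>lborel) \<partial>lborel)"
      by (simp add: RT)
    also have "\<dots> = (\<integral>\<^sup>+x. ?k x * (c * (\<integral>\<^sup>+w. ?k (R (w - T1 x)) * ?h w \<partial>lborel)) \<partial>lborel)"
    proof (intro nn_integral_cong arg_cong2[where f="(*)"] refl)
      fix x
      have "(\<integral>\<^sup>+z. (\<lambda>w. ?k (R w) * ?h (T1 x + w)) (T2 z) \<partial>lborel) =
          c * (\<integral>\<^sup>+w. ?k (R w) * ?h (T1 x + w) \<partial>lborel)"
        unfolding c_def by (rule nn_integral_lborel_linear[OF T2 R]) simp
      also have "(\<integral>\<^sup>+w. ?k (R w) * ?h (T1 x + w) \<partial>lborel) = (\<integral>\<^sup>+w. ?k (R (w - T1 x)) * ?h w \<partial>lborel)"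
        by (subst nn_integral_lborel_shift[of _ "- T1 x", symmetric]) (simp_all add: algebra_simps)
      finally show "(\<integral>\<^sup>+z. (\<lambda>w. ?k (R w) * ?h (T1 x + w)) (T2 z) \<partial>lborel) =
          c * (\<integral>\<^sup>+w. ?k (R (w - T1 x)) * ?h w \<partial>lborel)" .
    qed
    also have "\<dots> = (\<integral>\<^sup>+x. (\<integral>\<^sup>+w. c * (ennreal (?k x * ?k (R (w - T1 x))) * ?h w) \<partial>lborel) \<partial>lborel)"
      by (simp add: nn_integral_cmult[symmetric] ennreal_mult ac_simps)
    also have "\<dots> = (\<integral>\<^sup>+w. (\<integral>\<^sup>+x. c * (ennreal (?k x * ?k (R (w - T1 x))) * ?h w) \<partial>lborel) \<partial>lborel)"
      by (rule lborel_pair.Fubini'[symmetric]) measurable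
    also have "\<dots> = (\<integral>\<^sup>+w. (\<integral>\<^sup>+x. c * (ennreal (?k w * g (- adjoint T1 w + x)) * ?h w) \<partial>lborel) \<partial>lborel)"
      by (simp only: square)
    also have "\<dots> = (\<integral>\<^sup>+w. (\<integral>\<^sup>+x. c * (ennreal (?k w * g x) * ?h w) \<partial>lborel) \<partial>lborel)"
      by (intro nn_integral_cong nn_integral_lborel_shift) simp
    also have "\<dots> = (\<integral>\<^sup>+w. d * (?k w * ?h w) \<partial>lborel)"
    proof (rule nn_integral_cong)
      fix w :: 'b
      have "(\<integral>\<^sup>+x. c * (ennreal (?k w * g x) * ?h w) \<partial>lborel) = (\<integral>\<^sup>+x. (c * (?k w * ?h w)) * ennreal (g x) \<partial>lborel)"
        by (intro nn_integral_cong) (simp add: ennreal_mult g_def ac_simps)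
      also have "\<dots> = d * (?k w * ?h w)"
        by (subst nn_integral_cmult) (simp_all add: d_def ac_simps)
      finally show "(\<integral>\<^sup>+x. c * (ennreal (?k w * g x) * ?h w) \<partial>lborel) = d * (?k w * ?h w)" .
    qed
    also have "\<dots> = d * emeasure std_gauss A"
      by (simp add: nn_integral_cmult std_gauss_def emeasure_density)
    finally show ?thesis .
  qed
  interpret P: prob_space ?M
    by (simp add: std_gauss_prod prob_space_std_gauss)
  have "emeasure (distr ?M borel (\<lambda>(x, z). T1 x + T2 z)) UNIV = 1"
    by (subst emeasure_distr) (simp_all add: P.emeasure_space_1)
  with emea[of UNIV] have "d = 1"
    by (simp add: std_gauss.emeasure_space_1[simplified])
  show ?thesis
    by (rule measure_eqI) (simp_all add: emea \<open>d = 1\<close>)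
qed

lemma distr_std_gauss_rotation:
  fixes a b :: real
  assumes ab: "a\<^sup>2 + b\<^sup>2 = 1" and b: "b \<noteq> 0"
  shows "distr (std_gauss \<Otimes>\<^sub>M std_gauss) borel (\<lambda>(x, z). a *\<^sub>R x + b *\<^sub>R z) =
    (std_gauss :: 'a::euclidean_space measure)"
proof (rule distr_std_gauss_linear_sum[where R = "\<lambda>y. (1 / b) *\<^sub>R y"])
  have adj: "adjoint (\<lambda>x::'a. c *\<^sub>R x) = (\<lambda>x. c *\<^sub>R x)" for c
    by (rule adjoint_unique) simp
  fix w :: 'a
  show "(norm (adjoint (\<lambda>x. a *\<^sub>R x) w))\<^sup>2 + (norm (adjoint (\<lambda>x. b *\<^sub>R x) w))\<^sup>2 = (norm w)\<^sup>2"
    using ab by (simp add: adj power_mult_distrib distrib_right[symmetric])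
qed (use b in \<open>auto intro!: linearI simp: algebra_simps\<close>)

section \<open>Integrability and second moments under the standard Gaussian\<close>

lemma integrable_std_gauss_exp_square: "integrable std_gauss (\<lambda>x::'a::euclidean_space. exp ((norm x)\<^sup>2 / 4))"
proof (rule integrableI_nonneg)
  \<comment> \<open>The weight turns the density at \<open>x\<close> into the density at
    \<open>x / sqrt 2\<close>, whose integral is finite by scaling the total mass one.\<close>
  have "(\<integral>\<^sup>+x. ennreal (exp ((norm x)\<^sup>2 / 4)) \<partial>(std_gauss::'a measure)) =
      (\<integral>\<^sup>+x. ennreal (gauss_density ((1 / sqrt 2) *\<^sub>R x :: 'a)) \<partial>lborel)"
    by (subst nn_integral_std_gauss, simp, intro nn_integral_cong)
      (simp add: gauss_density_eq ennreal_mult[symmetric] exp_add[symmetric] power_mult_distrib mult.assoc power_divide)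
  also have "\<dots> < \<infinity>"
  proof -
    have "(1::ennreal) = (\<integral>\<^sup>+x. gauss_density (x::'a) \<partial>lborel)" by (simp add: nn_integral_gauss_density)
    also have "\<dots> = \<bar>1 / sqrt 2\<bar> ^ DIM('a) * (\<integral>\<^sup>+x. ennreal (gauss_density ((1 / sqrt 2) *\<^sub>R x :: 'a)) \<partial>lborel)"
      by (subst lborel_affine[of "1 / sqrt 2" "0::'a"])
        (simp_all add: nn_integral_density nn_integral_distr nn_integral_cmult)
    finally have "(\<integral>\<^sup>+x. ennreal (gauss_density ((1 / sqrt 2) *\<^sub>R x :: 'a)) \<partial>lborel) \<noteq> \<infinity>"
      by (auto simp: ennreal_mult_top)
    then show ?thesis by (simp add: less_top)
  qed
  finally show "(\<integral>\<^sup>+x. ennreal (exp ((norm x)\<^sup>2 / 4)) \<partial>(std_gauss::'a measure)) < \<infinity>" .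
qed auto

lemma integrable_std_gauss_exp: "integrable std_gauss (\<lambda>x::'a::euclidean_space. exp (c * norm x))"
proof (rule Bochner_Integration.integrable_bound)
  show "integrable std_gauss (\<lambda>x::'a. exp (c\<^sup>2) * exp ((norm x)\<^sup>2 / 4))"
    by (intro integrable_mult_right integrable_std_gauss_exp_square)
  have "c * t \<le> c\<^sup>2 + t\<^sup>2 / 4" for t
    using zero_le_power2[of "c - t / 2"] by (simp add: power2_eq_square algebra_simps)
  then show "AE x in std_gauss. norm (exp (c * norm (x::'a))) \<le> norm (exp (c\<^sup>2) * exp ((norm x)\<^sup>2 / 4))"
    by (simp add: exp_add[symmetric])
qed simp

lemma power_le_fact_exp:
  fixes y :: real assumes "0 \<le> y" shows "y ^ n \<le> fact n * exp y"
proof -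
  have "y ^ n / fact n \<le> exp y"
    using sum_le_suminf[OF sums_summable[OF exp_converges[of y]], of "{n}"] assms
    by (simp add: exp_def divide_inverse mult.commute)
  then show ?thesis by (simp add: field_simps)
qed

lemma integrable_std_gauss_power: "integrable std_gauss (\<lambda>x::'a::euclidean_space. (1 + norm x) ^ n)"
proof (rule Bochner_Integration.integrable_bound)
  show "integrable std_gauss (\<lambda>x::'a. fact n * exp 1 * exp (1 * norm x))"
    by (intro integrable_mult_right integrable_std_gauss_exp)
  show "AE x in std_gauss. norm ((1 + norm (x::'a)) ^ n) \<le> norm (fact n * exp 1 * exp (1 * norm x))"
    using power_le_fact_exp[of "1 + norm x" n for x :: 'a]
    by (intro always_eventually allI) (simp add: exp_add mult.assoc)
qed simp

lemma integrable_std_gauss_poly_bound: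
  fixes f :: "'a::euclidean_space \<Rightarrow> real"
  assumes [measurable]: "f \<in> borel_measurable borel" and "\<And>x. \<bar>f x\<bar> \<le> c * (1 + norm x) ^ n"
  shows "integrable std_gauss f"
proof (rule Bochner_Integration.integrable_bound)
  show "integrable std_gauss (\<lambda>x::'a. c * (1 + norm x) ^ n)"
    by (intro integrable_mult_right integrable_std_gauss_power)
  show "AE x in std_gauss. norm (f x) \<le> norm (c * (1 + norm x) ^ n)"
    using assms(2) by (intro always_eventually allI) (auto intro: order_trans[OF _ abs_ge_self])
qed simp

text \<open>Invariance under sign changes of coordinates makes the mean and the mixed second moments
  vanish by antisymmetry.\<close>

lemma distr_std_gauss_signs:
  fixes c :: "'a::euclidean_space \<Rightarrow> real"
  assumes c: "\<And>j. j \<in> Basis \<Longrightarrow> \<bar>c j\<bar> = 1"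
  shows "distr std_gauss borel (\<lambda>x. \<Sum>j\<in>Basis. (c j * (x \<bullet> j)) *\<^sub>R j) = std_gauss"
proof -
  define T where "T x = (\<Sum>j\<in>Basis. (c j * (x \<bullet> j)) *\<^sub>R j)" for x
  have [measurable]: "T \<in> borel_measurable borel" unfolding T_def by measurable
  have Tj: "T x \<bullet> j = c j * (x \<bullet> j)" if "j \<in> Basis" for x j
    using that by (simp add: T_def inner_sum_left inner_Basis if_distrib cong: if_cong)
  have norm_T: "norm (T x) = norm x" for x
  proof -
    have "c j * (x \<bullet> j) * (c j * (x \<bullet> j)) = (x \<bullet> j) * (x \<bullet> j)" if "j \<in> Basis" for j
    proof -
      have "c j * c j = 1" using c[OF that] by (metis abs_mult_self_eq mult_1)
      then show ?thesis by (simp add: algebra_simps)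
    qed
    then show ?thesis
      unfolding norm_eq euclidean_inner[of "T x" "T x"] euclidean_inner[of x x]
      by (intro sum.cong refl) (simp add: Tj)
  qed
  have "(lborel :: 'a measure) = density (distr lborel borel T) (\<lambda>_. (\<Prod>j\<in>Basis. \<bar>c j\<bar>))"
    using lborel_affine_euclidean[of c 0] c unfolding T_def by force
  then have "distr lborel borel T = lborel"
    using c by (simp add: density_1)
  have "density lborel (\<lambda>x. ennreal (gauss_density x)) = density (distr lborel borel T) (\<lambda>x. ennreal (gauss_density x))"
    using \<open>distr lborel borel T = lborel\<close> by simp
  also have "\<dots> = distr (density lborel (\<lambda>x. ennreal (gauss_density (T x)))) borel T"
    by (subst density_distr) auto
  also have "\<dots> = distr (density lborel (\<lambda>x. ennreal (gauss_density x))) borel T"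
    by (simp add: gauss_density_cong[OF norm_T])
  finally show ?thesis unfolding std_gauss_def T_def by simp
qed

lemma integral_std_gauss_signs:
  fixes c :: "'a::euclidean_space \<Rightarrow> real" and f :: "'a \<Rightarrow> real"
  assumes "\<And>j. j \<in> Basis \<Longrightarrow> \<bar>c j\<bar> = 1" and [measurable]: "f \<in> borel_measurable borel"
  shows "(\<integral>x. f (\<Sum>j\<in>Basis. (c j * (x \<bullet> j)) *\<^sub>R j) \<partial>std_gauss) = (\<integral>x. f x \<partial>std_gauss)"
  by (subst (2) distr_std_gauss_signs[OF assms(1), symmetric]) (simp_all add: integral_distr)

lemma integrable_std_gauss_inner: "integrable std_gauss (\<lambda>x::'a::euclidean_space. c \<bullet> x)"
proof (rule integrable_std_gauss_poly_bound[where n = 1])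
  fix x :: 'a
  show "\<bar>c \<bullet> x\<bar> \<le> norm c * (1 + norm x) ^ 1"
    using Cauchy_Schwarz_ineq2[of c x] norm_ge_zero[of c]
    unfolding power_one_right distrib_left by linarith
qed simp

lemma integral_std_gauss_inner: "(\<integral>x. c \<bullet> x \<partial>std_gauss) = 0" for c :: "'a::euclidean_space"
proof -
  have *: "(\<Sum>j\<in>Basis. (- 1 * (x \<bullet> j)) *\<^sub>R j) = - x" for x :: 'a
    by (simp add: sum_negf euclidean_representation)
  have "(\<integral>x. c \<bullet> (- x) \<partial>std_gauss) = (\<integral>x. c \<bullet> x \<partial>std_gauss)"
    using integral_std_gauss_signs[of "\<lambda>_. - 1" "\<lambda>x. c \<bullet> x"] unfolding * by simp
  then show ?thesis by simp
qed

lemma integrable_std_gauss_inner_mult: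
  "integrable std_gauss (\<lambda>x::'a::euclidean_space. (c \<bullet> x) * (d \<bullet> x))"
proof (rule integrable_std_gauss_poly_bound[where n = 2])
  fix x :: 'a
  have "\<bar>(c \<bullet> x) * (d \<bullet> x)\<bar> \<le> (norm c * norm x) * (norm d * norm x)"
    unfolding abs_mult by (intro mult_mono Cauchy_Schwarz_ineq2) auto
  also have "\<dots> = (norm c * norm d) * (norm x)\<^sup>2" by (simp add: power2_eq_square)
  also have "\<dots> \<le> (norm c * norm d) * (1 + norm x)\<^sup>2" by (intro mult_left_mono power_mono) auto
  finally show "\<bar>(c \<bullet> x) * (d \<bullet> x)\<bar> \<le> (norm c * norm d) * (1 + norm x)\<^sup>2" .
qed simp

lemma integral_std_gauss_basis:
  assumes b: "b \<in> Basis" and b': "b' \<in> Basis"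
  shows "(\<integral>x. (x \<bullet> b) * (x \<bullet> b') \<partial>std_gauss) = (if b = b' then 1 else (0::real))"
proof (cases "b = b'")
  case False
  \<comment> \<open>Flipping the coordinate \<open>b\<close> alone reverses the sign of the
    product.\<close>
  let ?c = "\<lambda>j. if j = b then - 1 else (1::real)"
  have *: "(\<Sum>j\<in>Basis. (?c j * (x \<bullet> j)) *\<^sub>R j) \<bullet> i = ?c i * (x \<bullet> i)" if "i \<in> Basis" for x i
    using that by (simp add: inner_sum_left inner_Basis if_distrib[of "\<lambda>y. _ * y"] cong: if_cong)
  have "(\<integral>x. - ((x \<bullet> b) * (x \<bullet> b')) \<partial>std_gauss) = (\<integral>x. (x \<bullet> b) * (x \<bullet> b') \<partial>std_gauss)"
    using integral_std_gauss_signs[of ?c "\<lambda>x. (x \<bullet> b) * (x \<bullet> b')"] False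
    unfolding *[OF b] *[OF b'] by simp
  with False show ?thesis by simp
next
  case True
  have "(\<integral>\<^sup>+x. ennreal ((x \<bullet> b) * (x \<bullet> b)) \<partial>std_gauss) = 1"
  proof -
    \<comment> \<open>The square of one coordinate is absorbed into its one-dimensional factor, so
      the moment is a product of one-dimensional integrals, all equal to one.\<close>
    let ?f = "\<lambda>i y. ennreal (if i = b then y\<^sup>2 * std_normal_density y else std_normal_density y)"
    have n1: "(\<integral>\<^sup>+y. ?f i y \<partial>lborel) = 1" for i
    proof (cases "i = b")
      case True
      have "has_bochner_integral lborel (\<lambda>x. std_normal_density x * x ^ 2) 1"
        using std_normal_moment_even[of 1] by (simp add: fact_2)
      with True show ?thesis
        by (subst nn_integral_eq_integral) (auto simp: has_bochner_integral_iff mult.commute)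
    next
      case False
      then show ?thesis by (subst nn_integral_eq_integral) (auto simp: integral_normal_density)
    qed
    have "(\<integral>\<^sup>+x. ennreal ((x \<bullet> b) * (x \<bullet> b)) \<partial>std_gauss) = (\<integral>\<^sup>+x. (\<Prod>i\<in>Basis. ?f i (x \<bullet> i)) \<partial>lborel)"
    proof (subst nn_integral_std_gauss, simp, rule nn_integral_cong)
      fix x
      have "(\<Prod>i\<in>Basis. if i = b then (x \<bullet> i)\<^sup>2 * std_normal_density (x \<bullet> i) else std_normal_density (x \<bullet> i)) =
        (\<Prod>i\<in>Basis. (if i = b then (x \<bullet> b)\<^sup>2 else 1) * std_normal_density (x \<bullet> i))"
        by (intro prod.cong) auto
      also have "\<dots> = (x \<bullet> b)\<^sup>2 * gauss_density x"
        using b by (simp add: prod.distrib gauss_density_def)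
      finally show "ennreal (gauss_density x) * ennreal ((x \<bullet> b) * (x \<bullet> b)) = (\<Prod>i\<in>Basis. ?f i (x \<bullet> i))"
        by (subst prod_ennreal) (auto simp: ennreal_mult[symmetric] power2_eq_square mult.commute)
    qed
    also have "\<dots> = (\<Prod>i\<in>Basis. (\<integral>\<^sup>+y. ?f i y \<partial>lborel))"
      by (rule nn_integral_lborel_prod) auto
    finally show ?thesis by (simp add: n1)
  qed
  then have "(\<integral>x. (x \<bullet> b) * (x \<bullet> b) \<partial>std_gauss) = 1"
    by (subst integral_eq_nn_integral) auto
  with True show ?thesis by simp
qed

lemma integral_std_gauss_inner_mult:
  "(\<integral>x. (c \<bullet> x) * (d \<bullet> x) \<partial>std_gauss) = c \<bullet> d" for c d :: "'a::euclidean_space"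
proof -
  have i: "integrable std_gauss (\<lambda>x::'a. (x \<bullet> b) * (x \<bullet> b'))" for b b'
    using integrable_std_gauss_inner_mult[of b b'] by (simp add: inner_commute)
  have "(c \<bullet> x) * (d \<bullet> x) = (\<Sum>b\<in>Basis. \<Sum>b'\<in>Basis. ((c \<bullet> b) * (d \<bullet> b')) * ((x \<bullet> b) * (x \<bullet> b')))" for x
    unfolding euclidean_inner[of c x] euclidean_inner[of d x] sum_product
    by (intro sum.cong) auto
  then have "(\<integral>x. (c \<bullet> x) * (d \<bullet> x) \<partial>std_gauss) =
      (\<Sum>b\<in>Basis. \<Sum>b'\<in>Basis. ((c \<bullet> b) * (d \<bullet> b')) * (\<integral>x. (x \<bullet> b) * (x \<bullet> b') \<partial>std_gauss))"
    by (simp add: i)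
  also have "\<dots> = (\<Sum>b\<in>Basis. \<Sum>b'\<in>Basis. ((c \<bullet> b) * (d \<bullet> b')) * (if b = b' then 1 else 0))"
    by (intro sum.cong) (simp_all add: integral_std_gauss_basis)
  also have "\<dots> = c \<bullet> d"
    by (simp add: euclidean_inner[of c d] if_distrib cong: if_cong)
  finally show ?thesis .
qed

section \<open>A Hoelder-type inequality for Gaussian pairs\<close>

text \<open>With \<open>s^3 / 3\<close> as last term, right-hand side minus logarithm has derivative
  \<open>s^3 / (1 + s)\<close> and hence a minimum at zero. Only an upper bound can hold uniformly
  down to \<open>s = -1\<close>, where the logarithm is unbounded below.\<close>

lemma ln_one_plus_le_cubic:
  fixes s :: real
  assumes "- 1 < s"
  shows "ln (1 + s) \<le> s - s\<^sup>2 / 2 + \<bar>s\<bar> ^ 3"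
proof -
  define f where "f s = s - s\<^sup>2 / 2 + s ^ 3 / 3 - ln (1 + s)" for s :: real
  have der: "(f has_real_derivative (x ^ 3 / (1 + x))) (at x)" if "- 1 < x" for x
    unfolding f_def using that
    by (auto intro!: derivative_eq_intros simp: field_simps power2_eq_square power3_eq_cube)
  have "f 0 \<le> f s"
  proof (cases "0 \<le> s")
    case True
    show ?thesis
      by (rule DERIV_nonneg_imp_nondecreasing[OF True]) (use der in \<open>force intro!: exI divide_nonneg_pos\<close>)
  next
    case False
    have "x ^ 3 / (1 + x) \<le> 0" if "s \<le> x" "x \<le> 0" for x
      using that assms by (intro divide_nonpos_pos) (auto simp: power3_eq_cube mult_nonneg_nonpos)
    with False assms der show ?thesis
      by (intro DERIV_nonpos_imp_nonincreasing[of s 0 f]) force+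
  qed
  then have "ln (1 + s) \<le> s - s\<^sup>2 / 2 + s ^ 3 / 3" by (simp add: f_def)
  also have "s ^ 3 / 3 \<le> \<bar>s\<bar> ^ 3"
    using abs_ge_self[of "s ^ 3"] by (simp add: power_abs[symmetric])
  finally show ?thesis by simp
qed

lemma exp_le_quadratic: "exp y \<le> 1 + y + y\<^sup>2 / 2 + \<bar>y\<bar> ^ 3 * exp \<bar>y\<bar>" for y :: real
proof -
  obtain t where t: "\<bar>t\<bar> \<le> \<bar>y\<bar>" "exp y = (\<Sum>m<3. y ^ m / fact m) + exp t / fact 3 * y ^ 3"
    using Maclaurin_exp_le[of y 3] by blast
  have "exp t / fact 3 * y ^ 3 \<le> exp \<bar>y\<bar> * \<bar>y\<bar> ^ 3"
  proof -
    have "exp t / fact 3 * y ^ 3 \<le> \<bar>exp t / fact 3 * y ^ 3\<bar>" by (rule abs_ge_self)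
    also have "\<dots> = (exp t / fact 3) * \<bar>y\<bar> ^ 3" by (simp add: abs_mult power_abs)
    also have "\<dots> \<le> exp \<bar>y\<bar> * \<bar>y\<bar> ^ 3"
    proof (rule mult_right_mono)
      have "exp t / fact 3 \<le> exp t" by (simp add: divide_le_eq_1_pos field_simps)
      also have "\<dots> \<le> exp \<bar>y\<bar>" using t by simp
      finally show "exp t / fact 3 \<le> exp \<bar>y\<bar>" .
    qed simp
    finally show ?thesis .
  qed
  then show ?thesis using t(2) by (simp add: numeral_3_eq_3 fact_2 power2_eq_square mult.commute)
qed

text \<open>The product is the exponential of a sum of logarithms. Replacing these by their cubic
  upper bounds gives an exponent \<open>y\<close> of order \<open>|s| + |t|\<close>, and the
  exponential is then expanded to second order. As only upper bounds enter, \<open>C\<close> does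
  not depend on how close \<open>s\<close> and \<open>t\<close> come to -1.\<close>

lemma powr_prod_le_quadratic:
  fixes \<alpha> \<beta> R :: real
  assumes \<alpha>: "0 \<le> \<alpha>" and \<beta>: "0 \<le> \<beta>" and R: "0 \<le> R"
  obtains C where "0 \<le> C" and "\<And>s t. \<lbrakk>- 1 < s; - 1 < t; \<bar>s\<bar> \<le> R; \<bar>t\<bar> \<le> R\<rbrakk> \<Longrightarrow>
      (1 + s) powr \<alpha> * (1 + t) powr \<beta> \<le> 1 + \<alpha> * s + \<beta> * t
        + ((\<alpha> * s + \<beta> * t)\<^sup>2 - \<alpha> * s\<^sup>2 - \<beta> * t\<^sup>2) / 2 + C * (\<bar>s\<bar> + \<bar>t\<bar>) ^ 3"
proof -
  define S where "S = \<alpha> + \<beta>"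
  define K where "K = S * (1 + R + R\<^sup>2)"
  \<comment> \<open>The three summands come from the cubic terms in \<open>y\<close>, from replacing
    \<open>y^2\<close> by the square of the linear part \<open>l\<close>, and from the remainder of
    the exponential; \<open>K\<close> is the constant in \<open>|y| <= K d\<close>.\<close>
  define C where "C = S + S * (1 + R) * K + K ^ 3 * exp (K * (2 * R))"
  have S: "0 \<le> S" using \<alpha> \<beta> by (simp add: S_def)
  have K: "0 \<le> K" using S R by (simp add: K_def)
  have C: "0 \<le> C" using S K R by (simp add: C_def)
  show ?thesis
  proof (rule that[OF C])
    fix s t :: real
    assume s: "- 1 < s" and t: "- 1 < t" and sR: "\<bar>s\<bar> \<le> R" and tR: "\<bar>t\<bar> \<le> R"
    define d where "d = \<bar>s\<bar> + \<bar>t\<bar>"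
    define l where "l = \<alpha> * s + \<beta> * t"
    define y where "y = \<alpha> * (s - s\<^sup>2 / 2 + \<bar>s\<bar> ^ 3) + \<beta> * (t - t\<^sup>2 / 2 + \<bar>t\<bar> ^ 3)"
    have d: "0 \<le> d" "\<bar>s\<bar> \<le> d" "\<bar>t\<bar> \<le> d" "d \<le> 2 * R" using sR tR by (auto simp: d_def)
    have lin: "\<bar>\<alpha> * a + \<beta> * b\<bar> \<le> S * c" if "\<bar>a\<bar> \<le> c" "\<bar>b\<bar> \<le> c" for a b c
    proof -
      have "\<bar>\<alpha> * a + \<beta> * b\<bar> \<le> \<alpha> * \<bar>a\<bar> + \<beta> * \<bar>b\<bar>"
        using abs_triangle_ineq[of "\<alpha> * a" "\<beta> * b"] \<alpha> \<beta> by (simp add: abs_mult)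
      also have "\<dots> \<le> \<alpha> * c + \<beta> * c" using that \<alpha> \<beta> by (intro add_mono mult_left_mono)
      finally show ?thesis by (simp add: S_def algebra_simps)
    qed
    have sq: "\<bar>x\<bar>\<^sup>2 \<le> d\<^sup>2" "\<bar>x\<bar> ^ 3 \<le> R * d\<^sup>2" "\<bar>x\<bar> ^ 3 \<le> R\<^sup>2 * d" "x\<^sup>2 \<le> R * d" "\<bar>x\<bar> ^ 3 \<le> d ^ 3"
      if "\<bar>x\<bar> \<le> R" "\<bar>x\<bar> \<le> d" for x
    proof -
      show "\<bar>x\<bar>\<^sup>2 \<le> d\<^sup>2" "\<bar>x\<bar> ^ 3 \<le> d ^ 3" using that by (intro power_mono; simp)+
      have "\<bar>x\<bar> * \<bar>x\<bar>\<^sup>2 \<le> R * d\<^sup>2" using that R d by (intro mult_mono power_mono) auto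
      then show "\<bar>x\<bar> ^ 3 \<le> R * d\<^sup>2" by (simp add: power3_eq_cube power2_eq_square)
      have "\<bar>x\<bar>\<^sup>2 * \<bar>x\<bar> \<le> R\<^sup>2 * d" using that R d by (intro mult_mono power_mono) auto
      then show "\<bar>x\<bar> ^ 3 \<le> R\<^sup>2 * d" by (simp add: power3_eq_cube power2_eq_square)
      have "\<bar>x\<bar> * \<bar>x\<bar> \<le> R * d" using that R d by (intro mult_mono) auto
      then show "x\<^sup>2 \<le> R * d" by (simp add: power2_eq_square)
    qed
    have e1: "\<bar>x - x\<^sup>2 / 2 + \<bar>x\<bar> ^ 3\<bar> \<le> (1 + R + R\<^sup>2) * d" if "\<bar>x\<bar> \<le> R" "\<bar>x\<bar> \<le> d" for x
    proof -
      have "\<bar>x - x\<^sup>2 / 2 + \<bar>x\<bar> ^ 3\<bar> \<le> \<bar>x\<bar> + x\<^sup>2 / 2 + \<bar>x\<bar> ^ 3"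
        using abs_ge_self[of x] abs_ge_minus_self[of x] zero_le_power2[of x] zero_le_power[of "\<bar>x\<bar>" 3]
        by (intro abs_leI) linarith+
      also have "\<dots> \<le> d + R * d + R\<^sup>2 * d"
        using sq(3,4)[OF that] that zero_le_power2[of x] by linarith
      finally show ?thesis by (simp add: algebra_simps)
    qed
    have yK: "\<bar>y\<bar> \<le> K * d"
      using lin[OF e1[OF sR d(2)] e1[OF tR d(3)]] by (simp add: y_def K_def mult.assoc)
    have lK: "\<bar>l\<bar> \<le> K * d"
    proof -
      have "\<bar>l\<bar> \<le> S * d" unfolding l_def by (rule lin[OF d(2,3)])
      also have "\<dots> \<le> K * d" using R S d by (intro mult_right_mono) (auto simp: K_def mult_le_cancel_left1)
      finally show ?thesis .
    qed
    have e2: "\<bar>- x\<^sup>2 / 2 + \<bar>x\<bar> ^ 3\<bar> \<le> (1 + R) * d\<^sup>2" if "\<bar>x\<bar> \<le> R" "\<bar>x\<bar> \<le> d" for x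
    proof -
      have "\<bar>- x\<^sup>2 / 2 + \<bar>x\<bar> ^ 3\<bar> \<le> x\<^sup>2 / 2 + \<bar>x\<bar> ^ 3"
        using zero_le_power2[of x] zero_le_power[of "\<bar>x\<bar>" 3] by (intro abs_leI) linarith+
      also have "\<dots> \<le> d\<^sup>2 + R * d\<^sup>2"
        using sq(1,2)[OF that] zero_le_power2[of x] unfolding power2_abs by linarith
      finally show ?thesis by (simp add: algebra_simps)
    qed
    have yl: "\<bar>y - l\<bar> \<le> S * ((1 + R) * d\<^sup>2)"
      using lin[OF e2[OF sR d(2)] e2[OF tR d(3)]] by (simp add: y_def l_def algebra_simps)
    have "(1 + s) powr \<alpha> * (1 + t) powr \<beta> = exp (\<alpha> * ln (1 + s) + \<beta> * ln (1 + t))"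
      using s t by (simp add: powr_def exp_add)
    also have "\<dots> \<le> exp y"
      unfolding y_def exp_le_cancel_iff using \<alpha> \<beta> s t
      by (intro add_mono mult_left_mono ln_one_plus_le_cubic)
    also have "\<dots> \<le> 1 + y + y\<^sup>2 / 2 + \<bar>y\<bar> ^ 3 * exp \<bar>y\<bar>" by (rule exp_le_quadratic)
    also have "\<bar>y\<bar> ^ 3 * exp \<bar>y\<bar> \<le> (K * d) ^ 3 * exp (K * (2 * R))"
    proof (intro mult_mono power_mono)
      show "exp \<bar>y\<bar> \<le> exp (K * (2 * R))"
        using yK order_trans[OF yK mult_left_mono[OF d(4) K]] by simp
    qed (use yK K d in auto)
    also have "y\<^sup>2 \<le> l\<^sup>2 + 2 * (S * (1 + R) * K * d ^ 3)"
    proof -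
      have "y\<^sup>2 - l\<^sup>2 = (y - l) * (y + l)" by (simp add: power2_eq_square algebra_simps)
      also have "\<dots> \<le> \<bar>y - l\<bar> * \<bar>y + l\<bar>" by (metis abs_ge_self abs_mult)
      also have "\<dots> \<le> (S * ((1 + R) * d\<^sup>2)) * (2 * (K * d))"
        using yl yK lK S R by (intro mult_mono) auto
      finally show ?thesis by (simp add: power2_eq_square power3_eq_cube algebra_simps)
    qed
    also have "y \<le> l - \<alpha> * s\<^sup>2 / 2 - \<beta> * t\<^sup>2 / 2 + S * d ^ 3"
    proof -
      have "\<alpha> * \<bar>s\<bar> ^ 3 + \<beta> * \<bar>t\<bar> ^ 3 \<le> \<alpha> * d ^ 3 + \<beta> * d ^ 3"
        using sq(5)[OF sR d(2)] sq(5)[OF tR d(3)] \<alpha> \<beta> by (intro add_mono mult_left_mono)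
      then show ?thesis by (simp add: y_def l_def S_def algebra_simps)
    qed
    finally show "(1 + s) powr \<alpha> * (1 + t) powr \<beta> \<le> 1 + \<alpha> * s + \<beta> * t
        + ((\<alpha> * s + \<beta> * t)\<^sup>2 - \<alpha> * s\<^sup>2 - \<beta> * t\<^sup>2) / 2 + C * (\<bar>s\<bar> + \<bar>t\<bar>) ^ 3"
      unfolding d_def[symmetric] l_def[symmetric] C_def
      by (simp add: l_def power_mult_distrib algebra_simps add_divide_distrib diff_divide_distrib)
  qed
qed

text \<open>\<open>a\<close> plays the role of the gradient of \<open>F\<close>; keeping it as data makes the class stable under averaging
  without differentiating under the integral.\<close>

definition C11_bounded :: "real \<Rightarrow> real \<Rightarrow> real \<Rightarrow> ('a::euclidean_space \<Rightarrow> real) \<Rightarrow> ('a \<Rightarrow> 'a) \<Rightarrow> bool" where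
  "C11_bounded e M L F a \<longleftrightarrow> F \<in> borel_measurable borel \<and> a \<in> borel_measurable borel \<and>
     (\<forall>x. e \<le> F x \<and> F x \<le> M) \<and> (\<forall>x. norm (a x) \<le> L) \<and>
     (\<forall>x z. \<bar>F (x + z) - F x\<bar> \<le> L * norm z) \<and>
     (\<forall>x z. \<bar>F (x + z) - F x - a x \<bullet> z\<bar> \<le> L * (norm z)\<^sup>2)"

lemma integrable_std_gauss_bounded:
  fixes f :: "'a::euclidean_space \<Rightarrow> 'b::{banach, second_countable_topology}"
  assumes "f \<in> borel_measurable borel" "\<And>x. norm (f x) \<le> K"
  shows "integrable std_gauss f"
  using assms by (intro std_gauss.integrable_const_bound[of _ K]) auto

lemma abs_integral_std_gauss_le:
  assumes "integrable std_gauss f" "\<And>x. \<bar>f x\<bar> \<le> (K::real)"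
  shows "\<bar>\<integral>x. f x \<partial>(std_gauss :: 'a::euclidean_space measure)\<bar> \<le> K"
proof -
  have "\<bar>\<integral>x. f x \<partial>(std_gauss :: 'a measure)\<bar> \<le> (\<integral>x. \<bar>f x\<bar> \<partial>std_gauss)" by (rule integral_abs_bound)
  also have "\<dots> \<le> K"
    using assms by (intro std_gauss.integral_le_const) auto
  finally show ?thesis .
qed

lemma borel_measurable_integral_std_gauss:
  fixes f :: "'a::euclidean_space \<Rightarrow> 'b::euclidean_space \<Rightarrow> 'c::{banach, second_countable_topology}"
  assumes "(\<lambda>(x, y). f x y) \<in> borel_measurable (borel \<Otimes>\<^sub>M borel)"
  shows "(\<lambda>x. \<integral>y. f x y \<partial>std_gauss) \<in> borel_measurable borel"
proof (rule std_gauss.borel_measurable_lebesgue_integral)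
  show "case_prod f \<in> borel_measurable (borel \<Otimes>\<^sub>M std_gauss)" using assms by simp
qed

text \<open>Each bound in \<open>C11_bounded\<close> is uniform in the base point and stable under
  convex combinations, so averaging over translates keeps the same \<open>e\<close>,
  \<open>M\<close> and \<open>L\<close>. Hence one error constant serves for the whole
  iteration.\<close>

lemma C11_bounded_average:
  fixes X :: "'w::euclidean_space \<Rightarrow> 'a::euclidean_space"
  assumes C: "C11_bounded e M L F a" and X: "X \<in> borel_measurable borel"
  shows "C11_bounded e M L (\<lambda>x. \<integral>w. F (x + X w) \<partial>std_gauss) (\<lambda>x. \<integral>w. a (x + X w) \<partial>std_gauss)"
proof -
  note [measurable] = X
  have [measurable]: "F \<in> borel_measurable borel" "a \<in> borel_measurable borel"
    and b: "\<And>x. e \<le> F x" "\<And>x. F x \<le> M" and na: "\<And>x. norm (a x) \<le> L"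
    and lip: "\<And>x z. \<bar>F (x + z) - F x\<bar> \<le> L * norm z"
    and tay: "\<And>x z. \<bar>F (x + z) - F x - a x \<bullet> z\<bar> \<le> L * (norm z)\<^sup>2"
    using C by (auto simp: C11_bounded_def)
  have iF [simp]: "integrable std_gauss (\<lambda>w. F (x + X w))" for x
  proof (rule integrable_std_gauss_bounded[where K = "\<bar>e\<bar> + \<bar>M\<bar>"])
    show "norm (F (x + X w)) \<le> \<bar>e\<bar> + \<bar>M\<bar>" for w
      using b(1)[of "x + X w"] b(2)[of "x + X w"] unfolding real_norm_def by linarith
  qed simp
  have ia [simp]: "integrable std_gauss (\<lambda>w. a (x + X w))" for x
    using na by (intro integrable_std_gauss_bounded[where K = L]) auto
  have "\<bar>(\<integral>w. F (x + z + X w) \<partial>std_gauss) - (\<integral>w. F (x + X w) \<partial>std_gauss)\<bar> \<le> L * norm z" for x z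
  proof -
    have "(\<integral>w. F (x + z + X w) \<partial>std_gauss) - (\<integral>w. F (x + X w) \<partial>std_gauss) =
        (\<integral>w. F (x + z + X w) - F (x + X w) \<partial>std_gauss)" by simp
    also have "\<bar>\<dots>\<bar> \<le> L * norm z"
      by (rule abs_integral_std_gauss_le, simp) (use lip[of "x + X w" z for w] in \<open>auto simp: add_ac\<close>)
    finally show ?thesis .
  qed
  moreover have "\<bar>(\<integral>w. F (x + z + X w) \<partial>std_gauss) - (\<integral>w. F (x + X w) \<partial>std_gauss) -
      (\<integral>w. a (x + X w) \<partial>std_gauss) \<bullet> z\<bar> \<le> L * (norm z)\<^sup>2" for x z
  proof -
    have "(\<integral>w. F (x + z + X w) \<partial>std_gauss) - (\<integral>w. F (x + X w) \<partial>std_gauss) - (\<integral>w. a (x + X w) \<partial>std_gauss) \<bullet> z =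
        (\<integral>w. F (x + z + X w) - F (x + X w) - a (x + X w) \<bullet> z \<partial>std_gauss)" by simp
    also have "\<bar>\<dots>\<bar> \<le> L * (norm z)\<^sup>2"
      by (rule abs_integral_std_gauss_le, simp) (use tay[of "x + X w" z for w] in \<open>auto simp: add_ac\<close>)
    finally show ?thesis .
  qed
  moreover have "e \<le> (\<integral>w. F (x + X w) \<partial>std_gauss)" "(\<integral>w. F (x + X w) \<partial>std_gauss) \<le> M" for x
    using b by (auto intro!: std_gauss.integral_ge_const std_gauss.integral_le_const)
  moreover have "norm (\<integral>w. a (x + X w) \<partial>std_gauss) \<le> L" for x
  proof -
    have "norm (\<integral>w. a (x + X w) \<partial>std_gauss) \<le> (\<integral>w. norm (a (x + X w)) \<partial>std_gauss)" by (rule integral_norm_bound)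
    also have "\<dots> \<le> L" using na by (intro std_gauss.integral_le_const) auto
    finally show ?thesis .
  qed
  moreover have "(\<lambda>x. \<integral>w. F (x + X w) \<partial>std_gauss) \<in> borel_measurable borel"
    "(\<lambda>x. \<integral>w. a (x + X w) \<partial>std_gauss) \<in> borel_measurable borel"
    by (intro borel_measurable_integral_std_gauss; measurable)+
  ultimately show ?thesis unfolding C11_bounded_def by blast
qed

text \<open>Variances of independent Gaussians add, so \<open>c *\<^sub>R x\<close> has the law of
  \<open>a *\<^sub>R x + b *\<^sub>R y\<close>. This is what separates off a single small
  increment.\<close>

lemma integral_std_gauss_split:
  fixes f :: "'a::euclidean_space \<Rightarrow> real"
  assumes [measurable]: "f \<in> borel_measurable borel" and f: "\<And>x. \<bar>f x\<bar> \<le> K"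
    and c: "c\<^sup>2 = a\<^sup>2 + b\<^sup>2" "0 < c" "b \<noteq> 0"
  shows "(\<integral>x. f (c *\<^sub>R x) \<partial>std_gauss) = (\<integral>x. (\<integral>y. f (a *\<^sub>R x + b *\<^sub>R y) \<partial>std_gauss) \<partial>std_gauss)"
proof -
  have "(a / c)\<^sup>2 + (b / c)\<^sup>2 = 1" "b / c \<noteq> 0"
    using c by (auto simp: power_divide add_divide_distrib[symmetric])
  note rot = distr_std_gauss_rotation[OF this, where 'a='a]
  have "(\<integral>x. f (c *\<^sub>R x) \<partial>std_gauss) =
    (\<integral>p. f (c *\<^sub>R (case p of (x, z) \<Rightarrow> (a / c) *\<^sub>R x + (b / c) *\<^sub>R z)) \<partial>(std_gauss \<Otimes>\<^sub>M std_gauss))"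
    by (subst rot[symmetric], subst integral_distr) auto
  also have "\<dots> = (\<integral>p. (case p of (x, z) \<Rightarrow> f (a *\<^sub>R x + b *\<^sub>R z)) \<partial>(std_gauss \<Otimes>\<^sub>M std_gauss))"
    using c by (intro Bochner_Integration.integral_cong) (auto simp: scaleR_add_right)
  also have "\<dots> = (\<integral>x. (\<integral>y. f (a *\<^sub>R x + b *\<^sub>R y) \<partial>std_gauss) \<partial>std_gauss)"
  proof (rule std_gauss_pair.integral_fst[symmetric])
    show "integrable (std_gauss \<Otimes>\<^sub>M std_gauss) (\<lambda>(x, z). f (a *\<^sub>R x + b *\<^sub>R z))"
      unfolding std_gauss_prod
      by (rule integrable_std_gauss_bounded[where K = K]) (use f in \<open>auto simp: borel_prod[symmetric]\<close>)
  qed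
  finally show ?thesis .
qed

text \<open>Powers of \<open>1 + norm w\<close> instead of \<open>norm w\<close> dominate all lower
  powers as well; the \<open>itself\<close> argument fixes the space of integration.\<close>

abbreviation gauss_moment :: "'w::euclidean_space itself \<Rightarrow> nat \<Rightarrow> real" where
  "gauss_moment _ n \<equiv> (\<integral>w. (1 + norm w) ^ n \<partial>(std_gauss :: 'w measure))"

lemma gauss_moment_nonneg: "0 \<le> gauss_moment TYPE('w::euclidean_space) n"
  by (rule Bochner_Integration.integral_nonneg) simp

text \<open>\<open>s\<close> is the relative deviation of \<open>F\<close> from its mean
  \<open>u\<close>, and \<open>\<sigma>\<close> its linear part in \<open>w\<close>. The linear part
  has mean zero, so \<open>u\<close> and \<open>F x\<close> differ by second order only; this is why
  \<open>s - \<sigma>\<close> is of order \<open>h^2\<close> although \<open>s\<close> is centred at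
  \<open>u\<close> and the gradient is taken at \<open>x\<close>. In \<open>c1\<close> and
  \<open>c2\<close> the 1 stands for the pointwise error, the moment for the error of the mean, and
  \<open>e\<close> for the lower bound of \<open>u\<close>.\<close>

lemma C11_bounded_fluctuation:
  fixes X :: "'w::euclidean_space \<Rightarrow> 'a::euclidean_space" and x :: 'a
  assumes C: "C11_bounded e M L F a" and e: "0 < e" and X: "linear X"
    and K: "\<And>w. norm (X w) \<le> K * norm w" "0 \<le> K" and h: "0 \<le> h"
  defines "u \<equiv> \<integral>w. F (x + h *\<^sub>R X w) \<partial>std_gauss"
  defines "s \<equiv> \<lambda>w. (F (x + h *\<^sub>R X w) - u) / u"
  defines "\<sigma> \<equiv> \<lambda>w. ((h / u) *\<^sub>R adjoint X (a x)) \<bullet> w"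
  defines "c1 \<equiv> L * K * (1 + gauss_moment TYPE('w) 1) / e"
  defines "c2 \<equiv> L * K\<^sup>2 * (1 + gauss_moment TYPE('w) 2) / e"
  shows "e \<le> u" "u \<le> M" "s \<in> borel_measurable borel" "integrable std_gauss s"
    "(\<integral>w. s w \<partial>std_gauss) = 0" "- 1 < s w" "\<bar>s w\<bar> \<le> M / e"
    "\<bar>s w\<bar> \<le> c1 * h * (1 + norm w)" "\<bar>\<sigma> w\<bar> \<le> c1 * h * (1 + norm w)"
    "\<bar>s w - \<sigma> w\<bar> \<le> c2 * h\<^sup>2 * (1 + norm w)\<^sup>2" "F (x + h *\<^sub>R X w) = u * (1 + s w)"
proof -
  let ?m1 = "gauss_moment TYPE('w) 1" and ?m2 = "gauss_moment TYPE('w) 2"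
  note [measurable] = linear_borel_measurable[OF X]
  have [measurable]: "F \<in> borel_measurable borel"
    and b: "\<And>x. e \<le> F x" "\<And>x. F x \<le> M" and na: "\<And>x. norm (a x) \<le> L"
    and lip: "\<And>x z. \<bar>F (x + z) - F x\<bar> \<le> L * norm z"
    and tay: "\<And>x z. \<bar>F (x + z) - F x - a x \<bullet> z\<bar> \<le> L * (norm z)\<^sup>2"
    using C by (auto simp: C11_bounded_def)
  have L: "0 \<le> L" using norm_ge_zero na order_trans by blast
  have m: "0 \<le> ?m1" "0 \<le> ?m2" by (rule gauss_moment_nonneg)+
  have grow: "c \<le> c * d" if "0 \<le> c" "1 \<le> d" for c d :: real
    using mult_left_mono[OF that(2,1)] by simp
  let ?F = "\<lambda>w. F (x + h *\<^sub>R X w)"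
  have iF [simp]: "integrable std_gauss ?F"
    by (rule integrable_std_gauss_bounded[where K = M]) (use b e in \<open>auto simp: abs_le_iff intro: order_trans[OF _ b(2)], smt (verit, best) b e\<close>)
  show u: "e \<le> u" "u \<le> M"
    unfolding u_def using b by (auto intro!: std_gauss.integral_ge_const std_gauss.integral_le_const)
  then have u0: "0 < u" using e by simp
  show s_meas: "s \<in> borel_measurable borel" unfolding s_def by measurable
  show "integrable std_gauss s" unfolding s_def by simp
  have "(\<integral>w. s w \<partial>std_gauss) = ((\<integral>w. ?F w \<partial>std_gauss) - u) / u" unfolding s_def by simp
  then show "(\<integral>w. s w \<partial>std_gauss) = 0" by (simp add: u_def)
  show Fu: "F (x + h *\<^sub>R X w) = u * (1 + s w)"
    using u0 by (simp add: s_def field_simps)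
  have "0 < ?F w" using b(1) e less_le_trans by blast
  then show "- 1 < s w" using u0 by (simp add: s_def field_simps)
  have div: "\<bar>y / u\<bar> \<le> z / e" if "\<bar>y\<bar> \<le> z" for y z
  proof -
    have "\<bar>y\<bar> / u \<le> z / e" using that u e by (intro frac_le) auto
    then show ?thesis using u0 by simp
  qed
  have "\<bar>?F w - u\<bar> \<le> M"
    using b(1,2)[of "x + h *\<^sub>R X w"] u e by linarith
  from div[OF this] show "\<bar>s w\<bar> \<le> M / e" by (simp add: s_def)
  have hX: "norm (h *\<^sub>R X w) \<le> h * K * norm w" for w
    using mult_left_mono[OF K(1)[of w] h] h by (simp add: mult.assoc)
  have lipX: "\<bar>?F w - F x\<bar> \<le> L * K * h * (1 + norm w)" for w
  proof -
    have "\<bar>?F w - F x\<bar> \<le> L * norm (h *\<^sub>R X w)" by (rule lip)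
    also have "\<dots> \<le> L * (h * K * norm w)" using hX L by (intro mult_left_mono)
    also have "\<dots> \<le> L * (h * K * (1 + norm w))" using L h K by (intro mult_left_mono) auto
    finally show ?thesis by (simp add: mult_ac)
  qed
  have "\<bar>u - F x\<bar> \<le> L * K * h * ?m1"
  proof -
    have "u - F x = (\<integral>w. ?F w - F x \<partial>std_gauss)" by (simp add: u_def)
    also have "\<bar>\<dots>\<bar> \<le> (\<integral>w. \<bar>?F w - F x\<bar> \<partial>std_gauss)" by (rule integral_abs_bound)
    also have "\<dots> \<le> (\<integral>w. L * K * h * (1 + norm (w::'w)) ^ 1 \<partial>std_gauss)"
      using lipX by (intro integral_mono integrable_mult_right integrable_std_gauss_power) auto
    finally show ?thesis by simp
  qed
  also have "L * K * h * ?m1 \<le> L * K * h * ?m1 * (1 + norm w)"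
    by (rule grow) (intro mult_nonneg_nonneg L K h m, simp)
  finally have "\<bar>?F w - u\<bar> \<le> L * K * h * (1 + norm w) + L * K * h * ?m1 * (1 + norm w)"
    using lipX[of w] by linarith
  also have "\<dots> = c1 * h * (1 + norm w) * e" unfolding c1_def using e by (simp add: field_simps)
  finally have "\<bar>?F w - u\<bar> \<le> c1 * h * (1 + norm w) * e" .
  from div[OF this] show "\<bar>s w\<bar> \<le> c1 * h * (1 + norm w)" using e by (simp add: s_def)
  have adj: "((h / u) *\<^sub>R adjoint X (a x)) \<bullet> w = (a x \<bullet> (h *\<^sub>R X w)) / u" for w
    using adjoint_works[OF X, of w "a x"] by (simp add: inner_commute)
  have "\<bar>a x \<bullet> (h *\<^sub>R X w)\<bar> \<le> norm (a x) * norm (h *\<^sub>R X w)" by (rule Cauchy_Schwarz_ineq2)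
  also have "\<dots> \<le> L * (h * K * norm w)" using na hX L by (intro mult_mono) auto
  also have "\<dots> \<le> L * K * (1 + ?m1) * h * (1 + norm w)"
  proof -
    have "L * (h * K * norm w) = (L * K * h) * (1 * norm w)" by (simp add: mult_ac)
    also have "\<dots> \<le> (L * K * h) * ((1 + ?m1) * (1 + norm w))"
      using L K h m by (intro mult_left_mono mult_mono) auto
    finally show ?thesis by (simp add: mult_ac)
  qed
  also have "\<dots> = c1 * h * (1 + norm w) * e" unfolding c1_def using e by simp
  finally have "\<bar>a x \<bullet> (h *\<^sub>R X w)\<bar> \<le> c1 * h * (1 + norm w) * e" .
  from div[OF this] show "\<bar>\<sigma> w\<bar> \<le> c1 * h * (1 + norm w)" using e unfolding \<sigma>_def adj by simp
  have tayX: "\<bar>?F w - F x - a x \<bullet> (h *\<^sub>R X w)\<bar> \<le> L * K\<^sup>2 * h\<^sup>2 * (1 + norm w)\<^sup>2" for w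
  proof -
    have "\<bar>?F w - F x - a x \<bullet> (h *\<^sub>R X w)\<bar> \<le> L * (norm (h *\<^sub>R X w))\<^sup>2" by (rule tay)
    also have "\<dots> \<le> L * (h * K * (1 + norm w))\<^sup>2"
      using hX[of w] L h K mult_left_mono[of "norm w" "1 + norm w" "h * K"]
      by (intro mult_left_mono power_mono) auto
    finally show ?thesis by (simp add: power_mult_distrib mult_ac)
  qed
  have iaX: "integrable std_gauss (\<lambda>w. a x \<bullet> (h *\<^sub>R X w))"
  proof -
    have "integrable std_gauss (\<lambda>w. u * (((h / u) *\<^sub>R adjoint X (a x)) \<bullet> w))"
      by (intro integrable_mult_right integrable_std_gauss_inner)
    then show ?thesis unfolding adj using u0 by simp
  qed
  have "\<bar>u - F x\<bar> \<le> L * K\<^sup>2 * h\<^sup>2 * ?m2"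
  proof -
    have "(\<integral>w. u * (((h / u) *\<^sub>R adjoint X (a x)) \<bullet> w) \<partial>std_gauss) = 0"
      by (simp only: integral_mult_right_zero integral_std_gauss_inner mult_zero_right)
    then have "(\<integral>w. a x \<bullet> (h *\<^sub>R X w) \<partial>std_gauss) = 0" unfolding adj using u0 by simp
    then have "u - F x = (\<integral>w. ?F w - F x - a x \<bullet> (h *\<^sub>R X w) \<partial>std_gauss)"
      using iaX by (simp add: u_def)
    also have "\<bar>\<dots>\<bar> \<le> (\<integral>w. \<bar>?F w - F x - a x \<bullet> (h *\<^sub>R X w)\<bar> \<partial>std_gauss)" by (rule integral_abs_bound)
    also have "\<dots> \<le> (\<integral>w. L * K\<^sup>2 * h\<^sup>2 * (1 + norm (w::'w)) ^ 2 \<partial>std_gauss)"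
      using tayX iaX by (intro integral_mono integrable_mult_right integrable_std_gauss_power integrable_abs) auto
    finally show ?thesis by simp
  qed
  also have "\<dots> \<le> L * K\<^sup>2 * h\<^sup>2 * ?m2 * (1 + norm w)\<^sup>2"
    by (rule grow) (intro mult_nonneg_nonneg L K h m zero_le_power2, simp add: one_le_power)
  finally have "\<bar>?F w - u - a x \<bullet> (h *\<^sub>R X w)\<bar> \<le>
      L * K\<^sup>2 * h\<^sup>2 * (1 + norm w)\<^sup>2 + L * K\<^sup>2 * h\<^sup>2 * ?m2 * (1 + norm w)\<^sup>2"
    using tayX[of w] by linarith
  also have "\<dots> = c2 * h\<^sup>2 * (1 + norm w)\<^sup>2 * e" unfolding c2_def using e by (simp add: field_simps)
  finally have "\<bar>?F w - u - a x \<bullet> (h *\<^sub>R X w)\<bar> \<le> c2 * h\<^sup>2 * (1 + norm w)\<^sup>2 * e" .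
  from div[OF this] show "\<bar>s w - \<sigma> w\<bar> \<le> c2 * h\<^sup>2 * (1 + norm w)\<^sup>2"
    using e unfolding \<sigma>_def adj s_def by (simp add: diff_divide_distrib)
qed

text \<open>Under the standard Gaussian law of \<open>w\<close> the assumption \<open>corr\<close> says that
  \<open>(\<alpha> a \<bullet> X w + \<beta> b \<bullet> Y w)\<^sup>2 - \<alpha> (a \<bullet> X w)\<^sup>2 - \<beta> (b \<bullet> Y w)\<^sup>2\<close> has nonpositive expectation.\<close>

locale gauss_pair =
  fixes X :: "'w::euclidean_space \<Rightarrow> 'a::euclidean_space" and Y :: "'w \<Rightarrow> 'b::euclidean_space"
    and \<alpha> \<beta> :: real
  assumes linX: "linear X" and linY: "linear Y" and \<alpha>: "0 < \<alpha>" and \<beta>: "0 < \<beta>"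
    and corr: "\<And>a b. (norm (\<alpha> *\<^sub>R adjoint X a + \<beta> *\<^sub>R adjoint Y b))\<^sup>2
        \<le> \<alpha> * (norm (adjoint X a))\<^sup>2 + \<beta> * (norm (adjoint Y b))\<^sup>2"
begin

text \<open>By \<open>corr\<close> the quadratic term of the expansion around the two means has nonpositive expectation.\<close>

lemma one_step:
  assumes e: "0 < e" "e \<le> M" and L: "0 \<le> L"
  obtains C where "0 \<le> C" and "\<And>F a G b x y h. C11_bounded e M L F a \<Longrightarrow> C11_bounded e M L G b \<Longrightarrow> 0 \<le> h \<Longrightarrow>
     (\<integral>w. F (x + h *\<^sub>R X w) powr \<alpha> * G (y + h *\<^sub>R Y w) powr \<beta> \<partial>std_gauss) \<le>
     (\<integral>w. F (x + h *\<^sub>R X w) \<partial>std_gauss) powr \<alpha> * (\<integral>w. G (y + h *\<^sub>R Y w) \<partial>std_gauss) powr \<beta> + C * h ^ 3"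
proof -
  obtain KX where KX: "\<And>w. norm (X w) \<le> KX * norm w" "0 \<le> KX"
    using linear_bounded_pos[OF linX] by (metis less_eq_real_def)
  obtain KY where KY: "\<And>w. norm (Y w) \<le> KY * norm w" "0 \<le> KY"
    using linear_bounded_pos[OF linY] by (metis less_eq_real_def)
  define K where "K = max KX KY"
  have K: "norm (X w) \<le> K * norm w" "norm (Y w) \<le> K * norm w" "0 \<le> K" for w
    using KX(1)[of w] KY(1)[of w] KX(2) mult_right_mono[of KX K "norm w"] mult_right_mono[of KY K "norm w"]
    by (auto simp: K_def)
  let ?m = "gauss_moment TYPE('w)"
  define c1 where "c1 = L * K * (1 + ?m 1) / e"
  define c2 where "c2 = L * K\<^sup>2 * (1 + ?m 2) / e"
  define T where "T = \<alpha> + \<beta>"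
  have c12: "0 \<le> c1" "0 \<le> c2"
    unfolding c1_def c2_def using L K e gauss_moment_nonneg[where 'w='w, of 1] gauss_moment_nonneg[where 'w='w, of 2] by auto
  have T0: "0 < T" using \<alpha> \<beta> by (simp add: T_def)
  \<comment> \<open>The radius \<open>M / e\<close> bounds the relative deviations of every function
    of the class, so \<open>C0\<close> does not depend on the functions.\<close>
  obtain C0 where C0: "0 \<le> C0" "\<And>s t. \<lbrakk>- 1 < s; - 1 < t; \<bar>s\<bar> \<le> M / e; \<bar>t\<bar> \<le> M / e\<rbrakk> \<Longrightarrow>
      (1 + s) powr \<alpha> * (1 + t) powr \<beta> \<le> 1 + \<alpha> * s + \<beta> * t
        + ((\<alpha> * s + \<beta> * t)\<^sup>2 - \<alpha> * s\<^sup>2 - \<beta> * t\<^sup>2) / 2 + C0 * (\<bar>s\<bar> + \<bar>t\<bar>) ^ 3"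
    using powr_prod_le_quadratic[of \<alpha> \<beta> "M / e"] \<alpha> \<beta> e by (auto simp: less_imp_le)
  \<comment> \<open>First the cost of replacing \<open>s\<close> and \<open>t\<close> by their
    linear parts in the quadratic term, then the cubic remainder, where
    \<open>|s w| + |t w| <= 2 c1 z w\<close>.\<close>
  define D where "D = (T\<^sup>2 + T) * (c1 * c2) + C0 * (2 * c1) ^ 3"
  define C where "C = M powr \<alpha> * M powr \<beta> * (D * ?m 3)"
  have D: "0 \<le> D" using c12 C0 T0 by (simp add: D_def)
  show ?thesis
  proof (rule that[of C])
    show "0 \<le> C" using D gauss_moment_nonneg[where 'w='w, of 3] by (simp add: C_def)
    fix F :: "'a \<Rightarrow> real" and a and G :: "'b \<Rightarrow> real" and b x y and h :: real
    assume F: "C11_bounded e M L F a" and G: "C11_bounded e M L G b" and h: "0 \<le> h"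
    define u where "u = (\<integral>w. F (x + h *\<^sub>R X w) \<partial>std_gauss)"
    define v where "v = (\<integral>w. G (y + h *\<^sub>R Y w) \<partial>std_gauss)"
    define s where "s w = (F (x + h *\<^sub>R X w) - u) / u" for w
    define t where "t w = (G (y + h *\<^sub>R Y w) - v) / v" for w
    define p where "p = (h / u) *\<^sub>R adjoint X (a x)"
    define r where "r = (h / v) *\<^sub>R adjoint Y (b y)"
    define z where "z w = h * (1 + norm w)" for w :: 'w
    note fF = C11_bounded_fluctuation[OF F e(1) linX K(1,3) h, of x, folded u_def, folded s_def p_def c1_def c2_def]
    note fG = C11_bounded_fluctuation[OF G e(1) linY K(2,3) h, of y, folded v_def, folded t_def r_def c1_def c2_def]
    note [measurable] = fF(3) fG(3)
    have uv: "0 < u" "0 < v" using fF(1) fG(1) e by auto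
    have z0: "0 \<le> z w" for w using h by (simp add: z_def)
    have bs: "\<bar>s w\<bar> \<le> c1 * z w" "\<bar>p \<bullet> w\<bar> \<le> c1 * z w" "\<bar>s w - p \<bullet> w\<bar> \<le> c2 * (z w)\<^sup>2" for w
      using fF(8-10)[of w] by (simp_all add: z_def power_mult_distrib mult_ac)
    have bt: "\<bar>t w\<bar> \<le> c1 * z w" "\<bar>r \<bullet> w\<bar> \<le> c1 * z w" "\<bar>t w - r \<bullet> w\<bar> \<le> c2 * (z w)\<^sup>2" for w
      using fG(8-10)[of w] by (simp_all add: z_def power_mult_distrib mult_ac)
    \<comment> \<open>The quadratic term at the linear parts; its expectation is exactly
      \<open>|\<alpha> p + \<beta> r|^2 - \<alpha> |p|^2 - \<beta> |r|^2\<close>.\<close>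
    define q where "q w = (\<alpha> * (p \<bullet> w) + \<beta> * (r \<bullet> w))\<^sup>2 - \<alpha> * (p \<bullet> w)\<^sup>2 - \<beta> * (r \<bullet> w)\<^sup>2" for w
    have sqdiff: "\<bar>c\<^sup>2 - d\<^sup>2\<bar> \<le> k * c2 * (2 * k * c1) * (z w) ^ 3"
      if "\<bar>c - d\<bar> \<le> k * (c2 * (z w)\<^sup>2)" "\<bar>c\<bar> \<le> k * (c1 * z w)" "\<bar>d\<bar> \<le> k * (c1 * z w)" "0 \<le> k" for c d w k
    proof -
      have "\<bar>c\<^sup>2 - d\<^sup>2\<bar> = \<bar>c - d\<bar> * \<bar>c + d\<bar>" by (simp add: abs_mult[symmetric] power2_eq_square algebra_simps)
      also have "\<dots> \<le> (k * (c2 * (z w)\<^sup>2)) * (2 * (k * (c1 * z w)))"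
        using that c12 by (intro mult_mono) auto
      finally show ?thesis by (simp add: power2_eq_square power3_eq_cube mult_ac)
    qed
    have lin: "\<bar>\<alpha> * c + \<beta> * d\<bar> \<le> T * k" if "\<bar>c\<bar> \<le> k" "\<bar>d\<bar> \<le> k" for c d k
    proof -
      have "\<bar>\<alpha> * c + \<beta> * d\<bar> \<le> \<alpha> * \<bar>c\<bar> + \<beta> * \<bar>d\<bar>"
        using abs_triangle_ineq[of "\<alpha> * c" "\<beta> * d"] \<alpha> \<beta> by (simp add: abs_mult)
      also have "\<dots> \<le> \<alpha> * k + \<beta> * k" using that \<alpha> \<beta> by (intro add_mono mult_left_mono) auto
      finally show ?thesis by (simp add: T_def algebra_simps)
    qed
    have pointwise: "F (x + h *\<^sub>R X w) powr \<alpha> * G (y + h *\<^sub>R Y w) powr \<beta> \<le>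
        u powr \<alpha> * v powr \<beta> * (1 + \<alpha> * s w + \<beta> * t w + q w / 2 + D * (z w) ^ 3)" for w
    proof -
      have 1: "\<bar>(\<alpha> * s w + \<beta> * t w)\<^sup>2 - (\<alpha> * (p \<bullet> w) + \<beta> * (r \<bullet> w))\<^sup>2\<bar> \<le> T * c2 * (2 * T * c1) * (z w) ^ 3"
      proof (rule sqdiff)
        have "\<bar>\<alpha> * (s w - p \<bullet> w) + \<beta> * (t w - r \<bullet> w)\<bar> \<le> T * (c2 * (z w)\<^sup>2)" by (rule lin[OF bs(3) bt(3)])
        then show "\<bar>\<alpha> * s w + \<beta> * t w - (\<alpha> * (p \<bullet> w) + \<beta> * (r \<bullet> w))\<bar> \<le> T * (c2 * (z w)\<^sup>2)"
          by (simp add: algebra_simps)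
      qed (use T0 lin[OF bs(1) bt(1)] lin[OF bs(2) bt(2)] in auto)
      have 2: "\<bar>(s w)\<^sup>2 - (p \<bullet> w)\<^sup>2\<bar> \<le> 1 * c2 * (2 * 1 * c1) * (z w) ^ 3"
        by (rule sqdiff) (use bs in auto)
      have 3: "\<bar>(t w)\<^sup>2 - (r \<bullet> w)\<^sup>2\<bar> \<le> 1 * c2 * (2 * 1 * c1) * (z w) ^ 3"
        by (rule sqdiff) (use bt in auto)
      have "(\<alpha> * s w + \<beta> * t w)\<^sup>2 - \<alpha> * (s w)\<^sup>2 - \<beta> * (t w)\<^sup>2 - q w \<le>
          T * c2 * (2 * T * c1) * (z w) ^ 3 + \<alpha> * (2 * c1 * c2 * (z w) ^ 3) + \<beta> * (2 * c1 * c2 * (z w) ^ 3)"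
      proof -
        have "\<alpha> * ((p \<bullet> w)\<^sup>2 - (s w)\<^sup>2) \<le> \<alpha> * (2 * c1 * c2 * (z w) ^ 3)"
          using 2 \<alpha> by (intro mult_left_mono) (auto simp: abs_le_iff mult_ac)
        moreover have "\<beta> * ((r \<bullet> w)\<^sup>2 - (t w)\<^sup>2) \<le> \<beta> * (2 * c1 * c2 * (z w) ^ 3)"
          using 3 \<beta> by (intro mult_left_mono) (auto simp: abs_le_iff mult_ac)
        ultimately show ?thesis
          using abs_le_D1[OF 1] unfolding q_def right_diff_distrib by linarith
      qed
      also have "\<dots> = 2 * ((T\<^sup>2 + T) * (c1 * c2) * (z w) ^ 3)"
        by (simp add: T_def power2_eq_square algebra_simps)
      finally have quad: "((\<alpha> * s w + \<beta> * t w)\<^sup>2 - \<alpha> * (s w)\<^sup>2 - \<beta> * (t w)\<^sup>2) / 2 \<le>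
          q w / 2 + (T\<^sup>2 + T) * (c1 * c2) * (z w) ^ 3"
      proof -
        have "A / 2 \<le> B / 2 + E" if "A - B \<le> 2 * E" for A B E :: real using that by linarith
        then show "A - q w \<le> 2 * E \<Longrightarrow> A / 2 \<le> q w / 2 + E" for A E by blast
      qed
      have "(\<bar>s w\<bar> + \<bar>t w\<bar>) ^ 3 \<le> (2 * c1 * z w) ^ 3"
        using bs(1)[of w] bt(1)[of w] by (intro power_mono) auto
      then have cub: "C0 * (\<bar>s w\<bar> + \<bar>t w\<bar>) ^ 3 \<le> C0 * (2 * c1) ^ 3 * (z w) ^ 3"
        using C0(1) by (simp add: mult_left_mono power_mult_distrib mult.assoc)
      have "F (x + h *\<^sub>R X w) powr \<alpha> * G (y + h *\<^sub>R Y w) powr \<beta> =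
          u powr \<alpha> * v powr \<beta> * ((1 + s w) powr \<alpha> * (1 + t w) powr \<beta>)"
        unfolding fF(11) fG(11) using uv fF(6)[of w] fG(6)[of w] by (simp add: powr_mult mult_ac)
      also have "\<dots> \<le> u powr \<alpha> * v powr \<beta> * (1 + \<alpha> * s w + \<beta> * t w
        + ((\<alpha> * s w + \<beta> * t w)\<^sup>2 - \<alpha> * (s w)\<^sup>2 - \<beta> * (t w)\<^sup>2) / 2 + C0 * (\<bar>s w\<bar> + \<bar>t w\<bar>) ^ 3)"
        using fF(6,7)[of w] fG(6,7)[of w] by (intro mult_left_mono C0(2)) auto
      also have "\<dots> \<le> u powr \<alpha> * v powr \<beta> * (1 + \<alpha> * s w + \<beta> * t w + q w / 2 + D * (z w) ^ 3)"
      proof (rule mult_left_mono)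
        let ?q = "(\<alpha> * s w + \<beta> * t w)\<^sup>2 - \<alpha> * (s w)\<^sup>2 - \<beta> * (t w)\<^sup>2"
        let ?z = "(z w) ^ 3" and ?l = "1 + \<alpha> * s w + \<beta> * t w"
        have "?l + ?q / 2 + C0 * (\<bar>s w\<bar> + \<bar>t w\<bar>) ^ 3
          \<le> ?l + (q w / 2 + (T\<^sup>2 + T) * (c1 * c2) * ?z) + C0 * (2 * c1) ^ 3 * ?z"
          by (intro add_mono order_refl quad cub)
        also have "\<dots> = ?l + q w / 2 + D * ?z" by (simp only: D_def distrib_right add.assoc)
        finally show "?l + ?q / 2 + C0 * (\<bar>s w\<bar> + \<bar>t w\<bar>) ^ 3 \<le> ?l + q w / 2 + D * ?z" .
      qed simp
      finally show ?thesis .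
    qed
    have iq: "integrable std_gauss q"
      unfolding q_def power2_eq_square distrib_left distrib_right
      by (intro Bochner_Integration.integrable_add Bochner_Integration.integrable_diff)
        (simp_all add: mult_ac integrable_std_gauss_inner_mult[simplified mult_ac])
    have Eq: "(\<integral>w. q w \<partial>std_gauss) \<le> 0"
    proof -
      have q_eq: "q w = ((\<alpha> *\<^sub>R p + \<beta> *\<^sub>R r) \<bullet> w) * ((\<alpha> *\<^sub>R p + \<beta> *\<^sub>R r) \<bullet> w)
          - \<alpha> * ((p \<bullet> w) * (p \<bullet> w)) - \<beta> * ((r \<bullet> w) * (r \<bullet> w))" for w
        by (simp add: q_def power2_eq_square inner_add_left)
      have "(\<integral>w. q w \<partial>std_gauss) = (norm (\<alpha> *\<^sub>R p + \<beta> *\<^sub>R r))\<^sup>2 - \<alpha> * (norm p)\<^sup>2 - \<beta> * (norm r)\<^sup>2"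
        unfolding q_eq power2_norm_eq_inner
        by (simp add: integrable_std_gauss_inner_mult integral_std_gauss_inner_mult del: inner_add_left inner_scaleR_left)
      also have "\<dots> \<le> 0"
      proof -
        \<comment> \<open>By linearity the weights \<open>h / u\<close> and \<open>h / v\<close>
          move inside the adjoints, so \<open>corr\<close> applies although the two weights
          differ.\<close>
        have "p = adjoint X ((h / u) *\<^sub>R a x)" "r = adjoint Y ((h / v) *\<^sub>R b y)"
          by (simp_all add: p_def r_def linear_scale adjoint_linear linX linY)
        then show ?thesis using corr[of "(h / u) *\<^sub>R a x" "(h / v) *\<^sub>R b y"] by simp
      qed
      finally show ?thesis .
    qed
    have iz: "integrable std_gauss (\<lambda>w. (z w) ^ 3)"
      unfolding z_def power_mult_distrib by (intro integrable_mult_right integrable_std_gauss_power)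
    have Ez: "(\<integral>w. (z w) ^ 3 \<partial>std_gauss) = h ^ 3 * ?m 3"
      unfolding z_def power_mult_distrib by simp
    note ints = fF(4) fG(4) iq iz
    have int_rhs: "integrable std_gauss (\<lambda>w. 1 + \<alpha> * s w + \<beta> * t w + q w / 2 + D * (z w) ^ 3)"
      using ints by simp
    have "(\<integral>w. F (x + h *\<^sub>R X w) powr \<alpha> * G (y + h *\<^sub>R Y w) powr \<beta> \<partial>std_gauss) \<le>
        (\<integral>w. u powr \<alpha> * v powr \<beta> * (1 + \<alpha> * s w + \<beta> * t w + q w / 2 + D * (z w) ^ 3) \<partial>std_gauss)"
    proof (rule integral_mono)
      show "integrable std_gauss (\<lambda>w. F (x + h *\<^sub>R X w) powr \<alpha> * G (y + h *\<^sub>R Y w) powr \<beta>)"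
      proof (rule integrable_std_gauss_bounded[where K = "M powr \<alpha> * M powr \<beta>"])
        have [measurable]: "F \<in> borel_measurable borel" "G \<in> borel_measurable borel"
          using F G by (auto simp: C11_bounded_def)
        note [measurable] = linear_borel_measurable[OF linX] linear_borel_measurable[OF linY]
        show "(\<lambda>w. F (x + h *\<^sub>R X w) powr \<alpha> * G (y + h *\<^sub>R Y w) powr \<beta>) \<in> borel_measurable borel"
          by measurable
        fix w
        have "e \<le> F (x + h *\<^sub>R X w)" "F (x + h *\<^sub>R X w) \<le> M" "e \<le> G (y + h *\<^sub>R Y w)" "G (y + h *\<^sub>R Y w) \<le> M"
          using F G by (auto simp: C11_bounded_def)
        then show "norm (F (x + h *\<^sub>R X w) powr \<alpha> * G (y + h *\<^sub>R Y w) powr \<beta>) \<le> M powr \<alpha> * M powr \<beta>"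
          using \<alpha> \<beta> e by (auto simp: abs_mult intro!: mult_mono powr_mono2)
      qed
    qed (use pointwise int_rhs in auto)
    also have "\<dots> = u powr \<alpha> * v powr \<beta> * (\<integral>w. 1 + \<alpha> * s w + \<beta> * t w + q w / 2 + D * (z w) ^ 3 \<partial>std_gauss)"
      by (rule integral_mult_right_zero)
    also have "(\<integral>w. 1 + \<alpha> * s w + \<beta> * t w + q w / 2 + D * (z w) ^ 3 \<partial>std_gauss) =
        1 + (\<integral>w. q w \<partial>std_gauss) / 2 + D * (h ^ 3 * ?m 3)"
      using ints fF(5) fG(5) Ez by simp
    also have "u powr \<alpha> * v powr \<beta> * \<dots> \<le> u powr \<alpha> * v powr \<beta> * (1 + D * (h ^ 3 * ?m 3))"
      using Eq by (intro mult_left_mono) auto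
    also have "\<dots> = u powr \<alpha> * v powr \<beta> + (u powr \<alpha> * v powr \<beta>) * (D * (h ^ 3 * ?m 3))"
      by (simp add: distrib_left)
    \<comment> \<open>The error still carries the factor
      \<open>u powr \<alpha> * v powr \<beta>\<close>; bounding it through \<open>M\<close> makes
      the constant uniform.\<close>
    also have "\<dots> \<le> u powr \<alpha> * v powr \<beta> + (M powr \<alpha> * M powr \<beta>) * (D * (h ^ 3 * ?m 3))"
      using uv fF(2) fG(2) \<alpha> \<beta> D h gauss_moment_nonneg[where 'w='w, of 3]
      by (intro add_left_mono mult_right_mono mult_mono powr_mono2) auto
    finally show "(\<integral>w. F (x + h *\<^sub>R X w) powr \<alpha> * G (y + h *\<^sub>R Y w) powr \<beta> \<partial>std_gauss) \<le>
     (\<integral>w. F (x + h *\<^sub>R X w) \<partial>std_gauss) powr \<alpha> * (\<integral>w. G (y + h *\<^sub>R Y w) \<partial>std_gauss) powr \<beta> + C * h ^ 3"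
      by (simp add: C_def u_def v_def mult_ac)
  qed
qed

end

context gauss_pair
begin

text \<open>A Gaussian vector with variance \<open>k + 1\<close> is the sum of independent ones with variances \<open>k\<close> and \<open>1\<close>.\<close>

lemma C11_inequality_iterate:
  assumes e: "0 < e" "e \<le> M" and h: "0 < h"
    and step: "\<And>F a G b x y. C11_bounded e M L F a \<Longrightarrow> C11_bounded e M L G b \<Longrightarrow>
     (\<integral>w. F (x + h *\<^sub>R X w) powr \<alpha> * G (y + h *\<^sub>R Y w) powr \<beta> \<partial>std_gauss) \<le>
     (\<integral>w. F (x + h *\<^sub>R X w) \<partial>std_gauss) powr \<alpha> * (\<integral>w. G (y + h *\<^sub>R Y w) \<partial>std_gauss) powr \<beta> + D"
    and F: "C11_bounded e M L F a" and G: "C11_bounded e M L G b"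
  shows "(\<integral>w. F (x + (h * sqrt k) *\<^sub>R X w) powr \<alpha> * G (y + (h * sqrt k) *\<^sub>R Y w) powr \<beta> \<partial>std_gauss) \<le>
     (\<integral>w. F (x + (h * sqrt k) *\<^sub>R X w) \<partial>std_gauss) powr \<alpha> *
     (\<integral>w. G (y + (h * sqrt k) *\<^sub>R Y w) \<partial>std_gauss) powr \<beta> + real k * D"
  using F G
proof (induction k arbitrary: F a G b)
  case 0
  then show ?case by simp
next
  case (Suc k)
  define c where "c = h * sqrt (real (Suc k))"
  define d where "d = h * sqrt (real k)"
  have c: "c\<^sup>2 = d\<^sup>2 + h\<^sup>2" "0 < c" "h \<noteq> 0"
    using h by (auto simp: c_def d_def power_mult_distrib algebra_simps)
  note linear_borel_measurable[OF linX, measurable] linear_borel_measurable[OF linY, measurable]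
  have meas [measurable]: "F \<in> borel_measurable borel" "G \<in> borel_measurable borel"
    and bF: "\<And>x. e \<le> F x" "\<And>x. F x \<le> M" and bG: "\<And>x. e \<le> G x" "\<And>x. G x \<le> M"
    using Suc.prems by (auto simp: C11_bounded_def)
  let ?MM = "M powr \<alpha> * M powr \<beta>"
  define PF where "PF x = (\<integral>w. F (x + h *\<^sub>R X w) \<partial>std_gauss)" for x
  define PG where "PG y = (\<integral>w. G (y + h *\<^sub>R Y w) \<partial>std_gauss)" for y
  define a' where "a' x = (\<integral>w. a (x + h *\<^sub>R X w) \<partial>std_gauss)" for x
  define b' where "b' y = (\<integral>w. b (y + h *\<^sub>R Y w) \<partial>std_gauss)" for y
  have PF: "C11_bounded e M L PF a'"
    unfolding PF_def[abs_def] a'_def[abs_def] by (rule C11_bounded_average[OF Suc.prems(1)]) measurable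
  have PG: "C11_bounded e M L PG b'"
    unfolding PG_def[abs_def] b'_def[abs_def] by (rule C11_bounded_average[OF Suc.prems(2)]) measurable
  have [measurable]: "PF \<in> borel_measurable borel" "PG \<in> borel_measurable borel"
    and bPF: "\<And>x. e \<le> PF x" "\<And>x. PF x \<le> M" and bPG: "\<And>x. e \<le> PG x" "\<And>x. PG x \<le> M"
    using PF PG by (auto simp: C11_bounded_def)
  have prod_bound: "\<bar>s powr \<alpha> * t powr \<beta>\<bar> \<le> ?MM"
    if "e \<le> s" "s \<le> M" "e \<le> t" "t \<le> M" for s t
    using that e \<alpha> \<beta> by (auto simp: abs_mult intro!: mult_mono powr_mono2)
  have bM: "\<bar>s\<bar> \<le> M" if "e \<le> s" "s \<le> M" for s using that e by auto
  have XY: "X (s *\<^sub>R w + t *\<^sub>R w') = s *\<^sub>R X w + t *\<^sub>R X w'" "Y (s *\<^sub>R w + t *\<^sub>R w') = s *\<^sub>R Y w + t *\<^sub>R Y w'"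
    "X (s *\<^sub>R w) = s *\<^sub>R X w" "Y (s *\<^sub>R w) = s *\<^sub>R Y w" for s t w w'
    by (simp_all add: linear_add linear_scale linX linY)
  let ?f = "\<lambda>w. F (x + X w) powr \<alpha> * G (y + Y w) powr \<beta>"
  \<comment> \<open>Averaging at scale \<open>h\<close> and then at scale \<open>d\<close> is
    averaging at scale \<open>c\<close>.\<close>
  have F2: "(\<integral>w. PF (x + d *\<^sub>R X w) \<partial>std_gauss) = (\<integral>w. F (x + c *\<^sub>R X w) \<partial>std_gauss)"
    using integral_std_gauss_split[of "\<lambda>w. F (x + X w)" M c d h] c bM[OF bF]
    by (simp add: XY PF_def add.assoc)
  have G2: "(\<integral>w. PG (y + d *\<^sub>R Y w) \<partial>std_gauss) = (\<integral>w. G (y + c *\<^sub>R Y w) \<partial>std_gauss)"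
    using integral_std_gauss_split[of "\<lambda>w. G (y + Y w)" M c d h] c bM[OF bG]
    by (simp add: XY PG_def add.assoc)
  let ?PP = "\<lambda>w. PF (x + d *\<^sub>R X w) powr \<alpha> * PG (y + d *\<^sub>R Y w) powr \<beta>"
  let ?inner = "\<lambda>w. \<integral>w'. F ((x + d *\<^sub>R X w) + h *\<^sub>R X w') powr \<alpha> * G ((y + d *\<^sub>R Y w) + h *\<^sub>R Y w') powr \<beta> \<partial>std_gauss"
  have "(\<integral>w. F (x + c *\<^sub>R X w) powr \<alpha> * G (y + c *\<^sub>R Y w) powr \<beta> \<partial>std_gauss) = (\<integral>w. ?f (c *\<^sub>R w) \<partial>std_gauss)"
    by (simp add: XY)
  also have "\<dots> = (\<integral>w. (\<integral>w'. ?f (d *\<^sub>R w + h *\<^sub>R w') \<partial>std_gauss) \<partial>std_gauss)"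
    by (rule integral_std_gauss_split[where K = ?MM]) (use c prod_bound bF bG in auto)
  also have "\<dots> = (\<integral>w. ?inner w \<partial>std_gauss)"
    by (simp add: XY add.assoc)
  \<comment> \<open>For a frozen outer variable the single step applies at the base points
    \<open>x + d *\<^sub>R X w\<close> and \<open>y + d *\<^sub>R Y w\<close>; the induction
    hypothesis is then used for the averaged functions \<open>PF\<close> and \<open>PG\<close>,
    which lie in the same class.\<close>
  also have "\<dots> \<le> (\<integral>w. ?PP w + D \<partial>std_gauss)"
  proof (rule integral_mono)
    show "integrable std_gauss ?inner"
    proof (rule integrable_std_gauss_bounded[where K = ?MM])
      show "?inner \<in> borel_measurable borel"
        by (rule borel_measurable_integral_std_gauss) measurable
      show "norm (?inner w)
          \<le> ?MM" for w
        unfolding real_norm_def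
        by (intro abs_integral_std_gauss_le integrable_std_gauss_bounded[where K = ?MM])
          (use prod_bound bF bG in auto)
    qed
    show "integrable std_gauss (\<lambda>w. ?PP w + D)"
      by (rule Bochner_Integration.integrable_add, rule integrable_std_gauss_bounded[where K = ?MM])
        (use prod_bound bPF bPG in auto)
    fix w
    show "?inner w
      \<le> ?PP w + D"
      unfolding PF_def PG_def by (rule step[OF Suc.prems])
  qed
  also have "\<dots> = (\<integral>w. ?PP w \<partial>std_gauss) + D"
  proof (subst Bochner_Integration.integral_add)
    show "integrable std_gauss (\<lambda>w. ?PP w)"
      by (intro integrable_std_gauss_bounded[where K = ?MM])
        (use prod_bound bPF bPG in auto)
  qed auto
  also have "\<dots> \<le> (\<integral>w. PF (x + d *\<^sub>R X w) \<partial>std_gauss) powr \<alpha> * (\<integral>w. PG (y + d *\<^sub>R Y w) \<partial>std_gauss) powr \<beta>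
      + real k * D + D"
    using Suc.IH[OF PF PG] by (simp add: d_def)
  finally show ?case unfolding F2 G2 by (simp add: c_def algebra_simps)
qed

lemma C11_inequality:
  assumes e: "0 < e" "e \<le> M" and F: "C11_bounded e M L F a" and G: "C11_bounded e M L G b"
  shows "(\<integral>w. F (X w) powr \<alpha> * G (Y w) powr \<beta> \<partial>std_gauss) \<le>
     (\<integral>w. F (X w) \<partial>std_gauss) powr \<alpha> * (\<integral>w. G (Y w) \<partial>std_gauss) powr \<beta>" (is "?l \<le> ?r")
proof -
  have L: "0 \<le> L" using F norm_ge_zero order_trans unfolding C11_bounded_def by blast
  obtain C where C: "0 \<le> C" "\<And>F a G b x y h. C11_bounded e M L F a \<Longrightarrow> C11_bounded e M L G b \<Longrightarrow> 0 \<le> h \<Longrightarrow>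
     (\<integral>w. F (x + h *\<^sub>R X w) powr \<alpha> * G (y + h *\<^sub>R Y w) powr \<beta> \<partial>std_gauss) \<le>
     (\<integral>w. F (x + h *\<^sub>R X w) \<partial>std_gauss) powr \<alpha> * (\<integral>w. G (y + h *\<^sub>R Y w) \<partial>std_gauss) powr \<beta> + C * h ^ 3"
    using one_step[OF e L] by blast
  have "?l \<le> ?r + C * inverse (real (Suc n))" for n
  proof -
    \<comment> \<open>With \<open>k = (n + 1)^2\<close> steps of size \<open>1 / (n + 1)\<close> the
      total scale \<open>h * sqrt k\<close> is exactly one, and the accumulated error
      \<open>k C h^3\<close> is \<open>C h\<close>.\<close>
    define h where "h = inverse (real (Suc n))"
    have h: "0 < h" "h * sqrt (real ((Suc n)\<^sup>2)) = 1" by (auto simp: h_def)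
    have "?l \<le> ?r + real ((Suc n)\<^sup>2) * (C * h ^ 3)"
      using C11_inequality_iterate[OF e h(1), of L "C * h ^ 3" F a G b 0 "(Suc n)\<^sup>2" 0, OF C(2) F G] h
      by simp
    also have "real ((Suc n)\<^sup>2) * (C * h ^ 3) = C * h"
    proof -
      have "N\<^sup>2 * (C * inverse N ^ 3) = C * inverse N" if "0 < N" for N :: real
        using that by (simp add: power2_eq_square power3_eq_cube field_simps)
      from this[of "real (Suc n)"] show ?thesis by (simp add: h_def)
    qed
    finally show ?thesis by (simp add: h_def)
  qed
  moreover have "(\<lambda>n. ?r + C * inverse (real (Suc n))) \<longlonglongrightarrow> ?r + C * 0"
    by (intro tendsto_intros LIMSEQ_inverse_real_of_nat)
  ultimately show ?thesis by (intro LIMSEQ_le_const[of _ ?r]) auto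
qed

text \<open>Shared by the passage to continuous and the passage to measurable functions.
  \<open>M\<close> supplies the dominating constants, and \<open>e\<close> keeps the bases of the
  powers positive in the limit.\<close>

lemma inequality_limit:
  fixes Fs :: "nat \<Rightarrow> 'a \<Rightarrow> real" and Gs :: "nat \<Rightarrow> 'b \<Rightarrow> real"
  assumes e: "0 < e"
    and [measurable]: "\<And>n. Fs n \<in> borel_measurable borel" "\<And>n. Gs n \<in> borel_measurable borel"
      "F \<in> borel_measurable borel" "G \<in> borel_measurable borel"
    and bF: "\<And>n x. e \<le> Fs n x" "\<And>n x. Fs n x \<le> M" and bG: "\<And>n x. e \<le> Gs n x" "\<And>n x. Gs n x \<le> M"
    and limF: "AE w in std_gauss. (\<lambda>n. Fs n (X w)) \<longlonglongrightarrow> F (X w)"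
    and limG: "AE w in std_gauss. (\<lambda>n. Gs n (Y w)) \<longlonglongrightarrow> G (Y w)"
    and ineq: "\<And>n. (\<integral>w. Fs n (X w) powr \<alpha> * Gs n (Y w) powr \<beta> \<partial>std_gauss) \<le>
     (\<integral>w. Fs n (X w) \<partial>std_gauss) powr \<alpha> * (\<integral>w. Gs n (Y w) \<partial>std_gauss) powr \<beta>"
  shows "(\<integral>w. F (X w) powr \<alpha> * G (Y w) powr \<beta> \<partial>std_gauss) \<le>
     (\<integral>w. F (X w) \<partial>std_gauss) powr \<alpha> * (\<integral>w. G (Y w) \<partial>std_gauss) powr \<beta>"
proof -
  note linear_borel_measurable[OF linX, measurable] linear_borel_measurable[OF linY, measurable]
  have ge: "e \<le> l" if "z \<longlonglongrightarrow> l" "\<And>n. e \<le> z n" for z :: "nat \<Rightarrow> real" and l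
    using that by (intro LIMSEQ_le_const[OF that(1)]) auto
  have bM: "\<bar>s\<bar> \<le> M" if "e \<le> s" "s \<le> M" for s using that e by auto
  have 1: "(\<lambda>n. \<integral>w. Fs n (X w) \<partial>std_gauss) \<longlonglongrightarrow> (\<integral>w. F (X w) \<partial>std_gauss)"
    by (rule integral_dominated_convergence[where w = "\<lambda>_. M"]) (use limF bM bF in auto)
  have 2: "(\<lambda>n. \<integral>w. Gs n (Y w) \<partial>std_gauss) \<longlonglongrightarrow> (\<integral>w. G (Y w) \<partial>std_gauss)"
    by (rule integral_dominated_convergence[where w = "\<lambda>_. M"]) (use limG bM bG in auto)
  have 3: "(\<lambda>n. \<integral>w. Fs n (X w) powr \<alpha> * Gs n (Y w) powr \<beta> \<partial>std_gauss) \<longlonglongrightarrow>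
      (\<integral>w. F (X w) powr \<alpha> * G (Y w) powr \<beta> \<partial>std_gauss)"
  proof (rule integral_dominated_convergence[where w = "\<lambda>_. M powr \<alpha> * M powr \<beta>"])
    show "AE w in std_gauss. (\<lambda>n. Fs n (X w) powr \<alpha> * Gs n (Y w) powr \<beta>) \<longlonglongrightarrow> F (X w) powr \<alpha> * G (Y w) powr \<beta>"
      using limF limG
    proof eventually_elim
      case (elim w)
      have "e \<le> F (X w)" "e \<le> G (Y w)" using ge[OF elim(1)] ge[OF elim(2)] bF bG by auto
      then show ?case using elim e by (intro tendsto_intros) auto
    qed
    show "AE w in std_gauss. norm (Fs n (X w) powr \<alpha> * Gs n (Y w) powr \<beta>) \<le> M powr \<alpha> * M powr \<beta>" for n
    proof (intro always_eventually allI)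
      fix w
      have "e \<le> Fs n (X w)" "Fs n (X w) \<le> M" "e \<le> Gs n (Y w)" "Gs n (Y w) \<le> M" by (rule bF bG)+
      then show "norm (Fs n (X w) powr \<alpha> * Gs n (Y w) powr \<beta>) \<le> M powr \<alpha> * M powr \<beta>"
        using e \<alpha> \<beta> by (auto simp: abs_mult intro!: mult_mono powr_mono2)
    qed
  qed auto
  have lower: "e \<le> (\<integral>w. Fs n (X w) \<partial>std_gauss)" "e \<le> (\<integral>w. Gs n (Y w) \<partial>std_gauss)" for n
    by (rule std_gauss.integral_ge_const; use bF bG bM in \<open>auto intro!: integrable_std_gauss_bounded[where K = M]\<close>)+
  have "e \<le> (\<integral>w. F (X w) \<partial>std_gauss)" "e \<le> (\<integral>w. G (Y w) \<partial>std_gauss)"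
    using ge[OF 1 lower(1)] ge[OF 2 lower(2)] by auto
  then have "(\<lambda>n. (\<integral>w. Fs n (X w) \<partial>std_gauss) powr \<alpha> * (\<integral>w. Gs n (Y w) \<partial>std_gauss) powr \<beta>) \<longlonglongrightarrow>
      (\<integral>w. F (X w) \<partial>std_gauss) powr \<alpha> * (\<integral>w. G (Y w) \<partial>std_gauss) powr \<beta>"
    using e 1 2 by (intro tendsto_intros) auto
  with 3 show ?thesis by (rule LIMSEQ_le) (use ineq in auto)
qed

end

section \<open>Gaussian mollification and passage to measurable functions\<close>

lemma integral_std_gauss_shift:
  fixes f :: "'a::euclidean_space \<Rightarrow> real"
  assumes [measurable]: "f \<in> borel_measurable borel" and nonneg: "\<And>x. 0 \<le> f x"
  shows "(\<integral>z. f (z + k) \<partial>std_gauss) = (\<integral>z. f z * exp (z \<bullet> k - (norm k)\<^sup>2 / 2) \<partial>std_gauss)"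
proof -
  \<comment> \<open>The density ratio of the Cameron-Martin formula: a shift of the argument becomes
    an exponential weight, so that derivatives fall on the weight and not on
    \<open>f\<close>.\<close>
  have dens: "gauss_density (- k + z) = gauss_density z * exp (z \<bullet> k - (norm k)\<^sup>2 / 2)" for z :: 'a
    unfolding gauss_density_eq mult.assoc exp_add[symmetric] power2_norm_eq_inner
    by (simp add: inner_diff_left inner_diff_right inner_commute add_divide_distrib diff_divide_distrib)
  have "(\<integral>\<^sup>+z. f (z + k) \<partial>std_gauss) = (\<integral>\<^sup>+z. gauss_density (- k + (k + z)) * ennreal (f (k + z)) \<partial>lborel)"
    by (subst nn_integral_std_gauss) (auto simp: add.commute)
  also have "\<dots> = (\<integral>\<^sup>+z. gauss_density (- k + z) * ennreal (f z) \<partial>lborel)"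
    by (rule nn_integral_lborel_shift) simp
  also have "\<dots> = (\<integral>\<^sup>+z. f z * exp (z \<bullet> k - (norm k)\<^sup>2 / 2) \<partial>std_gauss)"
    by (subst nn_integral_std_gauss, measurable, intro nn_integral_cong)
      (simp only: dens, simp add: ennreal_mult nonneg mult_ac)
  finally show ?thesis
    by (subst (1 2) integral_eq_nn_integral) (auto simp: nonneg)
qed

text \<open>The quadratic remainder carries powers of \<open>1 + norm z\<close>; they are absorbed
  into an exponential, which is integrable under \<open>std_gauss\<close>. The restriction on
  \<open>k\<close> bounds the exponent by \<open>1 + norm z\<close>.\<close>

lemma exp_tilt_taylor:
  fixes z k :: "'a::euclidean_space"
  assumes k: "norm k \<le> 1"
  shows "\<bar>exp (z \<bullet> k - (norm k)\<^sup>2 / 2) - 1 - z \<bullet> k\<bar> \<le> (norm k)\<^sup>2 * (3 * exp (2 + 2 * norm z))"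
proof -
  define y where "y = z \<bullet> k - (norm k)\<^sup>2 / 2"
  have y: "\<bar>y\<bar> \<le> norm k * (1 + norm z)"
  proof -
    have "\<bar>y\<bar> \<le> norm z * norm k + (norm k)\<^sup>2 / 2"
      using Cauchy_Schwarz_ineq2[of z k] abs_triangle_ineq4[of "z \<bullet> k" "(norm k)\<^sup>2 / 2"] by (simp add: y_def)
    also have "(norm k)\<^sup>2 / 2 \<le> norm k"
      using mult_left_mono[OF k norm_ge_zero[of k]] norm_ge_zero[of k] unfolding power2_eq_square by linarith
    finally show ?thesis by (simp add: algebra_simps)
  qed
  then have y2: "\<bar>y\<bar> \<le> 1 + norm z"
    using mult_right_mono[OF k, of "1 + norm z"] by simp
  obtain t where t: "\<bar>t\<bar> \<le> \<bar>y\<bar>" "exp y = (\<Sum>m<2. y ^ m / fact m) + exp t / fact 2 * y ^ 2"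
    using Maclaurin_exp_le[of y 2] by blast
  have "\<bar>exp y - 1 - y\<bar> = exp t / 2 * y\<^sup>2" using t(2) by (simp add: numeral_2_eq_2)
  also have "\<dots> \<le> exp (1 + norm z) * (norm k * (1 + norm z))\<^sup>2"
  proof (rule mult_mono)
    have "exp t / 2 \<le> exp t" by simp
    also have "\<dots> \<le> exp (1 + norm z)" using t(1) y2 by simp
    finally show "exp t / 2 \<le> exp (1 + norm z)" .
    show "y\<^sup>2 \<le> (norm k * (1 + norm z))\<^sup>2" using power_mono[OF y, of 2] by simp
  qed auto
  also have "\<dots> = (norm k)\<^sup>2 * (exp (1 + norm z) * (1 + norm z)\<^sup>2)" by (simp add: power_mult_distrib mult_ac)
  also have "\<dots> \<le> (norm k)\<^sup>2 * (exp (1 + norm z) * (2 * exp (1 + norm z)))"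
    using power_le_fact_exp[of "1 + norm z" 2] by (intro mult_left_mono) auto
  also have "exp (1 + norm z) * (2 * exp (1 + norm z)) = 2 * exp (2 + 2 * norm z)"
    by (simp add: exp_add[symmetric])
  finally have 1: "\<bar>exp y - 1 - y\<bar> \<le> (norm k)\<^sup>2 * (2 * exp (2 + 2 * norm z))" .
  have "\<bar>exp y - 1 - z \<bullet> k\<bar> \<le> \<bar>exp y - 1 - y\<bar> + (norm k)\<^sup>2 / 2"
  proof -
    have "z \<bullet> k = y + (norm k)\<^sup>2 / 2" by (simp add: y_def)
    then show ?thesis using zero_le_power2[of "norm k"] by linarith
  qed
  also have "(norm k)\<^sup>2 / 2 \<le> (norm k)\<^sup>2 * exp (2 + 2 * norm z)"
  proof -
    have "(norm k)\<^sup>2 / 2 \<le> (norm k)\<^sup>2 * 1" by simp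
    also have "\<dots> \<le> (norm k)\<^sup>2 * exp (2 + 2 * norm z)" by (intro mult_left_mono) auto
    finally show ?thesis .
  qed
  finally show ?thesis using 1 by (simp add: y_def algebra_simps)
qed

text \<open>\<open>F\<close> is only measurable; smoothness comes from writing a shift of
  \<open>F\<close> as a tilt of the Gaussian. The bound is delivered for every larger constant so
  that two functions can be given a common one.\<close>

lemma C11_bounded_mollify:
  fixes F :: "'a::euclidean_space \<Rightarrow> real"
  assumes [measurable]: "F \<in> borel_measurable borel" and bF: "\<And>x. e \<le> F x" "\<And>x. F x \<le> M"
    and e: "0 < e" and \<delta>: "0 < \<delta>"
  obtains L a where "0 \<le> L" "\<And>L'. L \<le> L' \<Longrightarrow> C11_bounded e M L' (\<lambda>x. \<integral>z. F (x + \<delta> *\<^sub>R z) \<partial>std_gauss) a"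
proof -
  define P where "P x = (\<integral>z. F (x + \<delta> *\<^sub>R z) \<partial>std_gauss)" for x
  \<comment> \<open>The gradient of \<open>P\<close>, in the form given by Gaussian integration by
    parts.\<close>
  define a where "a x = (\<integral>z. (F (x + \<delta> *\<^sub>R z) / \<delta>) *\<^sub>R z \<partial>std_gauss)" for x
  define m0 where "m0 = (\<integral>z. 3 * exp (2 + 2 * norm z) \<partial>(std_gauss :: 'a measure))"
  define m1 where "m1 = (\<integral>z. (1 + norm z) ^ 1 \<partial>(std_gauss :: 'a measure))"
  have M: "0 < M" using bF e order_trans less_le_trans by blast
  have F0: "0 \<le> F x" for x using bF(1)[of x] e by simp
  have aF: "\<bar>F x\<bar> \<le> M" for x using bF[of x] e by auto
  have m: "0 \<le> m0" "0 \<le> m1" unfolding m0_def m1_def by (rule Bochner_Integration.integral_nonneg; simp)+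
  have int0: "integrable std_gauss (\<lambda>z::'a. 3 * exp (2 + 2 * norm z))"
    unfolding exp_add by (intro integrable_mult_right integrable_std_gauss_exp)
  have iF: "integrable std_gauss (\<lambda>z. F (x + \<delta> *\<^sub>R z))" for x
    by (rule integrable_std_gauss_bounded[where K = M]) (use aF in auto)
  have bP: "e \<le> P x" "P x \<le> M" for x
    unfolding P_def using iF bF by (auto intro!: std_gauss.integral_ge_const std_gauss.integral_le_const)
  have ia: "integrable std_gauss (\<lambda>z. (F (x + \<delta> *\<^sub>R z) / \<delta>) *\<^sub>R z)" for x
  proof (rule Bochner_Integration.integrable_bound)
    show "integrable std_gauss (\<lambda>z::'a. (M / \<delta>) * (1 + norm z) ^ 1)"
      by (intro integrable_mult_right integrable_std_gauss_power)
    show "AE z in std_gauss. norm ((F (x + \<delta> *\<^sub>R z) / \<delta>) *\<^sub>R z) \<le> norm ((M / \<delta>) * (1 + norm z) ^ 1)"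
      using aF \<delta> M by (intro always_eventually allI) (auto simp: abs_mult intro!: mult_mono divide_right_mono)
  qed measurable
  have na: "norm (a x) \<le> M * m1 / \<delta>" for x
  proof -
    have "norm (a x) \<le> (\<integral>z. norm ((F (x + \<delta> *\<^sub>R z) / \<delta>) *\<^sub>R z) \<partial>std_gauss)"
      unfolding a_def by (rule integral_norm_bound)
    also have "\<dots> \<le> (\<integral>z. (M / \<delta>) * (1 + norm (z::'a)) ^ 1 \<partial>std_gauss)"
      using aF \<delta> M ia by (intro integral_mono integrable_mult_right integrable_std_gauss_power integrable_norm)
        (auto simp: abs_mult intro!: mult_mono divide_right_mono)
    finally show ?thesis by (simp add: m1_def)
  qed
  \<comment> \<open>\<open>M * m0\<close> pays for the tilt when \<open>norm k <= 1\<close>; for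
    larger shifts the trivial bounds on \<open>P\<close> and on the gradient give
    \<open>M + M * m1 * norm k\<close>, which is at most \<open>M * (1 + m1)\<close> times the
    square of \<open>norm k\<close>.\<close>
  define c where "c = M * (m0 + 1 + m1)"
  have c: "0 \<le> c" using M m by (simp add: c_def)
  have taylor: "\<bar>P (x + v) - P x - a x \<bullet> v\<bar> \<le> c * (norm v / \<delta>)\<^sup>2" for x v
  proof -
    define k where "k = (1 / \<delta>) *\<^sub>R v"
    have v: "v = \<delta> *\<^sub>R k" and nk: "norm v / \<delta> = norm k" using \<delta> by (auto simp: k_def)
    have av: "\<bar>a x \<bullet> v\<bar> \<le> M * m1 * norm k"
    proof -
      have "\<bar>a x \<bullet> v\<bar> \<le> norm (a x) * norm v" by (rule Cauchy_Schwarz_ineq2)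
      also have "\<dots> \<le> (M * m1 / \<delta>) * norm v" using na by (intro mult_right_mono) auto
      finally show ?thesis using \<delta> by (simp add: v)
    qed
    show ?thesis
    proof (cases "norm k \<le> 1")
      case True
      let ?W = "\<lambda>z. exp (z \<bullet> k - (norm k)\<^sup>2 / 2)"
      have ineqW: "\<bar>F (x + \<delta> *\<^sub>R z) * (?W z - 1 - z \<bullet> k)\<bar> \<le> (M * (norm k)\<^sup>2) * (3 * exp (2 + 2 * norm z))" for z
      proof -
        have "\<bar>F (x + \<delta> *\<^sub>R z) * (?W z - 1 - z \<bullet> k)\<bar> \<le> M * ((norm k)\<^sup>2 * (3 * exp (2 + 2 * norm z)))"
          unfolding abs_mult using aF M by (intro mult_mono exp_tilt_taylor[OF True]) auto
        then show ?thesis by (simp only: mult.assoc)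
      qed
      have "integrable std_gauss (\<lambda>z::'a. (M * (norm k)\<^sup>2) * (3 * exp (2 + 2 * norm z)))"
        by (intro integrable_mult_right int0)
      then have iR: "integrable std_gauss (\<lambda>z. F (x + \<delta> *\<^sub>R z) * (?W z - 1 - z \<bullet> k))"
        by (rule Bochner_Integration.integrable_bound) (use ineqW in \<open>auto intro!: order_trans[OF _ abs_ge_self]\<close>)
      have iFz: "integrable std_gauss (\<lambda>z. F (x + \<delta> *\<^sub>R z) * (z \<bullet> k))"
        using integrable_inner_left[OF ia[of x], of v] \<delta> by (simp add: v)
      have iW: "integrable std_gauss (\<lambda>z. F (x + \<delta> *\<^sub>R z) * ?W z)"
        using Bochner_Integration.integrable_add[OF Bochner_Integration.integrable_add[OF iR iF[of x]] iFz]
        by (simp add: algebra_simps)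
      have "P (x + v) = (\<integral>z. F (x + \<delta> *\<^sub>R (z + k)) \<partial>std_gauss)"
        unfolding P_def v by (simp add: scaleR_add_right add_ac)
      also have "\<dots> = (\<integral>z. F (x + \<delta> *\<^sub>R z) * ?W z \<partial>std_gauss)"
        by (rule integral_std_gauss_shift[of "\<lambda>z. F (x + \<delta> *\<^sub>R z)"]) (use F0 in auto)
      finally have Pv: "P (x + v) = (\<integral>z. F (x + \<delta> *\<^sub>R z) * ?W z \<partial>std_gauss)" .
      have "a x \<bullet> v = (\<integral>z. ((F (x + \<delta> *\<^sub>R z) / \<delta>) *\<^sub>R z) \<bullet> v \<partial>std_gauss)"
        unfolding a_def by (rule integral_inner_left[symmetric]) (use ia in auto)
      also have "\<dots> = (\<integral>z. F (x + \<delta> *\<^sub>R z) * (z \<bullet> k) \<partial>std_gauss)"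
        using \<delta> by (intro Bochner_Integration.integral_cong) (auto simp: v)
      finally have "P (x + v) - P x - a x \<bullet> v =
          (\<integral>z. F (x + \<delta> *\<^sub>R z) * ?W z - F (x + \<delta> *\<^sub>R z) - F (x + \<delta> *\<^sub>R z) * (z \<bullet> k) \<partial>std_gauss)"
        using iF iW iFz by (simp add: Pv P_def[of x])
      also have "\<dots> = (\<integral>z. F (x + \<delta> *\<^sub>R z) * (?W z - 1 - z \<bullet> k) \<partial>std_gauss)"
        by (simp add: algebra_simps)
      also have "\<bar>\<dots>\<bar> \<le> (\<integral>z. \<bar>F (x + \<delta> *\<^sub>R z) * (?W z - 1 - z \<bullet> k)\<bar> \<partial>std_gauss)" by (rule integral_abs_bound)
      also have "\<dots> \<le> (\<integral>z. (M * (norm k)\<^sup>2) * (3 * exp (2 + 2 * norm (z::'a))) \<partial>std_gauss)"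
        using iR int0 ineqW by (intro integral_mono integrable_abs integrable_mult_right) auto
      also have "\<dots> = (M * (norm k)\<^sup>2) * m0" unfolding m0_def by (rule integral_mult_right_zero)
      also have "\<dots> = (M * m0) * (norm k)\<^sup>2" by simp
      also have "\<dots> \<le> c * (norm k)\<^sup>2" using M m by (intro mult_right_mono) (auto simp: c_def)
      finally show ?thesis by (simp add: nk)
    next
      case False
      have "\<bar>P (x + v) - P x - a x \<bullet> v\<bar> \<le> M + M * m1 * norm k"
        using bP(1,2)[of "x + v"] bP(1,2)[of x] e av by linarith
      also have "\<dots> \<le> M * (norm k)\<^sup>2 + M * m1 * (norm k)\<^sup>2"
      proof (rule add_mono)
        have "1 \<le> (norm k)\<^sup>2" using False by (intro one_le_power) simp
        from mult_left_mono[OF this, of M] show "M \<le> M * (norm k)\<^sup>2" using M by simp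
        show "M * m1 * norm k \<le> M * m1 * (norm k)\<^sup>2"
          using False M m by (intro mult_left_mono self_le_power) auto
      qed
      also have "\<dots> \<le> c * (norm k)\<^sup>2"
        using M m mult_nonneg_nonneg[of "M * m0" "(norm k)\<^sup>2"] by (simp add: c_def algebra_simps)
      finally show ?thesis by (simp add: nk)
    qed
  qed
  have lip: "\<bar>P (x + v) - P x\<bar> \<le> (M * m1 + c) * (norm v / \<delta>)" for x v
  proof (cases "norm v / \<delta> \<le> 1")
    case True
    have "\<bar>a x \<bullet> v\<bar> \<le> norm (a x) * norm v" by (rule Cauchy_Schwarz_ineq2)
    also have "\<dots> \<le> (M * m1 / \<delta>) * norm v" using na by (intro mult_right_mono) auto
    finally have "\<bar>a x \<bullet> v\<bar> \<le> M * m1 * (norm v / \<delta>)" by simp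
    moreover have "c * (norm v / \<delta>)\<^sup>2 \<le> c * (norm v / \<delta>)"
      unfolding power2_eq_square by (rule mult_left_mono[OF mult_left_le[OF True] c]) (use \<delta> in simp)
    ultimately show ?thesis using taylor[of x v] unfolding distrib_right by linarith
  next
    case False
    have "\<bar>P (x + v) - P x\<bar> \<le> M * 1" using bP(1,2)[of "x + v"] bP(1,2)[of x] e by auto
    also have "\<dots> \<le> M * (norm v / \<delta>)" using False M by (intro mult_left_mono) auto
    also have "\<dots> \<le> (M * m1 + c) * (norm v / \<delta>)"
      using M m \<delta> by (intro mult_right_mono) (auto simp: c_def distrib_left)
    finally show ?thesis .
  qed
  define L where "L = c / \<delta>\<^sup>2 + (M * m1 + c) / \<delta>"
  have L1: "c / \<delta>\<^sup>2 \<le> L" "(M * m1 + c) / \<delta> \<le> L" "M * m1 / \<delta> \<le> L"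
    using c M m \<delta> by (auto simp: L_def add_divide_distrib)
  have [measurable]: "P \<in> borel_measurable borel" "a \<in> borel_measurable borel"
    unfolding P_def[abs_def] a_def[abs_def] by (intro borel_measurable_integral_std_gauss; measurable)+
  show ?thesis
  proof (rule that[of L a])
    show "0 \<le> L" using c M m \<delta> by (simp add: L_def)
    fix L' assume L': "L \<le> L'"
    have "norm (a x) \<le> L'" for x using na[of x] L1(3) L' by linarith
    moreover have "\<bar>P (x + v) - P x\<bar> \<le> L' * norm v" for x v
      using lip[of x v] mult_right_mono[of "(M * m1 + c) / \<delta>" L' "norm v"] L1(2) L' by simp
    moreover have "\<bar>P (x + v) - P x - a x \<bullet> v\<bar> \<le> L' * (norm v)\<^sup>2" for x v
      using taylor[of x v] mult_right_mono[of "c / \<delta>\<^sup>2" L' "(norm v)\<^sup>2"] L1(1) L' by (simp add: power_divide)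
    ultimately show "C11_bounded e M L' (\<lambda>x. \<integral>z. F (x + \<delta> *\<^sub>R z) \<partial>std_gauss) a"
      unfolding C11_bounded_def P_def[symmetric] using bP by auto
  qed
qed

lemma integral_mollify_tendsto:
  fixes F :: "'a::euclidean_space \<Rightarrow> real"
  assumes F: "continuous_on UNIV F" and bF: "\<And>x. \<bar>F x\<bar> \<le> M"
  shows "(\<lambda>n. \<integral>z. F (x + inverse (real (Suc n)) *\<^sub>R z) \<partial>std_gauss) \<longlonglongrightarrow> F x"
proof -
  have [measurable]: "F \<in> borel_measurable borel" using F by (rule borel_measurable_continuous_onI)
  have "(\<lambda>n. \<integral>z. F (x + inverse (real (Suc n)) *\<^sub>R z) \<partial>std_gauss) \<longlonglongrightarrow> (\<integral>z. F x \<partial>(std_gauss :: 'a measure))"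
  proof (rule integral_dominated_convergence[where w = "\<lambda>_. M"])
    have "(\<lambda>n. F (x + inverse (real (Suc n)) *\<^sub>R z)) \<longlonglongrightarrow> F x" for z
    proof -
      have "(\<lambda>n. x + inverse (real (Suc n)) *\<^sub>R z) \<longlonglongrightarrow> x + 0 *\<^sub>R z"
        by (intro tendsto_intros LIMSEQ_inverse_real_of_nat)
      moreover have "isCont F x" using F by (simp add: continuous_on_eq_continuous_at)
      ultimately show ?thesis using isCont_tendsto_compose[of x F] by simp
    qed
    then show "AE z in std_gauss. (\<lambda>n. F (x + inverse (real (Suc n)) *\<^sub>R z)) \<longlonglongrightarrow> F x" by simp
  qed (use bF in auto)
  then show ?thesis by simp
qed

text \<open>\<open>measurable_on\<close> supplies continuous approximants outside a negligible set;
  clipping them to the interval from \<open>e\<close> to \<open>M\<close> keeps continuity and does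
  not change the limit, which already lies there.\<close>

lemma bounded_measurable_AE_limit_continuous:
  fixes F :: "'a::euclidean_space \<Rightarrow> real"
  assumes [measurable]: "F \<in> borel_measurable borel" and bF: "\<And>x. e \<le> F x" "\<And>x. F x \<le> M"
  obtains Fs where "\<And>n. continuous_on UNIV (Fs n)" "\<And>n x. e \<le> Fs n x" "\<And>n x. Fs n x \<le> M"
    "AE x in lborel. (\<lambda>n. Fs n x) \<longlonglongrightarrow> F x"
proof -
  have "F measurable_on UNIV"
    by (rule lebesgue_measurable_imp_measurable_on_real) (auto intro: measurable_completion)
  then obtain N g where N: "negligible N" and g: "\<And>n. continuous_on UNIV (g n)"
    and lim: "\<And>x. x \<notin> N \<Longrightarrow> (\<lambda>n. g n x) \<longlonglongrightarrow> F x"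
    by (auto simp: measurable_on_def)
  define Fs where "Fs n x = max e (min M (g n x))" for n x
  have [measurable]: "g n \<in> borel_measurable borel" for n using g by (rule borel_measurable_continuous_onI)
  have cont: "continuous_on UNIV (Fs n)" for n unfolding Fs_def[abs_def] by (intro continuous_intros g)
  have [measurable]: "Fs n \<in> borel_measurable borel" for n using cont by (rule borel_measurable_continuous_onI)
  have "(\<lambda>n. Fs n x) \<longlonglongrightarrow> F x" if "x \<notin> N" for x
  proof -
    have "(\<lambda>n. Fs n x) \<longlonglongrightarrow> max e (min M (F x))"
      unfolding Fs_def by (intro tendsto_intros lim that)
    moreover have "max e (min M (F x)) = F x" using bF[of x] by simp
    ultimately show ?thesis by simp
  qed
  moreover have "AE x in lebesgue. x \<notin> N"
    using N by (intro AE_not_in) (simp add: negligible_iff_null_sets)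
  ultimately have "AE x in lebesgue. (\<lambda>n. Fs n x) \<longlonglongrightarrow> F x" by auto
  then have "AE x in lborel. (\<lambda>n. Fs n x) \<longlonglongrightarrow> F x" by (simp add: AE_completion_iff)
  moreover have "e \<le> Fs n x" "Fs n x \<le> M" for n x
    using bF[of x] by (auto simp: Fs_def)
  ultimately show ?thesis using that cont by blast
qed

context gauss_pair
begin

lemma continuous_inequality:
  assumes e: "0 < e" and F: "continuous_on UNIV F" and G: "continuous_on UNIV G"
    and bF: "\<And>x. e \<le> F x" "\<And>x. F x \<le> M" and bG: "\<And>x. e \<le> G x" "\<And>x. G x \<le> M"
  shows "(\<integral>w. F (X w) powr \<alpha> * G (Y w) powr \<beta> \<partial>std_gauss) \<le>
     (\<integral>w. F (X w) \<partial>std_gauss) powr \<alpha> * (\<integral>w. G (Y w) \<partial>std_gauss) powr \<beta>"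
proof -
  have [measurable]: "F \<in> borel_measurable borel" "G \<in> borel_measurable borel"
    using F G by (auto intro: borel_measurable_continuous_onI)
  have eM: "e \<le> M" using bF order_trans by blast
  have aF: "\<bar>F x\<bar> \<le> M" and aG: "\<bar>G y\<bar> \<le> M" for x y using bF[of x] bG[of y] e by auto
  define Fs where "Fs n x = (\<integral>z. F (x + inverse (real (Suc n)) *\<^sub>R z) \<partial>std_gauss)" for n x
  define Gs where "Gs n x = (\<integral>z. G (x + inverse (real (Suc n)) *\<^sub>R z) \<partial>std_gauss)" for n x
  have d: "0 < inverse (real (Suc n))" for n by simp
  have *: "\<exists>L a b. C11_bounded e M L (Fs n) a \<and> C11_bounded e M L (Gs n) b" for n
  proof -
    obtain L1 a where "0 \<le> L1" "\<And>L'. L1 \<le> L' \<Longrightarrow> C11_bounded e M L' (Fs n) a"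
      using C11_bounded_mollify[of F e M "inverse (real (Suc n))"] bF e d unfolding Fs_def[abs_def] by auto
    moreover obtain L2 b where "0 \<le> L2" "\<And>L'. L2 \<le> L' \<Longrightarrow> C11_bounded e M L' (Gs n) b"
      using C11_bounded_mollify[of G e M "inverse (real (Suc n))"] bG e d unfolding Gs_def[abs_def] by auto
    ultimately show ?thesis by (intro exI[of _ "max L1 L2"] exI[of _ a] exI[of _ b]) auto
  qed
  have p: "Fs n \<in> borel_measurable borel" "Gs n \<in> borel_measurable borel"
    "e \<le> Fs n x" "Fs n x \<le> M" "e \<le> Gs n y" "Gs n y \<le> M" for n x y
    using *[of n] by (auto simp: C11_bounded_def)
  show ?thesis
  proof (rule inequality_limit[where Fs = Fs and Gs = Gs, OF e p(1,2) _ _ p(3-6)])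
    show "AE w in std_gauss. (\<lambda>n. Fs n (X w)) \<longlonglongrightarrow> F (X w)"
      unfolding Fs_def using integral_mollify_tendsto[OF F aF] by simp
    show "AE w in std_gauss. (\<lambda>n. Gs n (Y w)) \<longlonglongrightarrow> G (Y w)"
      unfolding Gs_def using integral_mollify_tendsto[OF G aG] by simp
    show "(\<integral>w. Fs n (X w) powr \<alpha> * Gs n (Y w) powr \<beta> \<partial>std_gauss) \<le>
     (\<integral>w. Fs n (X w) \<partial>std_gauss) powr \<alpha> * (\<integral>w. Gs n (Y w) \<partial>std_gauss) powr \<beta>" for n
      using *[of n] C11_inequality[OF e eM] by blast
  qed auto
qed

text \<open>\<open>acX\<close> and \<open>acY\<close> state that the laws of \<open>X\<close> and
  \<open>Y\<close> are absolutely continuous, so that convergence outside a Lebesgue null set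
  survives composition with them.\<close>

lemma measurable_inequality:
  assumes e: "0 < e" and F [measurable]: "F \<in> borel_measurable borel" and G [measurable]: "G \<in> borel_measurable borel"
    and bF: "\<And>x. e \<le> F x" "\<And>x. F x \<le> M" and bG: "\<And>x. e \<le> G x" "\<And>x. G x \<le> M"
    and acX: "\<And>P. AE x in lborel. P x \<Longrightarrow> AE w in std_gauss. P (X w)"
    and acY: "\<And>P. AE x in lborel. P x \<Longrightarrow> AE w in std_gauss. P (Y w)"
  shows "(\<integral>w. F (X w) powr \<alpha> * G (Y w) powr \<beta> \<partial>std_gauss) \<le>
     (\<integral>w. F (X w) \<partial>std_gauss) powr \<alpha> * (\<integral>w. G (Y w) \<partial>std_gauss) powr \<beta>"
proof -
  obtain Fs where Fs: "\<And>n. continuous_on UNIV (Fs n)" "\<And>n x. e \<le> Fs n x" "\<And>n x. Fs n x \<le> M"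
    and limF: "AE x in lborel. (\<lambda>n. Fs n x) \<longlonglongrightarrow> F x"
    using bounded_measurable_AE_limit_continuous[OF F bF] by blast
  obtain Gs where Gs: "\<And>n. continuous_on UNIV (Gs n)" "\<And>n x. e \<le> Gs n x" "\<And>n x. Gs n x \<le> M"
    and limG: "AE x in lborel. (\<lambda>n. Gs n x) \<longlonglongrightarrow> G x"
    using bounded_measurable_AE_limit_continuous[OF G bG] by blast
  show ?thesis
  proof (rule inequality_limit[where Fs = Fs and Gs = Gs, OF e _ _ F G Fs(2,3) Gs(2,3)])
    show "AE w in std_gauss. (\<lambda>n. Fs n (X w)) \<longlonglongrightarrow> F (X w)"
      by (rule acX[OF limF])
    show "AE w in std_gauss. (\<lambda>n. Gs n (Y w)) \<longlonglongrightarrow> G (Y w)"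
      by (rule acY[OF limG])
    show "(\<integral>w. Fs n (X w) powr \<alpha> * Gs n (Y w) powr \<beta> \<partial>std_gauss) \<le>
     (\<integral>w. Fs n (X w) \<partial>std_gauss) powr \<alpha> * (\<integral>w. Gs n (Y w) \<partial>std_gauss) powr \<beta>" for n
      by (rule continuous_inequality[OF e Fs(1) Gs(1) Fs(2,3) Gs(2,3)])
  qed (use Fs(1) Gs(1) in \<open>auto intro: borel_measurable_continuous_onI\<close>)
qed

end

section \<open>Stable evolution families\<close>

lemma bounded_bilinear_matrix_mult: "bounded_bilinear ((**) :: real^'n^'m \<Rightarrow> real^'k^'n \<Rightarrow> real^'k^'m)"
  unfolding bilinear_conv_bounded_bilinear[symmetric] bilinear_def
  by (intro conjI allI linearI)
    (simp_all add: matrix_add_ldistrib matrix_matrix_mult_def vec_eq_iff sum.distrib sum_distrib_left algebra_simps)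

interpretation matmul: bounded_bilinear "(**) :: real^'n^'m \<Rightarrow> real^'k^'n \<Rightarrow> real^'k^'m"
  by (rule bounded_bilinear_matrix_mult)

lemma bounded_linear_transpose: "bounded_linear (transpose :: real^'n^'m \<Rightarrow> real^'m^'n)"
  unfolding linear_conv_bounded_linear[symmetric]
  by (rule linearI) (simp_all add: transpose_def vec_eq_iff)

lemma bounded_bilinear_matrix_vector_mult: "bounded_bilinear ((*v) :: real^'n^'m \<Rightarrow> real^'n \<Rightarrow> real^'m)"
  unfolding bilinear_conv_bounded_bilinear[symmetric] bilinear_def
  by (intro conjI allI linearI)
    (simp_all add: matrix_vector_mult_def vec_eq_iff sum.distrib sum_distrib_left algebra_simps)

interpretation matvec: bounded_bilinear "(*v) :: real^'n^'m \<Rightarrow> real^'n \<Rightarrow> real^'m"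
  by (rule bounded_bilinear_matrix_vector_mult)

text \<open>Stability is given in the operator norm, while integrals of matrices are estimated in
  the norm of the matrix type.\<close>

lemma norm_le_mat_opnorm:
  fixes M :: "real^'n^'m"
  shows "norm M \<le> real (CARD('m) * CARD('n)) * mat_opnorm M"
proof -
  have "norm M \<le> (\<Sum>i\<in>UNIV. norm (M $ i))" by (simp add: norm_vec_def[of M] L2_set_le_sum)
  also have "\<dots> \<le> (\<Sum>i\<in>(UNIV::'m set). \<Sum>j\<in>(UNIV::'n set). \<bar>M $ i $ j\<bar>)"
    by (intro sum_mono norm_le_l1_cart)
  also have "\<dots> \<le> (\<Sum>i\<in>(UNIV::'m set). \<Sum>j\<in>(UNIV::'n set). mat_opnorm M)"
    unfolding mat_opnorm_def by (intro sum_mono matrix_component_le_onorm)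
  finally show ?thesis by simp
qed

lemma norm_matrix_vector_le_opnorm: "norm (M *v x) \<le> mat_opnorm M * norm x" for M :: "real^'n^'m"
  unfolding mat_opnorm_def by (rule onorm) simp

text \<open>A Gronwall argument in both time directions: \<open>|W|^2\<close> changes at relative
  rate at most \<open>c\<close>, so with weight \<open>exp (- c \<tau>)\<close> it is nonincreasing
  after \<open>r\<close>, and with weight \<open>exp (c \<tau>)\<close> it is nondecreasing before
  \<open>r\<close>.\<close>

lemma linear_ode_zero:
  fixes A :: "real \<Rightarrow> real^'n^'n" and W :: "real \<Rightarrow> real^'k^'n"
  assumes A: "bounded (range A)" and W: "\<And>\<tau>. (W has_vector_derivative (A \<tau> ** W \<tau>)) (at \<tau>)"
    and W0: "W r = 0"
  shows "W \<tau> = 0"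
proof -
  obtain a where a: "\<And>\<tau>. norm (A \<tau>) \<le> a" using A by (auto simp: bounded_iff)
  obtain K where K: "0 < K" "\<And>(M::real^'n^'n) (N::real^'k^'n). norm (M ** N) \<le> norm M * norm N * K"
    using matmul.pos_bounded by blast
  define c where "c = 2 * (a * K)"
  have a0: "0 \<le> a" using a[of 0] norm_ge_zero order_trans by blast
  have bound: "\<bar>2 * (W \<tau> \<bullet> (A \<tau> ** W \<tau>))\<bar> \<le> c * (W \<tau> \<bullet> W \<tau>)" for \<tau>
  proof -
    have "\<bar>W \<tau> \<bullet> (A \<tau> ** W \<tau>)\<bar> \<le> norm (W \<tau>) * norm (A \<tau> ** W \<tau>)" by (rule Cauchy_Schwarz_ineq2)
    also have "\<dots> \<le> norm (W \<tau>) * (a * norm (W \<tau>) * K)"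
      using K(2)[of "A \<tau>" "W \<tau>"] mult_right_mono[OF mult_right_mono[OF a[of \<tau>], of "norm (W \<tau>)"], of K] K(1)
      by (intro mult_left_mono) auto
    finally show ?thesis by (simp add: c_def dot_square_norm power2_eq_square abs_mult mult_ac)
  qed
  have der: "((\<lambda>\<tau>. exp (k * \<tau>) * (W \<tau> \<bullet> W \<tau>)) has_real_derivative
      exp (k * \<tau>) * (k * (W \<tau> \<bullet> W \<tau>) + 2 * (W \<tau> \<bullet> (A \<tau> ** W \<tau>)))) (at \<tau>)" for k \<tau>
  proof -
    have "((\<lambda>\<tau>. W \<tau> \<bullet> W \<tau>) has_vector_derivative (W \<tau> \<bullet> (A \<tau> ** W \<tau>) + (A \<tau> ** W \<tau>) \<bullet> W \<tau>)) (at \<tau>)"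
      by (rule bounded_bilinear.has_vector_derivative[OF bounded_bilinear_inner W W])
    then have "((\<lambda>\<tau>. W \<tau> \<bullet> W \<tau>) has_real_derivative (2 * (W \<tau> \<bullet> (A \<tau> ** W \<tau>)))) (at \<tau>)"
      by (simp add: has_real_derivative_iff_has_vector_derivative inner_commute)
    note [derivative_intros] = this
    show ?thesis by (auto intro!: derivative_eq_intros simp: algebra_simps)
  qed
  have "W \<tau> \<bullet> W \<tau> \<le> 0"
  proof (cases "r \<le> \<tau>")
    case True
    have "exp (- c * \<tau>) * (W \<tau> \<bullet> W \<tau>) \<le> exp (- c * r) * (W r \<bullet> W r)"
    proof (rule DERIV_nonpos_imp_nonincreasing[OF True])
      fix x
      show "\<exists>y. ((\<lambda>\<tau>. exp (- c * \<tau>) * (W \<tau> \<bullet> W \<tau>)) has_real_derivative y) (at x) \<and> y \<le> 0"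
        using der[of "- c" x] bound[of x] by (intro exI conjI) (auto intro!: mult_nonneg_nonpos simp: abs_le_iff)
    qed
    then show ?thesis using W0 by (simp add: mult_le_0_iff)
  next
    case False
    then have "\<tau> \<le> r" by simp
    have "exp (c * \<tau>) * (W \<tau> \<bullet> W \<tau>) \<le> exp (c * r) * (W r \<bullet> W r)"
    proof (rule DERIV_nonneg_imp_nondecreasing[OF \<open>\<tau> \<le> r\<close>])
      fix x
      show "\<exists>y. ((\<lambda>\<tau>. exp (c * \<tau>) * (W \<tau> \<bullet> W \<tau>)) has_real_derivative y) (at x) \<and> 0 \<le> y"
        using der[of c x] bound[of x] by (intro exI conjI) (auto intro!: mult_nonneg_nonneg simp: abs_le_iff)
    qed
    then show ?thesis using W0 by (simp add: mult_le_0_iff)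
  qed
  then show ?thesis by (metis inner_eq_zero_iff inner_ge_zero antisym)
qed

lemma integrable_on_exp_atMost:
  fixes a t :: real assumes "0 < a"
  shows "(\<lambda>r. exp (- a * (t - r))) integrable_on {..t}"
proof -
  have "(\<lambda>x. exp (- a * x)) absolutely_integrable_on {- t..}"
    using integrable_on_exp_minus_to_infinity[OF assms, of "- t"]
    by (intro nonnegative_absolutely_integrable_1) auto
  then have "(\<lambda>x. exp (- a * (- x))) integrable_on {..t}"
    using has_absolute_integral_reflect_real[of "{..t}" "{- t..}" "\<lambda>x. exp (- a * x)"]
    by (auto intro: set_lebesgue_integral_eq_integral(1))
  from integrable_cmul[OF this, of "exp (- a * t)"] show ?thesis
    by (simp add: exp_add[symmetric] algebra_simps)
qed

lemma absolutely_integrable_exp_bound: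
  fixes f :: "real \<Rightarrow> 'b::euclidean_space"
  assumes f: "continuous_on {..t} f" and a: "0 < a" and b: "\<And>r. r \<le> t \<Longrightarrow> norm (f r) \<le> c * exp (- a * (t - r))"
  shows "f absolutely_integrable_on {..t}"
proof (rule measurable_bounded_by_integrable_imp_absolutely_integrable)
  show "f \<in> borel_measurable (lebesgue_on {..t})"
    using f by (intro continuous_imp_measurable_on_sets_lebesgue) auto
  show "(\<lambda>r. c * exp (- a * (t - r))) integrable_on {..t}"
    using integrable_cmul[OF integrable_on_exp_atMost[OF a, of t], of c] by simp
qed (use b in auto)

lemma integral_atMost_split:
  fixes f :: "real \<Rightarrow> 'b::euclidean_space"
  assumes f: "f absolutely_integrable_on {..t}" and st: "s \<le> t"
  shows "f integrable_on {..s}" "f integrable_on {s..t}"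
    "integral {..t} f = integral {..s} f + integral {s..t} f"
proof -
  show 1: "f integrable_on {..s}" "f integrable_on {s..t}"
    using set_integrable_subset[OF f] st by (auto intro!: set_lebesgue_integral_eq_integral(1))
  have "{..t} = {..s} \<union> {s..t}" "{..s} \<inter> {s..t} = {s}" using st by auto
  with integral_Un[OF 1] show "integral {..t} f = integral {..s} f + integral {s..t} f" by simp
qed

locale stable_evolution =
  fixes A B :: "real \<Rightarrow> real^'n^'n" and f :: "real \<Rightarrow> real^'n"
    and U :: "real \<Rightarrow> real \<Rightarrow> real^'n^'n" and \<mu>0 :: real
  assumes bddA: "bounded (range A)"
    and contB: "continuous_on UNIV B" and bddB: "bounded (range B)"
    and contf: "continuous_on UNIV f" and bddf: "bounded (range f)"
    and mu0: "\<mu>0 > 0" and Bbelow: "\<And>r x. norm (B r *v x) \<ge> \<mu>0 * norm x"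
    and U_id: "\<And>r. U r r = mat 1"
    and U_deriv: "\<And>\<tau> r. ((\<lambda>\<tau>. U \<tau> r) has_vector_derivative (A \<tau> ** U \<tau> r)) (at \<tau>)"
    and stable: "\<exists>\<omega> M. \<omega> < 0 \<and> (\<forall>r \<tau>. r \<le> \<tau> \<longrightarrow> mat_opnorm (U \<tau> r) \<le> M * exp (\<omega> * (\<tau> - r)))"
begin

text \<open>The difference of the two sides, as a function of the first time, solves the linear
  equation and vanishes at \<open>r\<close>; uniqueness in both directions covers every order of the
  three times.\<close>

lemma cocycle: "U t r ** U r s = U t s"
proof -
  have "((\<lambda>\<tau>. U \<tau> r ** U r s) has_vector_derivative (A \<tau> ** U \<tau> r) ** U r s) (at \<tau>)" for \<tau>
    by (rule bounded_linear.has_vector_derivative[OF matmul.bounded_linear_left U_deriv])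
  then have "((\<lambda>\<tau>. U \<tau> s - U \<tau> r ** U r s) has_vector_derivative A \<tau> ** (U \<tau> s - U \<tau> r ** U r s)) (at \<tau>)" for \<tau>
    using has_vector_derivative_diff[OF U_deriv] by (simp add: matmul.diff_right matrix_mul_assoc)
  from linear_ode_zero[OF bddA this, of r t] show ?thesis by (simp add: U_id)
qed

lemma U_decay:
  obtains a c where "0 < a" "0 \<le> c" "\<And>r \<tau>. r \<le> \<tau> \<Longrightarrow> norm (U \<tau> r) \<le> c * exp (- a * (\<tau> - r))"
proof -
  obtain \<omega> M where \<omega>: "\<omega> < 0" and M: "\<And>r \<tau>. r \<le> \<tau> \<Longrightarrow> mat_opnorm (U \<tau> r) \<le> M * exp (\<omega> * (\<tau> - r))"
    using stable by auto
  let ?N = "real (CARD('n) * CARD('n))"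
  have "norm (U \<tau> r) \<le> \<bar>?N * M\<bar> * exp (- (- \<omega>) * (\<tau> - r))" if "r \<le> \<tau>" for r \<tau>
  proof -
    have "norm (U \<tau> r) \<le> ?N * mat_opnorm (U \<tau> r)" by (rule norm_le_mat_opnorm)
    also have "\<dots> \<le> ?N * (M * exp (\<omega> * (\<tau> - r)))" using M[OF that] by (intro mult_left_mono) auto
    also have "\<dots> = (?N * M) * exp (\<omega> * (\<tau> - r))" by simp
    also have "\<dots> \<le> \<bar>?N * M\<bar> * exp (\<omega> * (\<tau> - r))" by (intro mult_right_mono abs_ge_self) auto
    finally show ?thesis by simp
  qed
  with \<omega> that[of "- \<omega>" "\<bar>?N * M\<bar>"] show ?thesis by auto
qed

text \<open>The equation governs only the first argument of \<open>U\<close>. Continuity in the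
  second follows from \<open>U t r - U t \<sigma> = U t r ** (mat 1 - U r \<sigma>)\<close>, whose
  first factor is bounded by stability.\<close>

lemma continuous_on_U: "continuous_on {..t} (U t)"
  unfolding continuous_on_def
proof
  fix \<sigma> assume \<sigma>: "\<sigma> \<in> {..t}"
  obtain a c where a: "0 < a" and c: "0 \<le> c" and dec: "\<And>r \<tau>. r \<le> \<tau> \<Longrightarrow> norm (U \<tau> r) \<le> c * exp (- a * (\<tau> - r))"
    using U_decay by metis
  obtain K where K: "0 < K" "\<And>(M :: real^'n^'n) (N :: real^'n^'n). norm (M ** N) \<le> norm M * norm N * K"
    using matmul.pos_bounded by blast
  have "((\<lambda>r. U t r - U t \<sigma>) \<longlongrightarrow> 0) (at \<sigma> within {..t})"
  proof (rule Lim_null_comparison)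
    have "norm (U t r - U t \<sigma>) \<le> c * norm (mat 1 - U r \<sigma>) * K" if "r \<le> t" for r
    proof -
      have "U t r - U t \<sigma> = U t r ** (mat 1 - U r \<sigma>)" by (simp add: matmul.diff_right cocycle matrix_mul_rid)
      then have "norm (U t r - U t \<sigma>) \<le> norm (U t r) * norm (mat 1 - U r \<sigma>) * K" using K(2) by simp
      moreover have "norm (U t r) \<le> c"
      proof -
        have "norm (U t r) \<le> c * exp (- a * (t - r))" by (rule dec[OF that])
        also have "\<dots> \<le> c * 1" using a c that by (intro mult_left_mono) auto
        finally show ?thesis by simp
      qed
      ultimately show ?thesis
        using K(1) by (meson order_trans mult_right_mono norm_ge_zero less_imp_le)
    qed
    then show "\<forall>\<^sub>F r in at \<sigma> within {..t}. norm (U t r - U t \<sigma>) \<le> c * norm (mat 1 - U r \<sigma>) * K"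
      by (auto simp: eventually_at_filter)
    have "isCont (\<lambda>r. U r \<sigma>) \<sigma>"
      using has_vector_derivative_continuous[OF U_deriv] by blast
    then have "((\<lambda>r. U r \<sigma>) \<longlongrightarrow> mat 1) (at \<sigma> within {..t})"
      using U_id[of \<sigma>] by (metis continuous_at_imp_continuous_at_within continuous_within)
    then have "((\<lambda>r. c * norm (mat 1 - U r \<sigma>) * K) \<longlongrightarrow> c * norm (mat 1 - mat 1 :: real^'n^'n) * K) (at \<sigma> within {..t})"
      by (intro tendsto_intros)
    then show "((\<lambda>r. c * norm (mat 1 - U r \<sigma>) * K) \<longlongrightarrow> 0) (at \<sigma> within {..t})" by simp
  qed
  then show "(U t \<longlongrightarrow> U t \<sigma>) (at \<sigma> within {..t})" by (simp add: LIM_zero_iff)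
qed

section \<open>Covariances and means of the evolution\<close>

abbreviation cov_density :: "real \<Rightarrow> real \<Rightarrow> real^'n^'n" where
  "cov_density t r \<equiv> U t r ** B r ** transpose (B r) ** transpose (U t r)"

lemma continuous_on_cov_density: "continuous_on {..t} (cov_density t)"
  by (intro matmul.continuous_on bounded_linear.continuous_on[OF bounded_linear_transpose]
      continuous_on_U continuous_on_subset[OF contB] subset_UNIV)

lemma cov_density_eq: "cov_density t r = (U t r ** B r) ** transpose (U t r ** B r)"
  by (simp add: matrix_transpose_mul matrix_mul_assoc)

lemma quadratic_cov_density:
  "y \<bullet> (cov_density t r *v y) = (norm (transpose (B r) *v (transpose (U t r) *v y)))\<^sup>2"
proof -
  have "y \<bullet> (cov_density t r *v y) = y \<bullet> ((U t r ** B r) *v (transpose (U t r ** B r) *v y))"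
    unfolding cov_density_eq by (simp only: matrix_vector_mul_assoc)
  also have "\<dots> = (transpose (U t r ** B r) *v y) \<bullet> (transpose (U t r ** B r) *v y)"
    by (metis inner_commute inner_matrix_vector_left)
  finally show ?thesis
    by (simp only: matrix_transpose_mul matrix_vector_mul_assoc power2_norm_eq_inner)
qed

lemma absolutely_integrable_cov_density: "cov_density t absolutely_integrable_on {..t}"
proof -
  obtain a c where a: "0 < a" and c: "0 \<le> c" and dec: "\<And>r \<tau>. r \<le> \<tau> \<Longrightarrow> norm (U \<tau> r) \<le> c * exp (- a * (\<tau> - r))"
    using U_decay by metis
  obtain b where b: "\<And>r. norm (B r) \<le> b" using bddB by (auto simp: bounded_iff)
  have b0: "0 \<le> b" using b[of 0] norm_ge_zero order_trans by blast
  obtain K where K: "0 < K" "\<And>(M :: real^'n^'n) (N :: real^'n^'n). norm (M ** N) \<le> norm M * norm N * K"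
    using matmul.pos_bounded by blast
  obtain T where T: "0 < T" "\<And>M :: real^'n^'n. norm (transpose M) \<le> norm M * T"
    using bounded_linear.pos_bounded[OF bounded_linear_transpose] by blast
  define d where "d = c * b * K"
  have d0: "0 \<le> d" using b0 c K by (simp add: d_def)
  show ?thesis
  proof (rule absolutely_integrable_exp_bound[OF continuous_on_cov_density, of "2 * a"])
    fix r assume "r \<le> t"
    let ?N = "U t r ** B r" and ?e = "exp (- a * (t - r))"
    have N: "norm ?N \<le> d * ?e"
    proof -
      have "norm ?N \<le> norm (U t r) * norm (B r) * K" by (rule K)
      also have "\<dots> \<le> (c * ?e) * b * K"
        using dec[OF \<open>r \<le> t\<close>] b[of r] c b0 K by (intro mult_right_mono mult_mono) auto
      finally show ?thesis by (simp add: d_def mult_ac)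
    qed
    have "norm (cov_density t r) \<le> norm ?N * norm (transpose ?N) * K" unfolding cov_density_eq by (rule K)
    also have "\<dots> \<le> (d * ?e) * ((d * ?e) * T) * K"
      using N order_trans[OF T(2) mult_right_mono[OF N]] T K d0 by (intro mult_right_mono mult_mono) auto
    also have "\<dots> = (d * d * T * K) * (?e * ?e)" by simp
    also have "?e * ?e = exp (- (2 * a) * (t - r))" by (simp add: exp_add[symmetric] algebra_simps)
    finally show "norm (cov_density t r) \<le> (d * d * T * K) * exp (- (2 * a) * (t - r))" .
  qed (use a in auto)
qed

lemma absolutely_integrable_mean: "(\<lambda>r. U t r *v f r) absolutely_integrable_on {..t}"
proof -
  obtain a c where a: "0 < a" and c: "0 \<le> c" and dec: "\<And>r \<tau>. r \<le> \<tau> \<Longrightarrow> norm (U \<tau> r) \<le> c * exp (- a * (\<tau> - r))"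
    using U_decay by metis
  obtain b where b: "\<And>r. norm (f r) \<le> b" using bddf by (auto simp: bounded_iff)
  have b0: "0 \<le> b" using b[of 0] norm_ge_zero order_trans by blast
  obtain K where K: "0 < K" "\<And>(M :: real^'n^'n) x. norm (M *v x) \<le> norm M * norm x * K"
    using matvec.pos_bounded by blast
  show ?thesis
  proof (rule absolutely_integrable_exp_bound[OF _ a])
    show "continuous_on {..t} (\<lambda>r. U t r *v f r)"
      by (intro matvec.continuous_on continuous_on_U continuous_on_subset[OF contf] subset_UNIV)
    fix r assume "r \<le> t"
    have "norm (U t r *v f r) \<le> norm (U t r) * norm (f r) * K" by (rule K)
    also have "\<dots> \<le> (c * exp (- a * (t - r))) * b * K"
      using dec[OF \<open>r \<le> t\<close>] b[of r] c b0 K by (intro mult_right_mono mult_mono) auto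
    finally show "norm (U t r *v f r) \<le> (c * b * K) * exp (- a * (t - r))" by (simp add: mult_ac)
  qed
qed

text \<open>The cocycle law pulls \<open>U t s\<close> out of the integral over the past of
  \<open>s\<close>. Together with \<open>meanGinf_split\<close> this identity makes
  \<open>nu\<close> at time \<open>t\<close> the image of \<open>nu\<close> at time \<open>s\<close>
  under the transition.\<close>

lemma covQinf_split:
  assumes "s \<le> t"
  shows "covQinf U B t = U t s ** covQinf U B s ** transpose (U t s) + covQ U B t s"
proof -
  have bl: "bounded_linear (\<lambda>M. U t s ** M ** transpose (U t s))"
    by (rule bounded_linear_compose[OF matmul.bounded_linear_left matmul.bounded_linear_right])
  have "integral {..s} (cov_density t) = integral {..s} ((\<lambda>M. U t s ** M ** transpose (U t s)) \<circ> cov_density s)"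
  proof (rule arg_cong[where f = "integral {..s}"], rule ext)
    fix r
    show "cov_density t r = ((\<lambda>M. U t s ** M ** transpose (U t s)) \<circ> cov_density s) r"
      unfolding o_def cocycle[of t s r, symmetric] by (simp only: matrix_transpose_mul matrix_mul_assoc)
  qed
  also have "\<dots> = U t s ** covQinf U B s ** transpose (U t s)"
    unfolding covQinf_def
    by (rule integral_linear[OF _ bl]) (rule set_lebesgue_integral_eq_integral(1)[OF absolutely_integrable_cov_density])
  finally show ?thesis
    using integral_atMost_split(3)[OF absolutely_integrable_cov_density assms] by (simp add: covQinf_def covQ_def)
qed

lemma meanGinf_split:
  assumes "s \<le> t"
  shows "meanGinf U f t = U t s *v meanGinf U f s + meanG U f t s"
proof -
  have "integral {..s} (\<lambda>r. U t r *v f r) = integral {..s} (((*v) (U t s)) \<circ> (\<lambda>r. U s r *v f r))"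
  proof (rule arg_cong[where f = "integral {..s}"], rule ext)
    fix r
    show "U t r *v f r = ((*v) (U t s) \<circ> (\<lambda>r. U s r *v f r)) r"
      unfolding o_def cocycle[of t s r, symmetric] by (simp only: matrix_vector_mul_assoc)
  qed
  also have "\<dots> = U t s *v meanGinf U f s"
    unfolding meanGinf_def
    by (rule integral_linear[OF _ matvec.bounded_linear_right]) (rule set_lebesgue_integral_eq_integral(1)[OF absolutely_integrable_mean])
  finally show ?thesis
    using integral_atMost_split(3)[OF absolutely_integrable_mean assms] by (simp add: meanGinf_def meanG_def)
qed

lemma quadratic_integral:
  assumes "cov_density t integrable_on S"
  shows "y \<bullet> (integral S (cov_density t) *v y) = integral S (\<lambda>r. y \<bullet> (cov_density t r *v y))"
proof -
  have "bounded_linear (\<lambda>M :: real^'n^'n. y \<bullet> (M *v y))"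
    by (rule bounded_linear_compose[OF bounded_linear_inner_right matvec.bounded_linear_left])
  from integral_linear[OF assms this] show ?thesis by (simp add: o_def)
qed

lemma transpose_integral:
  assumes "cov_density t integrable_on S"
  shows "transpose (integral S (cov_density t)) = integral S (cov_density t)"
proof -
  have "transpose (cov_density t r) = cov_density t r" for r
    by (simp add: matrix_transpose_mul matrix_mul_assoc)
  then show ?thesis
    using integral_linear[OF assms bounded_linear_transpose] by (simp add: o_def)
qed

lemma invertible_transpose_B: "invertible (transpose (B r))"
proof -
  have "x = 0" if "B r *v x = 0" for x
    using Bbelow[of x r] that mu0 by (simp add: mult_le_0_iff)
  then have "inj ((*v) (B r))" by (simp add: linear_injective_0)
  then have "invertible (B r)"
    using matrix_left_invertible_injective invertible_left_inverse by blast
  then show ?thesis by (simp add: transpose_invertible)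
qed

text \<open>The form is the integral of a continuous nonnegative function of \<open>r\<close> whose
  value at \<open>r = t\<close> is \<open>|transpose (B t) x|^2\<close>, positive because
  \<open>transpose (B t)\<close> is invertible.\<close>

lemma pos_def_covQ:
  assumes "s < t"
  shows "pos_def (covQ U B t s)"
  unfolding pos_def_def
proof (intro conjI allI impI)
  have int: "cov_density t integrable_on {s..t}"
    using integral_atMost_split(2)[OF absolutely_integrable_cov_density] assms by simp
  show "transpose (covQ U B t s) = covQ U B t s" unfolding covQ_def by (rule transpose_integral[OF int])
  fix x :: "real^'n" assume x: "x \<noteq> 0"
  let ?g = "\<lambda>r. x \<bullet> (cov_density t r *v x)"
  have q: "x \<bullet> (covQ U B t s *v x) = integral {s..t} ?g" unfolding covQ_def by (rule quadratic_integral[OF int])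
  have g0: "0 \<le> ?g r" for r unfolding quadratic_cov_density by simp
  have cont: "continuous_on {s..t} ?g"
    by (intro continuous_intros matvec.continuous_on continuous_on_subset[OF continuous_on_cov_density]) auto
  have "transpose (B t) *v x \<noteq> 0"
    using x inj_matrix_vector_mult[OF invertible_transpose_B[of t]] by (metis injD matrix_vector_mult_0_right)
  then have "?g t \<noteq> 0" unfolding quadratic_cov_density by (simp add: U_id transpose_mat)
  then have "integral {s..t} ?g \<noteq> 0"
    using integral_eq_0_iff[OF cont assms] g0 assms by auto
  moreover have "0 \<le> integral {s..t} ?g"
    by (rule integral_nonneg[OF integrable_continuous_real[OF cont]]) (rule g0)
  ultimately show "0 < x \<bullet> (covQ U B t s *v x)" using q by simp
qed

lemma quadratic_covQinf_nonneg: "0 \<le> x \<bullet> (covQinf U B t *v x)"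
proof -
  have int: "cov_density t integrable_on {..t}"
    by (rule set_lebesgue_integral_eq_integral(1)[OF absolutely_integrable_cov_density])
  have "bounded_linear (\<lambda>M :: real^'n^'n. x \<bullet> (M *v x))"
    by (rule bounded_linear_compose[OF bounded_linear_inner_right matvec.bounded_linear_left])
  from integrable_linear[OF int this] show ?thesis
    unfolding covQinf_def quadratic_integral[OF int]
    by (intro integral_nonneg) (auto simp: o_def quadratic_cov_density)
qed

text \<open>Strict positivity comes from the last unit of time, by \<open>pos_def_covQ\<close>; the
  earlier part contributes a nonnegative form.\<close>

lemma pos_def_covQinf: "pos_def (covQinf U B t)"
  unfolding pos_def_def
proof (intro conjI allI impI)
  show "transpose (covQinf U B t) = covQinf U B t"
    unfolding covQinf_def
    by (rule transpose_integral[OF set_lebesgue_integral_eq_integral(1)[OF absolutely_integrable_cov_density]])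
  fix x :: "real^'n" assume x: "x \<noteq> 0"
  have "x \<bullet> (covQinf U B t *v x) = x \<bullet> ((U t (t - 1) ** covQinf U B (t - 1) ** transpose (U t (t - 1))) *v x)
      + x \<bullet> (covQ U B t (t - 1) *v x)"
    by (subst covQinf_split[of "t - 1" t]) (simp_all add: matrix_vector_mult_add_rdistrib inner_add_right)
  moreover have "x \<bullet> ((U t (t - 1) ** covQinf U B (t - 1) ** transpose (U t (t - 1))) *v x) =
      (transpose (U t (t - 1)) *v x) \<bullet> (covQinf U B (t - 1) *v (transpose (U t (t - 1)) *v x))"
    by (metis inner_commute inner_matrix_vector_left matrix_vector_mul_assoc)
  moreover have "0 < x \<bullet> (covQ U B t (t - 1) *v x)"
    using pos_def_covQ[of "t - 1" t] x by (simp add: pos_def_def)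
  ultimately show "0 < x \<bullet> (covQinf U B t *v x)" using quadratic_covQinf_nonneg by (simp add: add_nonneg_pos)
qed

end

section \<open>Hypercontractivity\<close>

text \<open>The sign of the derivative is known only where \<open>p > 1\<close>, which is the claim
  itself. The last time \<open>r0\<close> with \<open>p r0 <= 1\<close> breaks the circle: after
  \<open>r0\<close> the function is nonincreasing, so \<open>p r0 >= p t > 1\<close>.\<close>

lemma exponent_gt_one:
  fixes p :: "real \<Rightarrow> real"
  assumes q: "1 < p t"
    and ode: "\<And>r. r \<le> t \<Longrightarrow> (p has_real_derivative p' r) (at r within {..t})"
    and neg: "\<And>r. r \<le> t \<Longrightarrow> 1 < p r \<Longrightarrow> p' r \<le> 0"
    and r: "r \<le> t"
  shows "1 < p r"
proof (rule ccontr)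
  assume "\<not> 1 < p r"
  define Z where "Z = {x \<in> {..t}. p x \<le> 1}"
  have cont: "continuous_on {..t} p"
    using ode by (auto simp: continuous_on_eq_continuous_within intro: DERIV_continuous)
  have "closed Z"
    unfolding Z_def by (rule continuous_on_closed_Collect_le[OF cont continuous_on_const]) auto
  moreover have "Z \<noteq> {}" "bdd_above Z" using r \<open>\<not> 1 < p r\<close> by (auto simp: Z_def)
  ultimately have Sup: "Sup Z \<in> Z" by (simp add: closed_contains_Sup)
  define r0 where "r0 = Sup Z"
  have r0: "r0 < t" "p r0 \<le> 1" using Sup q by (auto simp: Z_def r0_def less_le)
  have gt: "1 < p x" if "r0 < x" "x \<le> t" for x
    using cSup_upper[OF _ \<open>bdd_above Z\<close>, of x] that by (force simp: Z_def r0_def)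
  have "p t \<le> p r0"
  proof (rule DERIV_nonpos_imp_decreasing_open[OF less_imp_le[OF r0(1)]])
    fix x assume x: "r0 < x" "x < t"
    have "at x within {..t} = at x within UNIV"
      by (rule at_within_nhd[of x "{..<t}"]) (use x in auto)
    with ode[of x] neg[of x] gt[of x] x show "\<exists>y. (p has_real_derivative y) (at x) \<and> y \<le> 0" by auto
  next
    show "continuous_on {r0..t} p" by (rule continuous_on_subset[OF cont]) auto
  qed
  then show False using r0 q by simp
qed

context stable_evolution
begin

abbreviation cov_ratio :: "real \<Rightarrow> real" where
  "cov_ratio r \<equiv> (mat_opnorm (msqrt (covQinf U B r) ** matrix_inv (transpose (B r))))\<^sup>2"

text \<open>Write \<open>z\<close> as the inverse of \<open>transpose (B r)\<close> applied to
  \<open>transpose (B r) *v z\<close>; the operator norm in \<open>cfun\<close> is the constant that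
  results.\<close>

lemma quadratic_covQinf_le:
  "z \<bullet> (covQinf U B r *v z) \<le> cov_ratio r * (norm (transpose (B r) *v z))\<^sup>2"
proof -
  let ?S = "msqrt (covQinf U B r)" and ?B = "transpose (B r)"
  have "matrix_inv ?B ** ?B = mat 1"
    by (rule matrix_inv_invertible(2)[OF invertible_transpose_B])
  then have "?S *v z = (?S ** matrix_inv ?B) *v (?B *v z)"
    by (simp only: matrix_vector_mul_assoc matrix_mul_assoc[symmetric] matrix_mul_rid)
  then have "norm (?S *v z) \<le> mat_opnorm (?S ** matrix_inv ?B) * norm (?B *v z)"
    by (metis norm_matrix_vector_le_opnorm)
  then have "(norm (?S *v z))\<^sup>2 \<le> (mat_opnorm (?S ** matrix_inv ?B) * norm (?B *v z))\<^sup>2"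
    by (rule power_mono) simp
  then show ?thesis
    by (simp only: norm_msqrt_mult[OF pos_def_covQinf] power_mult_distrib)
qed

text \<open>The equation is linear in \<open>p - 1\<close>, which is why \<open>p - 1\<close> is the
  weight in the monotone quantity. If \<open>cov_ratio r = 0\<close>, both sides are zero by the
  convention for division.\<close>

lemma cfun_quotient: "1 < x \<Longrightarrow> - x / cfun U B x r = - ((x - 1) / cov_ratio r)"
  by (simp add: cfun_def)

lemma exponent_gt:
  assumes q: "1 < p t"
    and ode: "\<And>r. r \<le> t \<Longrightarrow> (p has_real_derivative (- p r / cfun U B (p r) r)) (at r within {..t})"
    and "r \<le> t"
  shows "1 < p r"
proof (rule exponent_gt_one[OF q ode _ \<open>r \<le> t\<close>])
  fix r assume "1 < p r"
  then show "- p r / cfun U B (p r) r \<le> 0"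
    unfolding cfun_quotient[OF \<open>1 < p r\<close>] by simp
qed auto

text \<open>The function \<open>v r = \<langle>U t r Q r U\<^sup>* t r y, y\<rangle>\<close> has derivative \<open>|B\<^sup>* r U\<^sup>* t r y|\<^sup>2\<close>, which dominates
  \<open>v r / cov_ratio r\<close>; hence \<open>v * (p - 1)\<close> is nondecreasing.\<close>

lemma covariance_decay:
  assumes st: "s \<le> t" and q: "1 < p t"
    and ode: "\<And>r. r \<le> t \<Longrightarrow> (p has_real_derivative (- p r / cfun U B (p r) r)) (at r within {..t})"
  shows "(p s - 1) * ((transpose (U t s) *v y) \<bullet> (covQinf U B s *v (transpose (U t s) *v y)))
    \<le> (p t - 1) * (y \<bullet> (covQinf U B t *v y))"
proof -
  define g where "g r = (norm (transpose (B r) *v (transpose (U t r) *v y)))\<^sup>2" for r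
  define v where "v r = (transpose (U t r) *v y) \<bullet> (covQinf U B r *v (transpose (U t r) *v y))" for r
  have pgt: "1 < p r" if "r \<le> t" for r by (rule exponent_gt[OF q ode that])
  have gcont: "continuous_on {..t} g"
    unfolding g_def quadratic_cov_density[symmetric]
    by (intro continuous_intros matvec.continuous_on continuous_on_cov_density)
  \<comment> \<open>Splitting the covariance at \<open>r\<close> exhibits \<open>v\<close> as a
    constant minus an integral with lower limit \<open>r\<close>, so its derivative is
    \<open>g\<close> by the fundamental theorem of calculus.\<close>
  have v: "v r = y \<bullet> (covQinf U B t *v y) - integral {r..t} g" if "r \<le> t" for r
  proof -
    have "v r = y \<bullet> ((U t r ** covQinf U B r ** transpose (U t r)) *v y)"
      unfolding v_def by (metis inner_commute inner_matrix_vector_left matrix_vector_mul_assoc)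
    moreover have "y \<bullet> (covQ U B t r *v y) = integral {r..t} g"
      unfolding covQ_def g_def quadratic_cov_density[symmetric]
      by (rule quadratic_integral[OF integral_atMost_split(2)[OF absolutely_integrable_cov_density that]])
    ultimately show ?thesis
      by (subst covQinf_split[OF that]) (simp add: matrix_vector_mult_add_rdistrib inner_add_right)
  qed
  have vder: "(v has_real_derivative g r) (at r within {s..t})" if "r \<in> {s..t}" for r
  proof -
    have "((\<lambda>r. y \<bullet> (covQinf U B t *v y) - integral {r..t} g) has_real_derivative g r) (at r within {s..t})"
      using integral_has_real_derivative'[OF continuous_on_subset[OF gcont] that]
      by (auto intro!: derivative_eq_intros)
    then show ?thesis
      by (rule has_field_derivative_transform_within[of _ _ _ _ 1]) (use v that in auto)
  qed
  have pder: "(p has_real_derivative (- p r / cfun U B (p r) r)) (at r within {s..t})" if "r \<in> {s..t}" for r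
    using ode[of r] that by (auto intro: DERIV_subset)
  have "v s * (p s - 1) \<le> v t * (p t - 1)"
  proof (rule DERIV_nonneg_imp_increasing_open[OF st])
    have "continuous_on {s..t} v" "continuous_on {s..t} p"
      unfolding continuous_on_eq_continuous_within
      using DERIV_continuous[OF vder] DERIV_continuous[OF pder] by blast+
    then show "continuous_on {s..t} (\<lambda>r. v r * (p r - 1))" by (intro continuous_intros)
    fix r assume r: "s < r" "r < t"
    have at: "at r within {s..t} = at r" using r by (intro at_within_interior) simp
    let ?d = "v r * (- ((p r - 1) / cov_ratio r)) + g r * (p r - 1)"
    have "((\<lambda>r. v r * (p r - 1)) has_real_derivative ?d) (at r)"
      using DERIV_mult[OF vder[of r] DERIV_diff[OF pder[of r] DERIV_const[of 1]]] r pgt[of r]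
      by (simp add: at cfun_quotient[symmetric] mult.commute)
    moreover have "0 \<le> ?d"
    proof -
      have vg: "v r \<le> cov_ratio r * g r" unfolding v_def g_def by (rule quadratic_covQinf_le)
      have p1: "0 \<le> p r - 1" using pgt[of r] r by simp
      have "v r / cov_ratio r \<le> g r"
      proof (cases "cov_ratio r = 0")
        \<comment> \<open>The quotient is zero by the convention for division, and the inequality is
          \<open>0 <= g r\<close>.\<close>
        case True then show ?thesis by (simp add: g_def)
      next
        case False
        then have "0 < cov_ratio r" by (simp add: less_le)
        with vg show ?thesis by (simp add: pos_divide_le_eq mult.commute)
      qed
      from mult_right_mono[OF this p1] show ?thesis by (simp add: field_simps)
    qed
    ultimately show "\<exists>d. ((\<lambda>r. v r * (p r - 1)) has_real_derivative d) (at r) \<and> 0 \<le> d" by blast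
  qed
  moreover have "v t = y \<bullet> (covQinf U B t *v y)" by (simp add: v)
  ultimately show ?thesis by (simp add: v_def mult.commute)
qed

end

section \<open>The Gaussian pair of one transition\<close>

lemma AE_std_gauss_linear:
  fixes T R :: "'a::euclidean_space \<Rightarrow> 'a"
  assumes T: "linear T" and R: "\<And>y. T (R y) = y" and N: "N \<in> null_sets lborel"
  shows "AE x in std_gauss. T x \<notin> N"
proof -
  note [measurable] = linear_borel_measurable[OF T]
  have [measurable]: "N \<in> sets borel" using N by auto
  have "(\<integral>\<^sup>+x. indicator N (T x) \<partial>lborel) = (\<integral>\<^sup>+x. gauss_density (T x) \<partial>lborel) * (\<integral>\<^sup>+x. indicator N x \<partial>lborel)"
    by (rule nn_integral_lborel_linear[OF T R]) simp
  also have "\<dots> = 0" using null_setsD1[OF N] by simp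
  finally have "AE x in lborel. indicator N (T x) = (0::ennreal)"
    by (subst (asm) nn_integral_0_iff_AE) auto
  then have "AE x in lborel. T x \<notin> N" by eventually_elim (simp add: indicator_def split: if_splits)
  then show ?thesis unfolding std_gauss_def by (subst AE_density) auto
qed

lemma borel_measurable_matrix_vector_mult [measurable]: "(*v) M \<in> borel_measurable borel" for M :: "real^'n^'n"
  by (rule linear_borel_measurable) (simp add: matrix_vector_mul_linear)

text \<open>One transition with the means removed: \<open>V\<close> is \<open>U t s\<close>, and the
  covariances are those of \<open>nu\<close> at time \<open>s\<close>, of the transition, and of
  \<open>nu\<close> at time \<open>t\<close>. \<open>decay\<close> is what
  \<open>covariance_decay\<close> delivers.\<close>

locale gauss_transition =
  fixes V Qs Q2 Qt :: "real^'n^'n" and p q :: real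
  assumes Qs: "pos_def Qs" and Q2: "pos_def Q2" and Qt: "pos_def Qt"
    and Qt_eq: "Qt = V ** Qs ** transpose V + Q2"
    and p: "1 < p" and q: "1 < q"
    and decay: "\<And>y. (p - 1) * ((transpose V *v y) \<bullet> (Qs *v (transpose V *v y))) \<le> (q - 1) * (y \<bullet> (Qt *v y))"
begin

text \<open>Under the standard Gaussian on the product the two components are independent; the first
  carries the state at time \<open>s\<close>, the second the noise accumulated afterwards.\<close>

definition X :: "(real^'n) \<times> (real^'n) \<Rightarrow> real^'n" where
  "X w = msqrt Qs *v fst w"

definition Y :: "(real^'n) \<times> (real^'n) \<Rightarrow> real^'n" where
  "Y w = V *v X w + msqrt Q2 *v snd w"

lemma linear_X: "linear X"
  unfolding X_def[abs_def] by (rule linearI) (simp_all add: matrix_vector_right_distrib matrix_vector_mult_scaleR)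

lemma linear_Y: "linear Y"
  unfolding Y_def[abs_def] X_def
  by (rule linearI) (simp_all add: matrix_vector_right_distrib matrix_vector_mult_scaleR scaleR_add_right)

lemma adjoint_X: "adjoint X = (\<lambda>a. (msqrt Qs *v a, 0))"
  by (rule adjoint_unique)
    (simp add: X_def inner_prod_def inner_matrix_vector_left transpose_msqrt[OF Qs])

lemma adjoint_Y: "adjoint Y = (\<lambda>b. (msqrt Qs *v (transpose V *v b), msqrt Q2 *v b))"
  by (rule adjoint_unique)
    (simp only: Y_def X_def inner_prod_def inner_add_left inner_matrix_vector_left transpose_msqrt[OF Qs]
      transpose_msqrt[OF Q2] fst_conv snd_conv, simp)

lemma norm_adjoint_Y:
  "(norm (msqrt Qs *v (transpose V *v b)))\<^sup>2 + (norm (msqrt Q2 *v b))\<^sup>2 = b \<bullet> (Qt *v b)"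
proof -
  have "b \<bullet> ((V ** Qs ** transpose V) *v b) = (transpose V *v b) \<bullet> (Qs *v (transpose V *v b))"
    by (metis inner_commute inner_matrix_vector_left matrix_vector_mul_assoc)
  then show ?thesis
    by (simp only: norm_msqrt_mult[OF Qs] norm_msqrt_mult[OF Q2] Qt_eq matrix_vector_mult_add_rdistrib inner_add_right)
qed

text \<open>With \<open>\<alpha> = 1 - 1/p\<close> and \<open>\<beta> = 1/q\<close> one has
  \<open>\<alpha> - \<alpha>^2 = (p - 1)/p^2\<close> and
  \<open>\<beta> - \<beta>^2 = (q - 1)/q^2\<close>. After expansion only the cross term
  \<open>2 \<alpha> \<beta> <x, y>\<close> needs an estimate: by Young's inequality it is at most
  \<open>(p - 1) (|x|^2/p^2 + |y|^2/q^2)\<close>, and \<open>decay\<close> turns the second part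
  into what is available for \<open>Y\<close>.\<close>

lemma gauss_pair: "gauss_pair X Y (1 - 1 / p) (1 / q)"
proof (rule gauss_pair.intro)
  fix a b
  define x where "x = msqrt Qs *v a"
  define y where "y = msqrt Qs *v (transpose V *v b)"
  define z where "z = msqrt Q2 *v b"
  have "(p - 1) * (norm y)\<^sup>2 \<le> (q - 1) * ((norm y)\<^sup>2 + (norm z)\<^sup>2)"
    using decay[of b] unfolding y_def z_def norm_adjoint_Y by (simp only: norm_msqrt_mult[OF Qs])
  then have 1: "(p - 1) / q\<^sup>2 * (norm y)\<^sup>2 \<le> (q - 1) / q\<^sup>2 * ((norm y)\<^sup>2 + (norm z)\<^sup>2)"
    by (simp add: divide_right_mono)
  have "2 * ((1 / p) * (1 / q)) * (x \<bullet> y) \<le> 2 * ((1 / p) * (1 / q)) * (norm x * norm y)"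
    using p q by (intro mult_left_mono norm_cauchy_schwarz) auto
  also have "\<dots> \<le> (1 / p)\<^sup>2 * (norm x)\<^sup>2 + (1 / q)\<^sup>2 * (norm y)\<^sup>2"
    using zero_le_power2[of "norm x / p - norm y / q"] by (simp add: power2_eq_square algebra_simps)
  finally have "(p - 1) * (2 * ((1 / p) * (1 / q)) * (x \<bullet> y)) \<le> (p - 1) * ((1 / p)\<^sup>2 * (norm x)\<^sup>2 + (1 / q)\<^sup>2 * (norm y)\<^sup>2)"
    using p by (intro mult_left_mono) auto
  also have "\<dots> = (p - 1) / p\<^sup>2 * (norm x)\<^sup>2 + (p - 1) / q\<^sup>2 * (norm y)\<^sup>2"
    by (simp add: power_divide distrib_left)
  also have "\<dots> \<le> (p - 1) / p\<^sup>2 * (norm x)\<^sup>2 + (q - 1) / q\<^sup>2 * ((norm y)\<^sup>2 + (norm z)\<^sup>2)"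
    using 1 by simp
  finally have 2: "(p - 1) * (2 * ((1 / p) * (1 / q)) * (x \<bullet> y)) \<le>
      (p - 1) / p\<^sup>2 * (norm x)\<^sup>2 + (q - 1) / q\<^sup>2 * ((norm y)\<^sup>2 + (norm z)\<^sup>2)" .
  define \<alpha> where "\<alpha> = 1 - 1 / p"
  define \<beta> where "\<beta> = 1 / q"
  have c: "(p - 1) * ((1 / p) * (1 / q)) = \<alpha> * \<beta>" "(p - 1) / p\<^sup>2 = \<alpha> - \<alpha>\<^sup>2" "(q - 1) / q\<^sup>2 = \<beta> - \<beta>\<^sup>2"
    using p q by (simp_all add: \<alpha>_def \<beta>_def power2_eq_square field_simps)
  have 3: "2 * (\<alpha> * \<beta>) * (x \<bullet> y) \<le> (\<alpha> - \<alpha>\<^sup>2) * (norm x)\<^sup>2 + (\<beta> - \<beta>\<^sup>2) * ((norm y)\<^sup>2 + (norm z)\<^sup>2)"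
  proof -
    have "2 * (\<alpha> * \<beta>) * (x \<bullet> y) = (p - 1) * (2 * ((1 / p) * (1 / q)) * (x \<bullet> y))"
      unfolding c(1)[symmetric] by (simp only: mult_ac)
    then show ?thesis using 2 unfolding c(2,3) by (simp only:)
  qed
  have "(norm (\<alpha> *\<^sub>R adjoint X a + \<beta> *\<^sub>R adjoint Y b))\<^sup>2 =
      \<alpha>\<^sup>2 * (norm x)\<^sup>2 + 2 * (\<alpha> * \<beta>) * (x \<bullet> y) + \<beta>\<^sup>2 * ((norm y)\<^sup>2 + (norm z)\<^sup>2)"
    unfolding adjoint_X adjoint_Y x_def[symmetric] y_def[symmetric] z_def[symmetric] power2_norm_eq_inner
    by (simp add: inner_prod_def inner_add_left inner_add_right inner_commute power2_eq_square algebra_simps)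
  also have "\<dots> \<le> \<alpha> * (norm x)\<^sup>2 + \<beta> * ((norm y)\<^sup>2 + (norm z)\<^sup>2)"
    using 3 by (simp add: algebra_simps)
  also have "\<dots> = \<alpha> * (norm (adjoint X a))\<^sup>2 + \<beta> * (norm (adjoint Y b))\<^sup>2"
    unfolding adjoint_X adjoint_Y x_def[symmetric] y_def[symmetric] z_def[symmetric] by (simp add: norm_prod_def)
  finally show "(norm ((1 - 1 / p) *\<^sub>R adjoint X a + (1 / q) *\<^sub>R adjoint Y b))\<^sup>2
        \<le> (1 - 1 / p) * (norm (adjoint X a))\<^sup>2 + 1 / q * (norm (adjoint Y b))\<^sup>2"
    unfolding \<alpha>_def \<beta>_def .
qed (use p q linear_X linear_Y in \<open>simp_all\<close>)

lemma msqrt_inverse: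
  assumes "pos_def Q" shows "msqrt Q *v (matrix_inv (msqrt Q) *v y) = y" "matrix_inv (msqrt Q) *v (msqrt Q *v y) = y"
proof -
  have "invertible (msqrt Q)"
    using inj_msqrt[OF assms] matrix_left_invertible_injective invertible_left_inverse by blast
  note matrix_inv_invertible[OF this]
  then
  show "msqrt Q *v (matrix_inv (msqrt Q) *v y) = y" "matrix_inv (msqrt Q) *v (msqrt Q *v y) = y"
    by (simp_all add: matrix_vector_mul_assoc)
qed

text \<open>\<open>Y\<close> is built from two independent noises, \<open>nu\<close> at time
  \<open>t\<close> from one square root. Multiplication by the inverse of \<open>msqrt Qt\<close>
  turns the covariance identity \<open>Qt_eq\<close> into the normalisation asked for by
  \<open>distr_std_gauss_linear_sum\<close>.\<close>

lemma distr_Y: "distr std_gauss borel Y = distr std_gauss borel ((*v) (msqrt Qt))"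
proof -
  let ?I = "matrix_inv (msqrt Qt)"
  define N1 where "N1 = ?I ** V ** msqrt Qs"
  define N2 where "N2 = ?I ** msqrt Q2"
  have adj: "adjoint ((*v) M) = (*v) (transpose M)" for M :: "real^'n^'n"
    using adjoint_matrix[of M] .
  have "distr (std_gauss \<Otimes>\<^sub>M std_gauss) borel (\<lambda>(x, z). N1 *v x + N2 *v z) = std_gauss"
  proof (rule distr_std_gauss_linear_sum[where R = "\<lambda>y. matrix_inv (msqrt Q2) *v (msqrt Qt *v y)"])
    show "N2 *v (matrix_inv (msqrt Q2) *v (msqrt Qt *v y)) = y" for y
      unfolding N2_def by (simp add: matrix_vector_mul_assoc[symmetric] msqrt_inverse Q2 Qt)
    fix w
    define u where "u = transpose ?I *v w"
    have "transpose N1 *v w = msqrt Qs *v (transpose V *v u)" "transpose N2 *v w = msqrt Q2 *v u"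
      unfolding N1_def N2_def u_def matrix_transpose_mul transpose_msqrt[OF Qs] transpose_msqrt[OF Q2]
      by (simp_all only: matrix_vector_mul_assoc matrix_mul_assoc)
    then have "(norm (transpose N1 *v w))\<^sup>2 + (norm (transpose N2 *v w))\<^sup>2 = (norm (msqrt Qt *v u))\<^sup>2"
      by (simp only: norm_adjoint_Y norm_msqrt_mult[OF Qt])
    also have "msqrt Qt *v u = w"
    proof (rule vector_eq_ldot[THEN iffD1], intro allI)
      fix z
      have "z \<bullet> (msqrt Qt *v u) = (msqrt Qt *v z) \<bullet> u"
        by (simp only: inner_matrix_vector_left transpose_msqrt[OF Qt])
      also have "\<dots> = (?I *v (msqrt Qt *v z)) \<bullet> w" unfolding u_def by (rule inner_matrix_vector_left[symmetric])
      finally show "z \<bullet> (msqrt Qt *v u) = z \<bullet> w" by (simp only: msqrt_inverse(2)[OF Qt])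
    qed
    finally show "(norm (adjoint ((*v) N1) w))\<^sup>2 + (norm (adjoint ((*v) N2) w))\<^sup>2 = (norm w)\<^sup>2"
      by (simp only: adj)
  qed (simp_all add: matrix_vector_mul_linear)
  then have "distr std_gauss borel ((*v) (msqrt Qt)) =
      distr (distr (std_gauss \<Otimes>\<^sub>M std_gauss) borel (\<lambda>(x, z). N1 *v x + N2 *v z)) borel ((*v) (msqrt Qt))"
    by simp
  also have "\<dots> = distr std_gauss borel (((*v) (msqrt Qt)) \<circ> (\<lambda>(x, z). N1 *v x + N2 *v z))"
    unfolding std_gauss_prod[symmetric]
    by (rule distr_distr) measurable
  also have "((*v) (msqrt Qt)) \<circ> (\<lambda>(x, z). N1 *v x + N2 *v z) = Y"
  proof
    fix w
    show "(((*v) (msqrt Qt)) \<circ> (\<lambda>(x, z). N1 *v x + N2 *v z)) w = Y w"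
      by (cases w) (simp add: Y_def X_def N1_def N2_def matrix_vector_right_distrib
          matrix_vector_mul_assoc[symmetric] msqrt_inverse[OF Qt])
  qed
  finally show ?thesis ..
qed

lemma measurable_XY [measurable]: "X \<in> borel_measurable borel" "Y \<in> borel_measurable borel"
  by (intro linear_borel_measurable linear_X linear_Y)+

text \<open>\<open>X\<close> depends on the first component alone, so the null set is avoided for
  almost every first component and every second one; \<open>AE_Y\<close> goes through the law of
  \<open>Y\<close> instead.\<close>

lemma AE_X:
  assumes "AE x in lborel. P x" shows "AE w in std_gauss. P (X w)"
proof -
  from assms obtain N where N: "\<And>x. x \<in> space lborel - N \<Longrightarrow> P x" "N \<in> null_sets lborel" by (rule AE_E3) blast
  have "AE x in std_gauss. msqrt Qs *v x \<notin> N"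
    by (rule AE_std_gauss_linear[where R = "(*v) (matrix_inv (msqrt Qs))"])
      (simp_all add: matrix_vector_mul_linear msqrt_inverse(1)[OF Qs] N(2))
  then have "AE x in std_gauss. AE z in (std_gauss :: (real^'n) measure). X (x, z) \<notin> N" by (simp add: X_def)
  then have "AE w in std_gauss \<Otimes>\<^sub>M std_gauss. X w \<notin> N"
  proof (rule std_gauss_pair.AE_pair_measure[rotated])
    have [measurable]: "N \<in> sets borel" using N by auto
    show "{w \<in> space (std_gauss \<Otimes>\<^sub>M std_gauss). X w \<notin> N} \<in> sets (std_gauss \<Otimes>\<^sub>M std_gauss)"
      unfolding std_gauss_prod by measurable
  qed
  then show ?thesis unfolding std_gauss_prod by eventually_elim (use N(1) in auto)
qed

lemma AE_Y:
  assumes "AE x in lborel. P x" shows "AE w in std_gauss. P (Y w)"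
proof -
  from assms obtain N where N: "\<And>x. x \<in> space lborel - N \<Longrightarrow> P x" "N \<in> null_sets lborel" by (rule AE_E3) blast
  have [measurable]: "N \<in> sets borel" using N by auto
  have "AE x in std_gauss. msqrt Qt *v x \<notin> N"
    by (rule AE_std_gauss_linear[where R = "(*v) (matrix_inv (msqrt Qt))"])
      (simp_all add: matrix_vector_mul_linear msqrt_inverse(1)[OF Qt] N(2))
  then have "AE x in distr std_gauss borel ((*v) (msqrt Qt)). x \<notin> N" by (subst AE_distr_iff) auto
  then have "AE w in std_gauss. Y w \<notin> N" unfolding distr_Y[symmetric] by (subst (asm) AE_distr_iff) auto
  then show ?thesis by eventually_elim (use N(1) in auto)
qed

text \<open>\<open>Pst\<close> with the means removed, as an integral over the noise alone.\<close>

definition T :: "(real^'n \<Rightarrow> real) \<Rightarrow> real^'n \<Rightarrow> real" where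
  "T \<phi> x = (\<integral>z. \<phi> (V *v x + msqrt Q2 *v z) \<partial>std_gauss)"

lemma measurable_T [measurable]:
  assumes [measurable]: "\<phi> \<in> borel_measurable borel"
  shows "T \<phi> \<in> borel_measurable borel"
  unfolding T_def[abs_def] by (rule borel_measurable_integral_std_gauss) measurable

lemma integral_Y:
  fixes \<phi> :: "real^'n \<Rightarrow> real"
  assumes [measurable]: "\<phi> \<in> borel_measurable borel"
  shows "(\<integral>w. \<phi> (Y w) \<partial>std_gauss) = (\<integral>x. \<phi> (msqrt Qt *v x) \<partial>std_gauss)"
proof -
  have "(\<integral>w. \<phi> (Y w) \<partial>std_gauss) = (\<integral>x. \<phi> x \<partial>distr std_gauss borel Y)" by (subst integral_distr) auto
  also have "\<dots> = (\<integral>x. \<phi> (msqrt Qt *v x) \<partial>std_gauss)" unfolding distr_Y by (subst integral_distr) auto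
  finally show ?thesis .
qed

text \<open>For \<open>F = (T \<phi>)^p\<close> and \<open>G = \<phi>^q\<close> the integrand on the
  left is the power \<open>p - 1\<close> of \<open>T \<phi>\<close> at \<open>X\<close> times
  \<open>\<phi>\<close> at \<open>Y\<close>, and integrating out the noise restores the power
  \<open>p\<close>. Thus \<open>I <= I^(1 - 1/p) J^(1/q)\<close>, and it remains to cancel the
  positive power of \<open>I\<close>.\<close>

lemma hypercontractive_bounded:
  assumes [measurable]: "\<phi> \<in> borel_measurable borel" and e: "0 < e" and b: "\<And>x. e \<le> \<phi> x" "\<And>x. \<phi> x \<le> M"
  shows "(\<integral>x. T \<phi> (msqrt Qs *v x) powr p \<partial>std_gauss) \<le> (\<integral>x. \<phi> (msqrt Qt *v x) powr q \<partial>std_gauss) powr (p / q)"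
proof -
  let ?h = "\<lambda>x z. T \<phi> (X (x, z)) powr (p - 1) * \<phi> (Y (x, z))"
  interpret gauss_pair X Y "1 - 1 / p" "1 / q" by (rule gauss_pair)
  have a\<phi>: "\<bar>\<phi> x\<bar> \<le> M" for x using b[of x] e by auto
  have i\<phi>: "integrable std_gauss (\<lambda>z. \<phi> (V *v x + msqrt Q2 *v z))" for x
    by (rule integrable_std_gauss_bounded[where K = M]) (use a\<phi> in auto)
  have bT: "e \<le> T \<phi> x" "T \<phi> x \<le> M" for x
    unfolding T_def using b i\<phi> by (auto intro!: std_gauss.integral_ge_const std_gauss.integral_le_const)
  define F where "F x = T \<phi> x powr p" for x
  define G where "G x = \<phi> x powr q" for x
  have [measurable]: "F \<in> borel_measurable borel" "G \<in> borel_measurable borel"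
    unfolding F_def[abs_def] G_def[abs_def] by measurable
  \<comment> \<open>\<open>measurable_inequality\<close> takes one pair of bounds for both
    functions.\<close>
  define e' where "e' = min (e powr p) (e powr q)"
  define M' where "M' = max (M powr p) (M powr q)"
  have e': "0 < e'" using e by (simp add: e'_def)
  have bF: "e' \<le> F x" "F x \<le> M'" for x
  proof -
    have "e powr p \<le> F x" "F x \<le> M powr p" unfolding F_def using bT[of x] e p by (auto intro!: powr_mono2)
    then show "e' \<le> F x" "F x \<le> M'" by (auto simp: e'_def M'_def)
  qed
  have aF: "\<bar>F x\<bar> \<le> M'" for x using bF[of x] e' by auto
  have bG: "e' \<le> G x" "G x \<le> M'" for x
  proof -
    have "e powr q \<le> G x" "G x \<le> M powr q" unfolding G_def using b[of x] e q by (auto intro!: powr_mono2)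
    then show "e' \<le> G x" "G x \<le> M'" by (auto simp: e'_def M'_def)
  qed
  define I where "I = (\<integral>x. T \<phi> (msqrt Qs *v x) powr p \<partial>std_gauss)"
  define J where "J = (\<integral>x. \<phi> (msqrt Qt *v x) powr q \<partial>std_gauss)"
  have T0: "0 < T \<phi> x" and \<phi>0: "0 < \<phi> x" for x using bT(1)[of x] b(1)[of x] e by auto
  have FG: "F (X w) powr (1 - 1 / p) * G (Y w) powr (1 / q) = T \<phi> (X w) powr (p - 1) * \<phi> (Y w)" for w
    using p q \<phi>0[of "Y w"] by (simp add: F_def G_def powr_powr right_diff_distrib less_imp_le)
  have iTY: "integrable (std_gauss \<Otimes>\<^sub>M std_gauss) (\<lambda>(x, z). ?h x z)"
    unfolding std_gauss_prod
  proof (rule integrable_std_gauss_bounded[where K = "M powr (p - 1) * M"])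
    show "(\<lambda>(x, z). ?h x z) \<in> borel_measurable borel"
      by (simp add: case_prod_unfold)
    show "norm (case w of (x, z) \<Rightarrow> ?h x z) \<le> M powr (p - 1) * M" for w
      using bT[of "X w"] b[of "Y w"] e p by (auto simp: abs_mult split: prod.split intro!: mult_mono powr_mono2)
  qed
  have "(\<integral>w. F (X w) powr (1 - 1 / p) * G (Y w) powr (1 / q) \<partial>std_gauss) =
      (\<integral>x. (\<integral>z. ?h x z \<partial>std_gauss) \<partial>std_gauss)"
    unfolding FG std_gauss_pair.integral_fst[OF iTY] by (simp add: std_gauss_prod case_prod_unfold)
  also have "\<dots> = I"
    unfolding I_def
  proof (intro Bochner_Integration.integral_cong refl)
    fix x
    have "(\<integral>z. ?h x z \<partial>std_gauss) = T \<phi> (msqrt Qs *v x) powr (p - 1) * T \<phi> (msqrt Qs *v x)"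
      by (simp add: X_def Y_def T_def)
    also have "\<dots> = T \<phi> (msqrt Qs *v x) powr p"
      using T0[of "msqrt Qs *v x"] by (simp add: powr_mult_base powr_diff)
    finally show "(\<integral>z. ?h x z \<partial>std_gauss) = T \<phi> (msqrt Qs *v x) powr p" .
  qed
  finally have lhs: "(\<integral>w. F (X w) powr (1 - 1 / p) * G (Y w) powr (1 / q) \<partial>std_gauss) = I" .
  have intF: "integrable (std_gauss \<Otimes>\<^sub>M std_gauss) (\<lambda>(x, z). F (X (x, z)))"
    unfolding std_gauss_prod
    by (rule integrable_std_gauss_bounded[where K = M']) (use aF in \<open>auto simp: case_prod_unfold\<close>)
  have EF: "(\<integral>w. F (X w) \<partial>std_gauss) = I"
    using std_gauss_pair.integral_fst[OF intF] by (simp add: std_gauss_prod case_prod_unfold I_def F_def X_def)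
  have EG: "(\<integral>w. G (Y w) \<partial>std_gauss) = J"
    unfolding J_def by (subst integral_Y) (simp_all add: G_def)
  have "I \<le> I powr (1 - 1 / p) * J powr (1 / q)"
    using measurable_inequality[where F = F and G = G, OF e' _ _ bF bG AE_X AE_Y] unfolding lhs EF EG by simp
  moreover have I0: "0 < I"
  proof -
    have "e' \<le> (\<integral>w. F (X w) \<partial>std_gauss)"
      using bF aF by (intro std_gauss.integral_ge_const integrable_std_gauss_bounded[where K = M']) auto
    then show ?thesis using e' EF by simp
  qed
  moreover have "I powr (1 - 1 / p) * I powr (1 / p) = I" using I0 by (simp add: powr_add[symmetric])
  ultimately have "I powr (1 - 1 / p) * I powr (1 / p) \<le> I powr (1 - 1 / p) * J powr (1 / q)" by simp
  then have "I powr (1 / p) \<le> J powr (1 / q)" using I0 by simp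
  then have "(I powr (1 / p)) powr p \<le> (J powr (1 / q)) powr p" using p by (intro powr_mono2) auto
  then show ?thesis using I0 p by (simp add: powr_powr I_def[symmetric] J_def[symmetric])
qed

text \<open>The \<open>p\<close>-integrability of \<open>T \<phi>\<close> is part of the claim, so
  the bounded case is applied to truncations of \<open>|\<phi>|\<close>, with Fatou's lemma on the
  left and dominated convergence on the right. The sign returns through
  \<open>|T \<phi>| <= T |\<phi>|\<close>.\<close>

lemma hypercontractive:
  assumes [measurable]: "\<phi> \<in> borel_measurable borel"
    and Lq: "integrable std_gauss (\<lambda>x. \<bar>\<phi> (msqrt Qt *v x)\<bar> powr q)"
  shows "AE x in std_gauss. integrable std_gauss (\<lambda>z. \<phi> (V *v (msqrt Qs *v x) + msqrt Q2 *v z))" (is ?AE)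
    and "integrable std_gauss (\<lambda>x. \<bar>T \<phi> (msqrt Qs *v x)\<bar> powr p)" (is ?int)
    and "(\<integral>x. \<bar>T \<phi> (msqrt Qs *v x)\<bar> powr p \<partial>std_gauss) powr (1 / p)
      \<le> (\<integral>x. \<bar>\<phi> (msqrt Qt *v x)\<bar> powr q \<partial>std_gauss) powr (1 / q)" (is ?le)
proof -
  let ?S = "\<lambda>x. msqrt Qs *v x" and ?R = "\<lambda>x. msqrt Qt *v x"
  \<comment> \<open>On a probability space \<open>L^q\<close> lies in \<open>L^1\<close>; with
    Fubini's theorem the integral defining \<open>T \<phi>\<close> then exists for almost every
    starting point.\<close>
  have le1: "s \<le> 1 + s powr q" if "0 \<le> s" for s :: real
  proof (cases "s \<le> 1")
    case True then show ?thesis by (simp add: add_increasing2)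
  next
    case False
    then have "s powr 1 \<le> s powr q" using q by (intro powr_mono) auto
    with False show ?thesis by simp
  qed
  have "integrable std_gauss (\<lambda>x. \<phi> (?R x))"
  proof (rule Bochner_Integration.integrable_bound)
    show "integrable std_gauss (\<lambda>x. 1 + \<bar>\<phi> (?R x)\<bar> powr q)" using Lq by simp
    show "AE x in std_gauss. norm (\<phi> (?R x)) \<le> norm (1 + \<bar>\<phi> (?R x)\<bar> powr q)"
      using le1[OF abs_ge_zero] by (simp add: abs_of_nonneg add_nonneg_nonneg)
  qed measurable
  then have "integrable (distr std_gauss borel ((*v) (msqrt Qt))) \<phi>" by (subst integrable_distr_eq) auto
  then have "integrable std_gauss (\<lambda>w. \<phi> (Y w))" unfolding distr_Y[symmetric] by (subst (asm) integrable_distr_eq) auto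
  then have "integrable (std_gauss \<Otimes>\<^sub>M std_gauss) (\<lambda>(x, z). \<phi> (Y (x, z)))"
    by (simp add: std_gauss_prod case_prod_unfold)
  from std_gauss_pair.AE_integrable_fst[OF this] show AE: ?AE by (simp add: Y_def X_def)

  \<comment> \<open>Truncation gives the upper bound, the added \<open>1 / (n + 1)\<close> the
    positive lower bound of the bounded case. The sequence need not be monotone in
    \<open>n\<close>.\<close>
  define \<phi>s where "\<phi>s n x = min \<bar>\<phi> x\<bar> (real n) + inverse (real (Suc n))" for n x
  have [measurable]: "\<phi>s n \<in> borel_measurable borel" for n unfolding \<phi>s_def[abs_def] by measurable
  have b: "inverse (real (Suc n)) \<le> \<phi>s n x" "\<phi>s n x \<le> real n + 1" "\<phi>s n x \<le> \<bar>\<phi> x\<bar> + 1" "0 \<le> \<phi>s n x" for n x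
  proof -
    have i: "inverse (real (Suc n)) \<le> 1" "0 < inverse (real (Suc n))" by (simp_all add: field_simps)
    show "inverse (real (Suc n)) \<le> \<phi>s n x" by (simp add: \<phi>s_def)
    then show "0 \<le> \<phi>s n x" using i by linarith
    show "\<phi>s n x \<le> real n + 1" "\<phi>s n x \<le> \<bar>\<phi> x\<bar> + 1"
      unfolding \<phi>s_def using i by (intro add_mono; simp)+
  qed
  have lim: "(\<lambda>n. \<phi>s n x) \<longlonglongrightarrow> \<bar>\<phi> x\<bar>" for x
  proof -
    have "(\<lambda>n. min \<bar>\<phi> x\<bar> (real n)) \<longlonglongrightarrow> \<bar>\<phi> x\<bar>"
    proof (rule tendsto_eventually)
      obtain N where "\<bar>\<phi> x\<bar> \<le> real N" using real_arch_simple by blast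
      then show "\<forall>\<^sub>F n in sequentially. min \<bar>\<phi> x\<bar> (real n) = \<bar>\<phi> x\<bar>"
        by (intro eventually_sequentiallyI[of N]) (auto simp: min_def)
    qed
    from tendsto_add[OF this LIMSEQ_inverse_real_of_nat] show ?thesis by (simp add: \<phi>s_def)
  qed
  define J where "J = (\<integral>x. \<bar>\<phi> (?R x)\<bar> powr q \<partial>std_gauss)"
  define Js where "Js n = (\<integral>x. \<phi>s n (?R x) powr q \<partial>std_gauss)" for n
  have J0: "0 \<le> J" "0 \<le> Js n" for n unfolding J_def Js_def by simp_all
  have "Js \<longlonglongrightarrow> J"
    unfolding Js_def[abs_def] J_def
  proof (rule integral_dominated_convergence[where w = "\<lambda>x. 2 powr q * (\<bar>\<phi> (?R x)\<bar> powr q + 1)"])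
    show "AE x in std_gauss. (\<lambda>n. \<phi>s n (?R x) powr q) \<longlonglongrightarrow> \<bar>\<phi> (?R x)\<bar> powr q"
      using q b(4) lim by (intro always_eventually allI tendsto_powr2) auto
    \<comment> \<open>With \<open>\<phi>s n <= |\<phi>| + 1\<close> this yields a dominating
      function independent of \<open>n\<close>.\<close>
    have "(s + 1) powr q \<le> 2 powr q * (s powr q + 1)" if "0 \<le> s" for s :: real
    proof -
      have "(s + 1) powr q \<le> (2 * max s 1) powr q" using that q by (intro powr_mono2) auto
      also have "\<dots> = 2 powr q * (max s 1) powr q" by (simp add: powr_mult)
      also have "\<dots> \<le> 2 powr q * (s powr q + 1)" by (intro mult_left_mono) (auto simp: max_def)
      finally show ?thesis .
    qed
    from order_trans[OF powr_mono2[OF _ b(4) b(3)] this] q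
    show "AE x in std_gauss. norm (\<phi>s n (?R x) powr q) \<le> 2 powr q * (\<bar>\<phi> (?R x)\<bar> powr q + 1)" for n
      by simp
  qed (use Lq in auto)
  then have limJ: "(\<lambda>n. ennreal (Js n powr (p / q))) \<longlonglongrightarrow> ennreal (J powr (p / q))"
    using p q J0 by (intro tendsto_ennrealI tendsto_powr2) auto
  have Is: "(\<integral>\<^sup>+x. ennreal (T (\<phi>s n) (?S x) powr p) \<partial>std_gauss) \<le> ennreal (Js n powr (p / q))" for n
  proof -
    have T0: "0 \<le> T (\<phi>s n) x" "T (\<phi>s n) x \<le> real n + 1" for x
      unfolding T_def using b(2,4)[of n]
      by (auto intro!: Bochner_Integration.integral_nonneg std_gauss.integral_le_const
          integrable_std_gauss_bounded[where K = "real n + 1"])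
    have "integrable std_gauss (\<lambda>x. T (\<phi>s n) (?S x) powr p)"
      by (rule integrable_std_gauss_bounded[where K = "(real n + 1) powr p"]) (use T0 p in \<open>auto intro!: powr_mono2\<close>)
    then have "(\<integral>\<^sup>+x. ennreal (T (\<phi>s n) (?S x) powr p) \<partial>std_gauss) =
        ennreal (\<integral>x. T (\<phi>s n) (?S x) powr p \<partial>std_gauss)"
      by (rule nn_integral_eq_integral) simp
    also have "\<dots> \<le> ennreal (Js n powr (p / q))"
      unfolding Js_def by (intro ennreal_leI hypercontractive_bounded[where e = "inverse (real (Suc n))" and M = "real n + 1"] b) auto
    finally show ?thesis .
  qed
  let ?T = "T (\<lambda>x. \<bar>\<phi> x\<bar>)"
  have "(\<integral>\<^sup>+x. ennreal (?T (?S x) powr p) \<partial>std_gauss) \<le>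
      (\<integral>\<^sup>+x. liminf (\<lambda>n. ennreal (T (\<phi>s n) (?S x) powr p)) \<partial>std_gauss)"
  proof (rule nn_integral_mono_AE)
    show "AE x in std_gauss. ennreal (?T (?S x) powr p) \<le> liminf (\<lambda>n. ennreal (T (\<phi>s n) (?S x) powr p))"
      using AE
    proof eventually_elim
      case (elim x)
      \<comment> \<open>Convergence holds at the starting points where \<open>|\<phi>|\<close> has a
        finite integral over the noise, hence almost everywhere.\<close>
      have "(\<lambda>n. T (\<phi>s n) (?S x)) \<longlonglongrightarrow> ?T (?S x)"
        unfolding T_def
      proof (rule integral_dominated_convergence[where w = "\<lambda>z. \<bar>\<phi> (V *v (?S x) + msqrt Q2 *v z)\<bar> + 1"])
        show "AE z in std_gauss. norm (\<phi>s n (V *v (?S x) + msqrt Q2 *v z))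
            \<le> \<bar>\<phi> (V *v (?S x) + msqrt Q2 *v z)\<bar> + 1" for n
          using b(3,4) by simp
      qed (use elim lim in auto)
      then have "(\<lambda>n. ennreal (T (\<phi>s n) (?S x) powr p)) \<longlonglongrightarrow> ennreal (?T (?S x) powr p)"
        using p b(4) by (intro tendsto_ennrealI tendsto_powr2) (auto simp: T_def intro!: always_eventually Bochner_Integration.integral_nonneg)
      from lim_imp_Liminf[OF sequentially_bot this] show ?case by simp
    qed
  qed
  also have "\<dots> \<le> liminf (\<lambda>n. \<integral>\<^sup>+x. ennreal (T (\<phi>s n) (?S x) powr p) \<partial>std_gauss)"
    by (rule nn_integral_liminf) measurable
  also have "\<dots> \<le> liminf (\<lambda>n. ennreal (Js n powr (p / q)))"
    by (rule Liminf_mono) (use Is in auto)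
  also have "\<dots> = ennreal (J powr (p / q))" by (rule lim_imp_Liminf[OF sequentially_bot limJ])
  finally have bound: "(\<integral>\<^sup>+x. ennreal (?T (?S x) powr p) \<partial>std_gauss) \<le> ennreal (J powr (p / q))" .
  have "(\<integral>\<^sup>+x. ennreal (\<bar>T \<phi> (?S x)\<bar> powr p) \<partial>std_gauss) \<le> (\<integral>\<^sup>+x. ennreal (?T (?S x) powr p) \<partial>std_gauss)"
    unfolding T_def using p by (intro nn_integral_mono ennreal_leI powr_mono2 integral_abs_bound) auto
  also note bound
  finally have nn: "(\<integral>\<^sup>+x. ennreal (\<bar>T \<phi> (?S x)\<bar> powr p) \<partial>std_gauss) \<le> ennreal (J powr (p / q))" .
  then show int: ?int
    by (intro integrableI_nonneg) (auto intro: le_less_trans)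
  have "ennreal (\<integral>x. \<bar>T \<phi> (?S x)\<bar> powr p \<partial>std_gauss) \<le> ennreal (J powr (p / q))"
    using nn nn_integral_eq_integral[OF int] by simp
  then have "(\<integral>x. \<bar>T \<phi> (?S x)\<bar> powr p \<partial>std_gauss) \<le> J powr (p / q)" by (simp add: ennreal_le_iff)
  then have "(\<integral>x. \<bar>T \<phi> (?S x)\<bar> powr p \<partial>std_gauss) powr (1 / p) \<le> (J powr (p / q)) powr (1 / p)"
    using p by (intro powr_mono2) auto
  then show ?le using p by (simp add: powr_powr J_def)
qed

end

section \<open>Translation back to \<open>nu\<close> and \<open>Pst\<close>\<close>

lemma gaussian_measure_eq:
  "gaussian_measure m Q = distr std_gauss borel (\<lambda>x. m + msqrt Q *v x)"
  by (simp add: gaussian_measure_def std_gaussian_eq)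

text \<open>\<open>AE_distr_iff\<close> asks for a measurable set; integrability is finiteness of a
  nonnegative integral that depends measurably on \<open>x\<close>.\<close>

lemma sets_integrable_std_gauss:
  fixes h :: "'a::euclidean_space \<Rightarrow> 'b::euclidean_space \<Rightarrow> real"
  assumes [measurable]: "(\<lambda>(x, z). h x z) \<in> borel_measurable (borel \<Otimes>\<^sub>M borel)"
  shows "{x. integrable std_gauss (h x)} \<in> sets borel"
proof -
  have "(\<lambda>x. \<integral>\<^sup>+z. ennreal (norm (h x z)) \<partial>std_gauss) \<in> borel_measurable borel"
    by (rule std_gauss.borel_measurable_nn_integral) measurable
  then have "{x \<in> space borel. (\<integral>\<^sup>+z. ennreal (norm (h x z)) \<partial>std_gauss) < \<infinity>} \<in> sets borel"
    by measurable
  moreover have "h x \<in> borel_measurable borel" for x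
    using measurable_Pair2[OF assms, of x] by simp
  ultimately show ?thesis by (simp add: integrable_iff_bounded)
qed

theorem theorem3p3:
  fixes A B :: "real \<Rightarrow> real^'n^'n" and f :: "real \<Rightarrow> real^'n"
    and U :: "real \<Rightarrow> real \<Rightarrow> real^'n^'n"
    and p :: "real \<Rightarrow> real" and q t s :: real and \<mu>0 :: real
    and \<phi> :: "real^'n \<Rightarrow> real"
  assumes contA: "continuous_on UNIV A" and bddA: "bounded (range A)"
    and contB: "continuous_on UNIV B" and bddB: "bounded (range B)"
    and contf: "continuous_on UNIV f" and bddf: "bounded (range f)"
    and mu0: "\<mu>0 > 0" and Bbelow: "\<And>r x. norm (B r *v x) \<ge> \<mu>0 * norm x"
    and U_id: "\<And>r. U r r = mat 1"
    and U_deriv: "\<And>\<tau> r. ((\<lambda>\<tau>. U \<tau> r) has_vector_derivative (A \<tau> ** U \<tau> r)) (at \<tau>)"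
    and stable: "\<exists>\<omega> M. \<omega> < 0 \<and> (\<forall>r \<tau>. r \<le> \<tau> \<longrightarrow> mat_opnorm (U \<tau> r) \<le> M * exp (\<omega> * (\<tau> - r)))"
    and q: "1 < q"
    and p_init: "p t = q"
    and p_ode: "\<And>r. r \<le> t \<Longrightarrow>
        (p has_real_derivative (- p r / cfun U B (p r) r)) (at r within {..t})"
    and st: "s < t"
    and phi_meas: "\<phi> \<in> borel_measurable borel"
    and phi_Lq: "integrable (nu U B f t) (\<lambda>y. \<bar>\<phi> y\<bar> powr q)"
  shows "(AE x in nu U B f s.
            integrable (gaussian_measure (U t s *v x + meanG U f t s) (covQ U B t s)) \<phi>)
         \<and> Pst U B f s t \<phi> \<in> borel_measurable borel
         \<and> integrable (nu U B f s) (\<lambda>x. \<bar>Pst U B f s t \<phi> x\<bar> powr p s)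
         \<and> (\<integral>x. \<bar>Pst U B f s t \<phi> x\<bar> powr p s \<partial>nu U B f s) powr (1 / p s)
             \<le> (\<integral>y. \<bar>\<phi> y\<bar> powr q \<partial>nu U B f t) powr (1 / q)"
proof -
  interpret stable_evolution A B f U \<mu>0
    by (rule stable_evolution.intro) (fact bddA contB bddB contf bddf mu0 Bbelow U_id U_deriv stable)+
  note [measurable] = phi_meas
  have pt: "1 < p t" using q p_init by simp
  interpret G: gauss_transition "U t s" "covQinf U B s" "covQ U B t s" "covQinf U B t" "p s" q
  proof (rule gauss_transition.intro)
    show "1 < p s" by (rule exponent_gt[OF pt p_ode]) (use st in auto)
    show "(p s - 1) * ((transpose (U t s) *v y) \<bullet> (covQinf U B s *v (transpose (U t s) *v y)))
      \<le> (q - 1) * (y \<bullet> (covQinf U B t *v y))" for y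
      using covariance_decay[OF less_imp_le[OF st] pt p_ode] p_init by simp
  qed (fact pos_def_covQinf pos_def_covQ[OF st] covQinf_split[OF less_imp_le[OF st]] q)+
  let ?g = "meanG U f t s" and ?ms = "meanGinf U f s" and ?mt = "meanGinf U f t"
  let ?Ss = "msqrt (covQinf U B s)" and ?S2 = "msqrt (covQ U B t s)" and ?St = "msqrt (covQinf U B t)"
  \<comment> \<open>Recentring at the mean of \<open>nu\<close> at time \<open>t\<close> removes the
    drift \<open>f\<close> from the rest of the argument.\<close>
  define \<psi> where "\<psi> y = \<phi> (?mt + y)" for y
  have [measurable]: "\<psi> \<in> borel_measurable borel" unfolding \<psi>_def[abs_def] by measurable
  have Lq: "integrable std_gauss (\<lambda>x. \<bar>\<psi> (?St *v x)\<bar> powr q)"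
    using phi_Lq unfolding nu_def gaussian_measure_eq by (subst (asm) integrable_distr_eq) (auto simp: \<psi>_def)
  have Jeq: "(\<integral>y. \<bar>\<phi> y\<bar> powr q \<partial>nu U B f t) = (\<integral>x. \<bar>\<psi> (?St *v x)\<bar> powr q \<partial>std_gauss)"
    unfolding nu_def gaussian_measure_eq by (subst integral_distr) (auto simp: \<psi>_def)
  \<comment> \<open>By \<open>meanGinf_split\<close> a start at the mean of \<open>nu\<close> at
    time \<open>s\<close> is carried to the mean at time \<open>t\<close>, so the recentred operator
    is exactly \<open>G.T\<close>.\<close>
  have shift: "U t s *v (?ms + ?Ss *v x) + ?g + ?S2 *v z = ?mt + (U t s *v (?Ss *v x) + ?S2 *v z)" for x z
    unfolding meanGinf_split[OF less_imp_le[OF st]] by (simp add: matrix_vector_right_distrib)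
  have P: "Pst U B f s t \<phi> x = (\<integral>z. \<phi> (U t s *v x + ?g + ?S2 *v z) \<partial>std_gauss)" for x
    unfolding Pst_def gaussian_measure_eq by (subst integral_distr) auto
  have PT: "Pst U B f s t \<phi> (?ms + ?Ss *v x) = G.T \<psi> (?Ss *v x)" for x
    unfolding P shift G.T_def \<psi>_def ..
  have int_iff: "integrable (gaussian_measure (U t s *v x + ?g) (covQ U B t s)) \<phi> \<longleftrightarrow>
      integrable std_gauss (\<lambda>z. \<phi> (U t s *v x + ?g + ?S2 *v z))" for x
    unfolding gaussian_measure_eq by (subst integrable_distr_eq) auto
  have meas_P [measurable]: "Pst U B f s t \<phi> \<in> borel_measurable borel"
    unfolding P[abs_def] by (rule borel_measurable_integral_std_gauss) measurable
  have "AE x in nu U B f s. integrable (gaussian_measure (U t s *v x + ?g) (covQ U B t s)) \<phi>"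
    unfolding int_iff unfolding nu_def gaussian_measure_eq
  proof (subst AE_distr_iff)
    show "{x \<in> space borel. integrable std_gauss (\<lambda>z. \<phi> (U t s *v x + ?g + ?S2 *v z))} \<in> sets borel"
      using sets_integrable_std_gauss[of "\<lambda>x z. \<phi> (U t s *v x + ?g + ?S2 *v z)"] by simp
    show "AE x in std_gauss. integrable std_gauss (\<lambda>z. \<phi> (U t s *v (?ms + ?Ss *v x) + ?g + ?S2 *v z))"
      unfolding shift using G.hypercontractive(1)[OF _ Lq] by (simp add: \<psi>_def)
  qed measurable
  moreover have "integrable (nu U B f s) (\<lambda>x. \<bar>Pst U B f s t \<phi> x\<bar> powr p s)"
    unfolding nu_def gaussian_measure_eq
    by (subst integrable_distr_eq) (use G.hypercontractive(2)[OF _ Lq] in \<open>auto simp: PT\<close>)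
  moreover have "(\<integral>x. \<bar>Pst U B f s t \<phi> x\<bar> powr p s \<partial>nu U B f s) = (\<integral>x. \<bar>G.T \<psi> (?Ss *v x)\<bar> powr p s \<partial>std_gauss)"
    unfolding nu_def gaussian_measure_eq by (subst integral_distr) (auto simp: PT)
  ultimately show ?thesis
    using G.hypercontractive(3)[OF _ Lq] meas_P Jeq by simp
qed

end
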